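(* Every irreducible self-representation (group homomorphism, not assumed continuous) $\varrho\colon\mathrm{Is}(\mathbf{H}^\infty)\to\mathrm{Is}(\mathbf{H}^\infty)$ is conjugated (by an element of the target group $\mathrm{Is}(\mathbf{H}^\infty)$) to $\varrho^\infty_t$ for a unique $t\in(0,1]$.
   Context: Let $H$ be a separable infinite-dimensional real Hilbert space and let $B$ be the bilinear form on $\mathbf{R}\oplus H$ given by $B(s\oplus h,s'\oplus h')=ss'-\langle h,h'\rangle$. The infinite-dimensional real hyperbolic space is $\mathbf{H}^\infty=\{x=s\oplus h: B(x,x)=1,\ s>0\}$ with metric $d$ given by $\cosh d(x,y)=B(x,y)$. Its isometry group $\mathrm{Is}(\mathbf{H}^\infty)$ is endowed with the (Polish) topology of pointwise convergence. Every isometry of $\mathbf{H}^\infty$ is the restriction of a unique invertible linear operator of $\mathbf{R}\oplus H$ preserving $B$ and $\mathbf{H}^\infty$, so $\mathrm{Is}(\mathbf{H}^\infty)\cong \mathbf{O}_+(B)$. A representation $G\to \mathrm{Is}(\mathbf{H}^\infty)$ is irreducible if the associated linear representation on $\mathbf{R}\oplus H$ has no closed invariant linear subspaces other than $0$ and the whole space. For $0<t\le 1$, $\varrho^\infty_t\colon \mathrm{Is}(\mathbf{H}^\infty)\to \mathrm{Is}(\mathbf{H}^\infty)$ denotes a continuous irreducible self-representation for which there is a map $f^\infty_t\colon\mathbf{H}^\infty\to\mathbf{H}^\infty$ with $f^\infty_t(gx)=\varrho^\infty_t(g)f^\infty_t(x)$ for all $g\in\mathrm{Is}(\mathbf{H}^\infty)$,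 $x\in\mathbf{H}^\infty$, and $\cosh d(f^\infty_t(x),f^\infty_t(y))=(\cosh d(x,y))^t$ for all $x,y\in\mathbf{H}^\infty$. Such a representation exists for each $t\in(0,1]$ and is unique up to conjugacy. *)

theory Defs
  imports "HOL-Analysis.Analysis" "HOL-Algebra.Bij"
begin

section \<open>The hyperbolic space\<close>

definition hyp_form :: "real \<times> 'h::real_inner \<Rightarrow> real \<times> 'h \<Rightarrow> real"
  where "hyp_form x y = fst x * fst y - snd x \<bullet> snd y"

definition hyp_space :: "(real \<times> 'h::real_inner) set"
  where "hyp_space = {x. hyp_form x x = 1 \<and> fst x > 0}"

text \<open>The value \<open>0\<close> off the hyperbolic space is there because the locale \<open>Metric_space\<close> asks for
  nonnegativity on the whole type.\<close>

definition hyp_dist :: "real \<times> 'h::real_inner \<Rightarrow> real \<times> 'h \<Rightarrow> real"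
  where "hyp_dist x y =
    (if x \<in> hyp_space \<and> y \<in> hyp_space then arcosh (hyp_form x y) else 0)"

lemma hyp_form_simps:
  "hyp_form (x + y) z = hyp_form x z + hyp_form y z"
  "hyp_form z (x + y) = hyp_form z x + hyp_form z y"
  "hyp_form (x - y) z = hyp_form x z - hyp_form y z"
  "hyp_form z (x - y) = hyp_form z x - hyp_form z y"
  "hyp_form (c *\<^sub>R x) z = c * hyp_form x z"
  "hyp_form z (c *\<^sub>R x) = c * hyp_form z x"
  by (simp_all add: hyp_form_def inner_simps algebra_simps)

lemma hyp_form_commute: "hyp_form x y = hyp_form y x"
  by (simp add: hyp_form_def inner_commute mult.commute)

lemma hyp_form_ge_1:
  assumes "x \<in> hyp_space" "y \<in> hyp_space"
  shows "hyp_form x y \<ge> 1"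
proof -
  define a b s s' where "a = norm (snd x)" "b = norm (snd y)" "s = fst x" "s' = fst y"
  note d = this
  have s: "s\<^sup>2 = 1 + a\<^sup>2" "s'\<^sup>2 = 1 + b\<^sup>2" "s > 0" "s' > 0" "a \<ge> 0" "b \<ge> 0"
    using assms
    by (auto simp: d hyp_space_def hyp_form_def power2_eq_square[of "fst _"] power2_norm_eq_inner)
  have "(1 + a * b)\<^sup>2 \<le> (s * s')\<^sup>2"
    using zero_le_power2[of "a - b"] unfolding power_mult_distrib s(1,2)
    by (simp add: power2_eq_square algebra_simps)
  then have "1 + a * b \<le> s * s'"
    by (rule power2_le_imp_le) (simp add: s(3,4) less_imp_le)
  moreover have "snd x \<bullet> snd y \<le> a * b"
    using norm_cauchy_schwarz d by blast
  ultimately show ?thesis by (simp add: hyp_form_def d)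
qed

lemma cosh_hyp_dist:
  "x \<in> hyp_space \<Longrightarrow> y \<in> hyp_space \<Longrightarrow> cosh (hyp_dist x y) = hyp_form x y"
  by (simp add: hyp_dist_def hyp_form_ge_1)

lemma hyp_form_orthogonal_neg:
  assumes "y \<in> hyp_space" "hyp_form v y = 0" "v \<noteq> 0"
  shows "hyp_form v v < 0"
proof -
  define s where "s = fst y"
  define a where "a = norm (snd v)"
  define b where "b = norm (snd y)"
  have s: "s\<^sup>2 = 1 + b\<^sup>2" "s > 0"
    using assms(1)
    by (auto simp: s_def b_def hyp_space_def hyp_form_def power2_eq_square[of "fst y"] power2_norm_eq_inner)
  have "fst v * s = snd v \<bullet> snd y"
    using assms(2) by (simp add: hyp_form_def s_def)
  then have "(fst v * s)\<^sup>2 \<le> (a * b)\<^sup>2"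
    by (metis Cauchy_Schwarz_ineq2 a_def b_def abs_ge_zero power2_abs power_mono)
  then have le: "(fst v)\<^sup>2 + (fst v)\<^sup>2 * b\<^sup>2 \<le> a\<^sup>2 * b\<^sup>2"
    by (simp add: power_mult_distrib s algebra_simps)
  have "(fst v)\<^sup>2 < a\<^sup>2"
  proof (rule ccontr)
    assume c: "\<not> (fst v)\<^sup>2 < a\<^sup>2"
    then have "a\<^sup>2 * b\<^sup>2 \<le> (fst v)\<^sup>2 * b\<^sup>2" by (intro mult_right_mono) auto
    with le have "(fst v)\<^sup>2 \<le> 0" by linarith
    then have "fst v = 0" by simp
    with c have "snd v = 0" by (simp add: a_def)
    with \<open>fst v = 0\<close> assms(3) show False by (simp add: prod_eq_iff)
  qed
  then show ?thesis
    by (simp add: hyp_form_def a_def power2_norm_eq_inner power2_eq_square[of "fst _"])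
qed

lemma Metric_space_hyp: "Metric_space hyp_space hyp_dist"
proof
  show "0 \<le> hyp_dist x y" for x y :: "real \<times> 'a"
    by (simp add: hyp_dist_def hyp_form_ge_1)
  show "hyp_dist x y = hyp_dist y x" for x y :: "real \<times> 'a"
    by (simp add: hyp_dist_def hyp_form_commute)
next
  fix x y :: "real \<times> 'a"
  assume xy: "x \<in> hyp_space" "y \<in> hyp_space"
  have "hyp_form x y = 1 \<longleftrightarrow> x = y"
  proof
    assume eq: "hyp_form x y = 1"
    have "hyp_form x x = 1" "hyp_form y y = 1" using xy by (auto simp: hyp_space_def)
    then have "hyp_form (x - y) y = 0" "hyp_form (x - y) (x - y) = 0"
      using eq by (auto simp: hyp_form_simps hyp_form_commute[of y x])
    then show "x = y" using hyp_form_orthogonal_neg[OF xy(2), of "x - y"] by auto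
  qed (use xy in \<open>auto simp: hyp_space_def\<close>)
  then show "hyp_dist x y = 0 \<longleftrightarrow> x = y"
    using xy by (simp add: hyp_dist_def hyp_form_ge_1)
next
  fix x y z :: "real \<times> 'a"
  assume xyz: "x \<in> hyp_space" "y \<in> hyp_space" "z \<in> hyp_space"
  define a where "a = hyp_form x y"
  define b where "b = hyp_form y z"
  define u where "u = x - a *\<^sub>R y"
  define v where "v = z - b *\<^sub>R y"
  have one: "hyp_form x x = 1" "hyp_form y y = 1" "hyp_form z z = 1"
    using xyz by (auto simp: hyp_space_def)
  have ab: "a \<ge> 1" "b \<ge> 1" using xyz by (auto simp: a_def b_def hyp_form_ge_1)
  have u: "hyp_form u y = 0" "hyp_form u u = 1 - a\<^sup>2"
    by (auto simp: u_def hyp_form_simps one a_def hyp_form_commute[of y x] power2_eq_square algebra_simps)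
  have v: "hyp_form v y = 0" "hyp_form v v = 1 - b\<^sup>2"
    by (auto simp: v_def hyp_form_simps one b_def hyp_form_commute[of z y] power2_eq_square algebra_simps)
  have uv: "hyp_form u v = hyp_form x z - a * b"
    by (simp add: u_def v_def hyp_form_simps one algebra_simps) (simp add: a_def b_def)
  have nonpos: "hyp_form w w \<le> 0" if "hyp_form w y = 0" for w
    using hyp_form_orthogonal_neg[OF xyz(2) that] by (cases "w = 0") (auto simp: hyp_form_def)
  have CS: "(hyp_form u v)\<^sup>2 \<le> (a\<^sup>2 - 1) * (b\<^sup>2 - 1)"
  proof (cases "v = 0")
    case True
    then have "b\<^sup>2 = 1" "hyp_form u v = 0" using v by (auto simp: hyp_form_def)
    then show ?thesis by simp
  next
    case False
    define q where "q = b\<^sup>2 - 1"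
    have q: "q > 0" using hyp_form_orthogonal_neg[OF xyz(2) v(1) False] v(2) by (simp add: q_def)
    have "hyp_form (q *\<^sub>R u + hyp_form u v *\<^sub>R v) (q *\<^sub>R u + hyp_form u v *\<^sub>R v) \<le> 0"
      by (intro nonpos) (simp add: hyp_form_simps u v)
    also have "hyp_form (q *\<^sub>R u + hyp_form u v *\<^sub>R v) (q *\<^sub>R u + hyp_form u v *\<^sub>R v)
        = q * ((hyp_form u v)\<^sup>2 - (a\<^sup>2 - 1) * q)"
      by (simp add: hyp_form_simps hyp_form_commute[of v u] u(2) v(2))
         (simp add: q_def power2_eq_square algebra_simps)
    finally have "(hyp_form u v)\<^sup>2 - (a\<^sup>2 - 1) * q \<le> 0"
      using q by (simp add: mult_le_0_iff)
    then show ?thesis by (simp add: q_def)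
  qed
  have d: "hyp_dist x y \<ge> 0" "hyp_dist y z \<ge> 0" "hyp_dist x z \<ge> 0"
    using xyz by (auto simp: hyp_dist_def hyp_form_ge_1)
  have "(hyp_form u v)\<^sup>2 \<le> (sinh (hyp_dist x y) * sinh (hyp_dist y z))\<^sup>2"
    using CS xyz by (simp add: power_mult_distrib sinh_square_eq cosh_hyp_dist a_def b_def)
  then have "hyp_form u v \<le> sinh (hyp_dist x y) * sinh (hyp_dist y z)"
    using d by (rule_tac power2_le_imp_le) (simp_all add: mult_nonneg_nonneg)
  then have "hyp_form x z \<le> a * b + sinh (hyp_dist x y) * sinh (hyp_dist y z)"
    unfolding uv by linarith
  also have "\<dots> = cosh (hyp_dist x y + hyp_dist y z)"
    unfolding cosh_add a_def b_def cosh_hyp_dist[OF xyz(1,2)] cosh_hyp_dist[OF xyz(2,3)] ..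
  finally have "cosh (hyp_dist x z) \<le> cosh (hyp_dist x y + hyp_dist y z)"
    unfolding cosh_hyp_dist[OF xyz(1,3)] .
  then show "hyp_dist x z \<le> hyp_dist x y + hyp_dist y z"
    using d cosh_real_nonneg_le_iff[of "hyp_dist x z" "hyp_dist x y + hyp_dist y z"] by linarith
qed

section \<open>The isometry group\<close>

definition hyp_isometries :: "(real \<times> 'h::real_inner \<Rightarrow> real \<times> 'h) set"
  where "hyp_isometries =
    {g \<in> Bij hyp_space. \<forall>x\<in>hyp_space. \<forall>y\<in>hyp_space. hyp_dist (g x) (g y) = hyp_dist x y}"

definition Is_hyp :: "(real \<times> 'h::real_inner \<Rightarrow> real \<times> 'h) monoid"
  where "Is_hyp = (BijGroup hyp_space)\<lparr>carrier := hyp_isometries\<rparr>"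

definition Is_hyp_topology :: "(real \<times> 'h::real_inner \<Rightarrow> real \<times> 'h) topology"
  where "Is_hyp_topology =
    subtopology (product_topology (\<lambda>_. Metric_space.mtopology hyp_space hyp_dist) hyp_space)
      (carrier Is_hyp)"

lemma group_Is_hyp: "group Is_hyp"
proof -
  interpret G: group "BijGroup (hyp_space :: (real \<times> 'a) set)" by (rule group_BijGroup)
  have "subgroup hyp_isometries (BijGroup (hyp_space :: (real \<times> 'a) set))"
  proof (rule G.subgroupI)
    show "hyp_isometries \<subseteq> carrier (BijGroup (hyp_space :: (real \<times> 'a) set))"
      by (auto simp: hyp_isometries_def BijGroup_def)
    have "restrict (\<lambda>x. x) hyp_space \<in> (hyp_isometries :: (real \<times> 'a \<Rightarrow> _) set)"
      by (simp add: hyp_isometries_def id_Bij)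
    then show "(hyp_isometries :: (real \<times> 'a \<Rightarrow> _) set) \<noteq> {}" by blast
  next
    fix g :: "real \<times> 'a \<Rightarrow> real \<times> 'a" assume g: "g \<in> hyp_isometries"
    then have B: "g \<in> Bij hyp_space" by (simp add: hyp_isometries_def)
    have "hyp_dist (inv_into hyp_space g x) (inv_into hyp_space g y) = hyp_dist x y"
      if "x \<in> hyp_space" "y \<in> hyp_space" for x y
      using g that Bij_inv_into_mem[OF B]
      by (smt (verit) B Bij_def Int_iff bij_betw_inv_into_right hyp_isometries_def mem_Collect_eq)
    then show "inv\<^bsub>BijGroup hyp_space\<^esub> g \<in> hyp_isometries"
      using B by (simp add: inv_BijGroup hyp_isometries_def restrict_inv_into_Bij)
  next
    fix g h :: "real \<times> 'a \<Rightarrow> real \<times> 'a" assume gh: "g \<in> hyp_isometries" "h \<in> hyp_isometries"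
    then have "h \<in> hyp_space \<rightarrow> hyp_space" by (simp add: hyp_isometries_def Bij_imp_funcset)
    with gh show "g \<otimes>\<^bsub>BijGroup hyp_space\<^esub> h \<in> hyp_isometries"
      by (simp add: hyp_isometries_def BijGroup_def compose_Bij compose_eq Pi_iff)
  qed
  then show ?thesis
    unfolding Is_hyp_def by (rule G.subgroup_imp_group)
qed

lemma topspace_Is_hyp_topology: "topspace Is_hyp_topology = carrier Is_hyp"
proof -
  have "hyp_isometries \<subseteq> (hyp_space \<rightarrow>\<^sub>E (hyp_space :: (real \<times> 'a) set))"
    using Bij_imp_extensional Bij_imp_funcset unfolding hyp_isometries_def PiE_def by blast
  then show ?thesis
    unfolding Is_hyp_topology_def Is_hyp_def topspace_subtopology topspace_product_topology
      Metric_space.topspace_mtopology[OF Metric_space_hyp]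
    by (simp add: Int_absorb1)
qed

section \<open>Linear extension of isometries\<close>

definition is_lin_ext ::
    "(real \<times> 'h::real_inner \<Rightarrow> real \<times> 'h) \<Rightarrow> (real \<times> 'h \<Rightarrow> real \<times> 'h) \<Rightarrow> bool"
  where "is_lin_ext g T \<longleftrightarrow>
    linear T \<and> bij T \<and> (\<forall>x y. hyp_form (T x) (T y) = hyp_form x y) \<and>
    T ` hyp_space = hyp_space \<and> (\<forall>x\<in>hyp_space. T x = g x)"

definition lin_ext ::
    "(real \<times> 'h::real_inner \<Rightarrow> real \<times> 'h) \<Rightarrow> real \<times> 'h \<Rightarrow> real \<times> 'h"
  where "lin_ext g = (THE T. is_lin_ext g T)"

lemma hyp_space_decomp:
  fixes v :: "real \<times> 'h::real_inner"
  obtains c p q where "p \<in> hyp_space" "q \<in> hyp_space" "v = p + c *\<^sub>R q"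
proof
  let ?c = "sqrt (1 + snd v \<bullet> snd v)"
  show "(?c, snd v) \<in> hyp_space"
    by (simp add: hyp_space_def hyp_form_def add_pos_nonneg)
  show "(1, 0) \<in> (hyp_space :: (real \<times> 'h) set)"
    by (simp add: hyp_space_def hyp_form_def)
  show "v = (?c, snd v) + (fst v - ?c) *\<^sub>R (1, 0)"
    by (simp add: prod_eq_iff)
qed

lemma hyp_form_nondegenerate:
  assumes "\<And>w. w \<in> hyp_space \<Longrightarrow> hyp_form v w = 0"
  shows "v = 0"
proof -
  have z: "hyp_form v w = 0" for w
    using hyp_space_decomp[of w] assms by (metis add_0 hyp_form_simps(2,6) mult_zero_right)
  show ?thesis
    using z[of "(1, 0)"] z[of "(0, snd v)"] by (simp add: hyp_form_def prod_eq_iff)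
qed

lemma ex1_lin_ext:
  fixes g :: "real \<times> 'h::real_inner \<Rightarrow> real \<times> 'h"
  assumes g: "g \<in> carrier Is_hyp"
  shows "\<exists>!T. is_lin_ext g T"
proof (rule ex_ex1I)
  have gB: "g \<in> Bij hyp_space" and gd: "hyp_dist (g x) (g y) = hyp_dist x y"
    if "x \<in> hyp_space" "y \<in> hyp_space" for x y
    using g that by (auto simp: Is_hyp_def hyp_isometries_def)
  have bij: "bij_betw g hyp_space hyp_space"
    using g by (simp add: Is_hyp_def hyp_isometries_def Bij_def)
  then have gm: "g x \<in> hyp_space" if "x \<in> hyp_space" for x
    using that by (auto simp: bij_betw_def)
  have gf: "hyp_form (g x) (g y) = hyp_form x y" if "x \<in> hyp_space" "y \<in> hyp_space" for x y
    using cosh_hyp_dist[OF that] cosh_hyp_dist[OF gm gm, OF that] gd[OF that] by simp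
  have "\<forall>v :: real \<times> 'h. \<exists>w. \<forall>y\<in>hyp_space. hyp_form w (g y) = hyp_form v y"
  proof
    fix v :: "real \<times> 'h"
    obtain c p q where "p \<in> hyp_space" "q \<in> hyp_space" "v = p + c *\<^sub>R q"
      by (rule hyp_space_decomp)
    then show "\<exists>w. \<forall>y\<in>hyp_space. hyp_form w (g y) = hyp_form v y"
      by (intro exI[of _ "g p + c *\<^sub>R g q"]) (simp add: hyp_form_simps gf)
  qed
  then obtain T where T: "\<And>v y. y \<in> hyp_space \<Longrightarrow> hyp_form (T v) (g y) = hyp_form v y"
    by metis
  have eqI: "a = b" if ab: "\<And>y. y \<in> hyp_space \<Longrightarrow> hyp_form a (g y) = hyp_form b (g y)" for a b
  proof -
    have "hyp_form (a - b) w = 0" if w: "w \<in> hyp_space" for w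
    proof -
      obtain y where "y \<in> hyp_space" "w = g y"
        using w bij_betw_imp_surj_on[OF bij] by blast
      then show ?thesis using ab by (simp add: hyp_form_simps)
    qed
    then show ?thesis using hyp_form_nondegenerate[of "a - b"] by simp
  qed
  have lin: "linear T"
    by (intro linearI eqI) (simp_all add: hyp_form_simps T)
  have Tg: "T x = g x" if "x \<in> hyp_space" for x
    by (rule eqI) (simp add: T gf that)
  have Tf: "hyp_form (T x) (T y) = hyp_form x y" for x y
  proof -
    obtain c and p q :: "real \<times> 'h" where "p \<in> hyp_space" "q \<in> hyp_space" "y = p + c *\<^sub>R q"
      by (rule hyp_space_decomp)
    then show ?thesis
      by (simp add: linear_add[OF lin] linear_scale[OF lin] Tg hyp_form_simps T)
  qed
  have "inj T"
  proof (subst linear_injective_0[OF lin], intro allI impI)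
    fix x assume "T x = 0"
    have "hyp_form x w = 0" for w
      using Tf[of x w] \<open>T x = 0\<close> by (simp add: hyp_form_def)
    then show "x = 0" by (rule hyp_form_nondegenerate)
  qed
  moreover have "surj T"
    unfolding surj_def
  proof
    fix y :: "real \<times> 'h"
    obtain c p q where pq: "p \<in> hyp_space" "q \<in> hyp_space" "y = p + c *\<^sub>R q"
      by (rule hyp_space_decomp)
    obtain p' where p': "p = g p'" "p' \<in> hyp_space"
      using pq(1) bij_betw_imp_surj_on[OF bij] by (metis imageE)
    obtain q' where q': "q = g q'" "q' \<in> hyp_space"
      using pq(2) bij_betw_imp_surj_on[OF bij] by (metis imageE)
    have "y = T (p' + c *\<^sub>R q')"
      by (simp add: pq(3) p' q' linear_add[OF lin] linear_scale[OF lin] Tg)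
    then show "\<exists>x. y = T x" by blast
  qed
  moreover have "T ` hyp_space = hyp_space"
    using bij Tg by (metis bij_betw_def image_cong)
  ultimately have "is_lin_ext g T"
    unfolding is_lin_ext_def bij_def using lin Tf Tg by blast
  then show "\<exists>T. is_lin_ext g T" by blast
next
  fix T S assume TS: "is_lin_ext g T" "is_lin_ext g S"
  show "T = S"
  proof
    fix v :: "real \<times> 'h"
    obtain c p q where "p \<in> hyp_space" "q \<in> hyp_space" "v = p + c *\<^sub>R q"
      by (rule hyp_space_decomp)
    with TS show "T v = S v"
      by (simp add: is_lin_ext_def linear_add linear_scale)
  qed
qed

section \<open>Representations\<close>

definition irreducible_rep ::
    "('g, 'm) monoid_scheme \<Rightarrow> ('g \<Rightarrow> real \<times> 'h::real_inner \<Rightarrow> real \<times> 'h) \<Rightarrow> bool"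
  where "irreducible_rep G \<rho> \<longleftrightarrow>
    \<rho> \<in> hom G Is_hyp \<and>
    (\<forall>V. subspace V \<and> closed V \<and> (\<forall>g\<in>carrier G. lin_ext (\<rho> g) ` V \<subseteq> V) \<longrightarrow>
      V = {0} \<or> V = UNIV)"

text \<open>\<open>is_rho t \<rho>\<close> says that \<open>\<rho>\<close> qualifies as the exotic self-representation with parameter \<open>t\<close>;
  such a \<open>\<rho>\<close> is determined by \<open>t\<close> only up to conjugacy.\<close>

definition is_rho ::
    "real \<Rightarrow> ((real \<times> 'h \<Rightarrow> real \<times> 'h) \<Rightarrow> real \<times> 'h::real_inner \<Rightarrow> real \<times> 'h) \<Rightarrow> bool"
  where "is_rho t \<rho> \<longleftrightarrow>
    irreducible_rep Is_hyp \<rho> \<and> continuous_map Is_hyp_topology Is_hyp_topology \<rho> \<and>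
    (\<exists>f \<in> hyp_space \<rightarrow> hyp_space.
      (\<forall>g\<in>carrier Is_hyp. \<forall>x\<in>hyp_space. f (g x) = \<rho> g (f x)) \<and>
      (\<forall>x\<in>hyp_space. \<forall>y\<in>hyp_space. cosh (hyp_dist (f x) (f y)) = cosh (hyp_dist x y) powr t))"

definition conjugate_reps ::
    "('g, 'm) monoid_scheme \<Rightarrow> ('g \<Rightarrow> real \<times> 'h::real_inner \<Rightarrow> real \<times> 'h) \<Rightarrow>
     ('g \<Rightarrow> real \<times> 'h \<Rightarrow> real \<times> 'h) \<Rightarrow> bool"
  where "conjugate_reps G \<rho> \<sigma> \<longleftrightarrow>
    (\<exists>a\<in>carrier Is_hyp. \<forall>g\<in>carrier G. \<rho> g = a \<otimes>\<^bsub>Is_hyp\<^esub> \<sigma> g \<otimes>\<^bsub>Is_hyp\<^esub> inv\<^bsub>Is_hyp\<^esub> a)"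

end

theory Submission
  imports Defs
begin

text \<open>The stabilizer of a point of the hyperbolic space is the orthogonal group of \<open>H\<close>. As an abstract
  group it is strongly bounded, so its image under \<open>\<rho>\<close> has bounded orbits and fixes a point, the
  circumcenter of an orbit.

  A fixed point \<open>p\<close> yields an equivariant map \<open>f\<close> and, by two-point homogeneity, a function \<open>F\<close> with
  \<open>B (f x) (f y) = F (B x y)\<close>. Averaging \<open>f\<close> over large orthonormal frames on the sphere with
  \<open>B x o = u\<close> about the base point \<open>o\<close> converges to a vector \<open>v u\<close> fixed by the stabilizer, with
  \<open>B (v u) (v w) = F (u * w)\<close>. The reverse Cauchy-Schwarz inequality makes \<open>s \<mapsto> ln (F (exp s))\<close>
  midpoint concave, hence asymptotically linear with some slope \<open>t\<close>, and a limit point of the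
  normalized \<open>v u\<close> is a common eigenvector. If it were isotropic, it would span an invariant line; so
  it can be normalized to a new fixed point, for which \<open>F u = u powr t\<close>. Irreducibility gives \<open>t > 0\<close>,
  and the triangle inequality gives \<open>t \<le> 1\<close>.

  Two irreducible representations with the same \<open>F\<close> are conjugate, because the images of the
  equivariant maps are total; and \<open>t\<close> is determined by the growth of displacements.\<close>

section \<open>Closed convex sets in Hilbert spaces\<close>

text \<open>The kernel of an arbitrary fixed point need not be a power, since the stabilizer might
  fix more than a line; this is why the fixed point has to be changed. Multiplication enters through
  infinite dimension: if \<open>e\<close> is orthogonal to the vector part of \<open>z\<close>, the
  point at height \<open>u\<close> in direction \<open>e\<close> has form value
  \<open>u * fst z\<close> with \<open>z\<close>, and large frames orthogonal to finitely many given
  vectors always exist. Paired with averages, \<open>\<rho> g\<close> therefore acts as the dilation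
  of \<open>u\<close> by \<open>fst (g hyp_base)\<close>. Since \<open>F (c * u) / F u\<close> tends
  to \<open>c powr t\<close>, averages over far spheres are nearly eigenvectors. After normalization
  they are merely bounded, without convergence in norm, so intersections of nested closed convex
  hulls replace weak limits. The second obstacle is that the form is indefinite. Norm estimates are
  obtained by splitting off one positive vector: on its complement minus the form dominates the
  norm. Boundedness of form-preserving maps, completeness and convergence of averages all rest on
  this.\<close>

lemma bounded_linear_extension_dense:
  fixes f :: "'a::real_normed_vector \<Rightarrow> 'b::{real_normed_vector, complete_space}"
  assumes D: "subspace D" "closure D = UNIV"
    and f: "linear f" "\<And>x. x \<in> D \<Longrightarrow> norm (f x) \<le> K * norm x"
  obtains T where "bounded_linear T" "\<And>x. x \<in> D \<Longrightarrow> T x = f x" "\<And>x. norm (T x) \<le> K * norm x"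
proof -
  have uc: "uniformly_continuous_on D f"
  proof (rule lipschitz_on_uniformly_continuous)
    show "(max K 0)-lipschitz_on D f"
    proof (rule lipschitz_onI)
      fix x y assume xy: "x \<in> D" "y \<in> D"
      have "dist (f x) (f y) = norm (f (x - y))"
        by (simp add: dist_norm linear_diff[OF f(1)])
      also have "\<dots> \<le> K * norm (x - y)"
        using f(2) subspace_diff[OF D(1) xy] .
      also have "\<dots> \<le> max K 0 * dist x y"
        by (simp add: dist_norm mult_right_mono)
      finally show "dist (f x) (f y) \<le> max K 0 * dist x y" .
    qed simp
  qed
  obtain T where T: "uniformly_continuous_on (closure D) T" "\<And>x. x \<in> D \<Longrightarrow> f x = T x"
    using uniformly_continuous_on_extension_on_closure[OF uc] by metis
  have cT: "continuous_on UNIV T"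
    using T(1) D(2) uniformly_continuous_imp_continuous by metis
  have lim: "(\<lambda>n. T (X n)) \<longlonglongrightarrow> T x" if "X \<longlonglongrightarrow> x" for X x
    using cT that by (metis continuous_on_eq_continuous_at isCont_tendsto_compose open_UNIV UNIV_I)
  have seq: "\<exists>X. (\<forall>n. X n \<in> D) \<and> X \<longlonglongrightarrow> x" for x
    using D(2) closure_sequential by blast
  have add: "T (x + y) = T x + T y" for x y
  proof -
    obtain X Y where X: "\<forall>n. X n \<in> D" "X \<longlonglongrightarrow> x" and Y: "\<forall>n. Y n \<in> D" "Y \<longlonglongrightarrow> y"
      using seq by metis
    have "(\<lambda>n. T (X n + Y n)) \<longlonglongrightarrow> T (x + y)" by (intro lim tendsto_add X Y)
    moreover have "T (X n + Y n) = T (X n) + T (Y n)" for n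
      using X(1) Y(1) by (simp add: T(2)[symmetric] subspace_add[OF D(1)] linear_add[OF f(1)])
    ultimately have "(\<lambda>n. T (X n) + T (Y n)) \<longlonglongrightarrow> T (x + y)" by simp
    moreover have "(\<lambda>n. T (X n) + T (Y n)) \<longlonglongrightarrow> T x + T y" by (intro tendsto_add lim X Y)
    ultimately show ?thesis by (rule LIMSEQ_unique)
  qed
  have scale: "T (c *\<^sub>R x) = c *\<^sub>R T x" for c x
  proof -
    obtain X where X: "\<forall>n. X n \<in> D" "X \<longlonglongrightarrow> x"
      using seq by metis
    have "(\<lambda>n. T (c *\<^sub>R X n)) \<longlonglongrightarrow> T (c *\<^sub>R x)" by (intro lim tendsto_intros X)
    moreover have "T (c *\<^sub>R X n) = c *\<^sub>R T (X n)" for n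
      using X(1) by (simp add: T(2)[symmetric] subspace_scale[OF D(1)] linear_scale[OF f(1)])
    ultimately have "(\<lambda>n. c *\<^sub>R T (X n)) \<longlonglongrightarrow> T (c *\<^sub>R x)" by simp
    moreover have "(\<lambda>n. c *\<^sub>R T (X n)) \<longlonglongrightarrow> c *\<^sub>R T x" by (intro tendsto_intros lim X)
    ultimately show ?thesis by (rule LIMSEQ_unique)
  qed
  have le: "norm (T x) \<le> K * norm x" for x
  proof -
    obtain X where X: "\<forall>n. X n \<in> D" "X \<longlonglongrightarrow> x"
      using seq by metis
    have "(\<lambda>n. norm (T (X n))) \<longlonglongrightarrow> norm (T x)" "(\<lambda>n. K * norm (X n)) \<longlonglongrightarrow> K * norm x"
      by (intro tendsto_intros lim X)+
    then show ?thesis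
      by (rule LIMSEQ_le) (use X T(2) f(2) in auto)
  qed
  have "bounded_linear T"
    by (rule bounded_linear_intro[where K = K]) (auto simp: add scale mult.commute le)
  with T(2) le that show ?thesis by metis
qed

text \<open>The midpoint of two points of \<open>C\<close> lies in \<open>C\<close>, so its norm is
  at least the infimum \<open>d\<close>; the parallelogram law then bounds their distance by how far
  their norms exceed \<open>d\<close>. This makes minimizing sequences Cauchy and gives the last
  conclusion, the quantitative form exploited in
  \<open>nested_bounded_convex_Inter_nonempty\<close>.\<close>

lemma convex_closed_min_norm:
  fixes C :: "'a::{real_inner, complete_space} set"
  assumes "closed C" "convex C" "C \<noteq> {}"
  obtains m where "m \<in> C" "\<And>x. x \<in> C \<Longrightarrow> norm m \<le> norm x"
    "\<And>x. x \<in> C \<Longrightarrow> (norm (x - m))\<^sup>2 \<le> 2 * ((norm x)\<^sup>2 - (norm m)\<^sup>2)"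
proof -
  define d where "d = Inf (norm ` C)"
  have bb: "bdd_below (norm ` C)" by (rule bdd_belowI[of _ 0]) auto
  have d_le: "d \<le> norm x" if "x \<in> C" for x
    unfolding d_def by (rule cInf_lower) (use that bb in auto)
  have d0: "d \<ge> 0" unfolding d_def by (rule cInf_greatest) (use assms in auto)
  have par: "(norm (x - y))\<^sup>2 \<le> 2 * (norm x)\<^sup>2 + 2 * (norm y)\<^sup>2 - 4 * d\<^sup>2" if "x \<in> C" "y \<in> C" for x y
  proof -
    have "(1/2) *\<^sub>R x + (1/2) *\<^sub>R y \<in> C" using assms(2) that by (auto intro: convexD)
    then have "d \<le> norm ((1/2) *\<^sub>R x + (1/2) *\<^sub>R y)" by (rule d_le)
    then have "d\<^sup>2 \<le> (norm ((1/2) *\<^sub>R x + (1/2) *\<^sub>R y))\<^sup>2" using d0 by (rule power_mono)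
    then show ?thesis
      by (simp add: power2_norm_eq_inner inner_simps inner_commute algebra_simps)
  qed
  have "\<exists>x\<in>C. norm x < d + 1 / Suc n" for n
    using cInf_lessD[of "norm ` C" "d + 1 / Suc n"] assms(3) by (auto simp: d_def)
  then obtain X where X: "\<And>n. X n \<in> C" "\<And>n. norm (X n) < d + 1 / Suc n" by metis
  have nl: "(\<lambda>n. norm (X n)) \<longlonglongrightarrow> d"
  proof (rule tendsto_sandwich[of "\<lambda>_. d" _ _ "\<lambda>n. d + 1 / Suc n"])
    show "(\<lambda>n. d + 1 / real (Suc n)) \<longlonglongrightarrow> d"
      using tendsto_add[OF tendsto_const[of d] LIMSEQ_inverse_real_of_nat] by (simp add: divide_inverse)
  qed (use X d_le in \<open>auto intro!: always_eventually less_imp_le\<close>)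
  have "Cauchy X"
  proof (rule metric_CauchyI)
    fix e :: real assume e: "e > 0"
    have "(\<lambda>n. (norm (X n))\<^sup>2) \<longlonglongrightarrow> d\<^sup>2" by (intro tendsto_intros nl)
    then have "eventually (\<lambda>n. (norm (X n))\<^sup>2 < d\<^sup>2 + e\<^sup>2 / 4) sequentially"
      by (rule order_tendstoD) (use e in auto)
    then obtain M where M: "\<And>n. n \<ge> M \<Longrightarrow> (norm (X n))\<^sup>2 < d\<^sup>2 + e\<^sup>2 / 4"
      by (auto simp: eventually_sequentially)
    have "dist (X m) (X n) < e" if "m \<ge> M" "n \<ge> M" for m n
    proof -
      have "(norm (X m - X n))\<^sup>2 < e\<^sup>2"
        using par[OF X(1)[of m] X(1)[of n]] M[OF that(1)] M[OF that(2)] by linarith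
      then show ?thesis using e by (simp add: dist_norm power2_less_imp_less)
    qed
    then show "\<exists>M. \<forall>m\<ge>M. \<forall>n\<ge>M. dist (X m) (X n) < e" by blast
  qed
  then obtain m where m: "X \<longlonglongrightarrow> m" using Cauchy_convergent convergent_def by blast
  have mC: "m \<in> C" using assms(1) X(1) m closed_sequentially by blast
  have "(\<lambda>n. norm (X n)) \<longlonglongrightarrow> norm m" by (intro tendsto_intros m)
  then have nm: "norm m = d" using nl LIMSEQ_unique by blast
  show ?thesis
  proof (rule that[OF mC])
    show "norm m \<le> norm x" if "x \<in> C" for x using d_le[OF that] nm by simp
    show "(norm (x - m))\<^sup>2 \<le> 2 * ((norm x)\<^sup>2 - (norm m)\<^sup>2)" if "x \<in> C" for x
      using par[OF that mC] nm by (simp add: algebra_simps)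
  qed
qed

text \<open>A substitute for weak compactness. The points of least norm in the \<open>C n\<close>
  have increasing, bounded norms; a later one lies in every earlier set, so the quantitative
  estimate turns convergence of the norms into the Cauchy property of the points.\<close>

lemma nested_bounded_convex_Inter_nonempty:
  fixes C :: "nat \<Rightarrow> 'a::{real_inner, complete_space} set"
  assumes C: "\<And>n. closed (C n)" "\<And>n. convex (C n)" "\<And>n. C n \<noteq> {}" "decseq C"
    and bdd: "bounded (C 0)"
  shows "(\<Inter>n. C n) \<noteq> {}"
proof -
  have "\<exists>m\<in>C n. \<forall>x\<in>C n. (norm (x - m))\<^sup>2 \<le> 2 * ((norm x)\<^sup>2 - (norm m)\<^sup>2)" for n
    using convex_closed_min_norm[OF C(1-3)] by metis
  then obtain m where m: "\<And>n. m n \<in> C n"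
    "\<And>n x. x \<in> C n \<Longrightarrow> (norm (x - m n))\<^sup>2 \<le> 2 * ((norm x)\<^sup>2 - (norm (m n))\<^sup>2)" by metis
  have mC: "m k \<in> C n" if "n \<le> k" for k n using C(4) that m(1) by (auto dest: decseqD)
  obtain b where b: "\<And>x. x \<in> C 0 \<Longrightarrow> norm x \<le> b" using bdd bounded_iff by blast
  have inc: "incseq (\<lambda>n. (norm (m n))\<^sup>2)"
  proof (rule incseq_SucI)
    fix n show "(norm (m n))\<^sup>2 \<le> (norm (m (Suc n)))\<^sup>2"
      using order_trans[OF zero_le_power2 m(2)[OF mC[of n "Suc n", OF le_SucI[OF le_refl]]]] by simp
  qed
  have "(norm (m n))\<^sup>2 \<le> b\<^sup>2" for n
    using b[OF mC[of 0 n]] by (simp add: power_mono)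
  then obtain L where L: "(\<lambda>n. (norm (m n))\<^sup>2) \<longlonglongrightarrow> L" "\<And>n. (norm (m n))\<^sup>2 \<le> L"
    using incseq_convergent[OF inc] by metis
  have "Cauchy m"
  proof (rule CauchyI')
    fix e :: real assume e: "e > 0"
    have "eventually (\<lambda>n. (norm (m n))\<^sup>2 > L - e\<^sup>2 / 2) sequentially"
      using L(1) by (rule order_tendstoD) (use e in auto)
    then obtain M where M: "\<And>n. n \<ge> M \<Longrightarrow> (norm (m n))\<^sup>2 > L - e\<^sup>2 / 2"
      by (auto simp: eventually_sequentially)
    have "dist (m i) (m n) < e" if "i \<ge> M" "n > i" for i n
    proof -
      have "(norm (m n - m i))\<^sup>2 < e\<^sup>2"
        using m(2)[OF mC[of i n]] M[OF that(1)] L(2)[of n] that by simp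
      then show ?thesis using e by (simp add: dist_norm norm_minus_commute power2_less_imp_less)
    qed
    then show "\<exists>M. \<forall>i\<ge>M. \<forall>n>i. dist (m i) (m n) < e" by blast
  qed
  then obtain x where x: "m \<longlonglongrightarrow> x" using Cauchy_convergent convergent_def by blast
  have "x \<in> C n" for n
    by (rule Lim_in_closed_set[OF C(1) _ _ x])
      (use mC in \<open>auto intro: eventually_sequentiallyI[of n]\<close>)
  then show ?thesis by blast
qed

lemma orthogonal_projection_exists:
  fixes X :: "'a::{real_inner, complete_space} set"
  assumes "closed X" "subspace X"
  obtains p where "p \<in> X" "\<And>x. x \<in> X \<Longrightarrow> (y - p) \<bullet> x = 0"
proof -
  \<comment> \<open>The element of least norm in this translate is the residual
    \<open>y - p\<close>.\<close>
  let ?C = "(\<lambda>x. y - x) ` X"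
  have im: "?C = (+) y ` X"
  proof (rule equalityI; rule subsetI)
    fix z assume "z \<in> ?C"
    then obtain x where "x \<in> X" "z = y + - x" by auto
    then show "z \<in> (+) y ` X" using subspace_neg[OF assms(2)] by blast
  next
    fix z assume "z \<in> (+) y ` X"
    then obtain x where "x \<in> X" "z = y - - x" by auto
    then show "z \<in> ?C" using subspace_neg[OF assms(2)] by blast
  qed
  have "closed ?C" unfolding im by (rule closed_translation[OF assms(1)])
  moreover have "convex ?C" unfolding im
    using assms(2) subspace_imp_convex convex_translation by blast
  moreover have "?C \<noteq> {}" using assms(2) subspace_0 by blast
  ultimately obtain m where m: "m \<in> ?C" "\<And>z. z \<in> ?C \<Longrightarrow> norm m \<le> norm z"
    using convex_closed_min_norm by metis
  then obtain p where p: "p \<in> X" "m = y - p" by blast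
  have "(y - p) \<bullet> x = 0" if x: "x \<in> X" for x
  proof (cases "x = 0")
    case False
    \<comment> \<open>The coefficient that minimizes the norm of \<open>m - c *\<^sub>R x\<close>;
      minimality of \<open>m\<close> leaves no room for a gain.\<close>
    define c where "c = m \<bullet> x / (x \<bullet> x)"
    have xx: "x \<bullet> x > 0" using False by simp
    have "m - c *\<^sub>R x = y - (p + c *\<^sub>R x)" by (simp add: p)
    moreover have "p + c *\<^sub>R x \<in> X"
      using assms(2) p(1) x by (simp add: subspace_add subspace_scale)
    ultimately have "norm m \<le> norm (m - c *\<^sub>R x)" by (intro m(2)) (rule image_eqI)
    then have "m \<bullet> m \<le> (m - c *\<^sub>R x) \<bullet> (m - c *\<^sub>R x)" by (simp add: norm_le)
    also have "\<dots> = m \<bullet> m - (m \<bullet> x)\<^sup>2 / (x \<bullet> x)"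
      using xx by (simp add: c_def inner_simps inner_commute power2_eq_square field_simps)
    finally have "(m \<bullet> x)\<^sup>2 / (x \<bullet> x) \<le> 0" by simp
    then have "m \<bullet> x = 0" using xx by (simp add: divide_le_0_iff)
    then show ?thesis using p by simp
  qed simp
  with p that show ?thesis by blast
qed

lemma closed_subspace_eq_UNIV:
  fixes X :: "'a::{real_inner, complete_space} set"
  assumes "closed X" "subspace X" "\<And>y. (\<And>x. x \<in> X \<Longrightarrow> y \<bullet> x = 0) \<Longrightarrow> y = 0"
  shows "X = UNIV"
proof -
  have "y \<in> X" for y
  proof -
    obtain p where "p \<in> X" "\<And>x. x \<in> X \<Longrightarrow> (y - p) \<bullet> x = 0"
      using orthogonal_projection_exists[OF assms(1,2)] by metis
    with assms(3)[of "y - p"] show ?thesis by simp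
  qed
  then show ?thesis by blast
qed

section \<open>Orthonormal bases and orthogonal operators\<close>

definition orthonormal_on :: "'i set \<Rightarrow> ('i \<Rightarrow> 'h::real_inner) \<Rightarrow> bool"
  where "orthonormal_on I e \<longleftrightarrow> (\<forall>i\<in>I. \<forall>j\<in>I. e i \<bullet> e j = (if i = j then 1 else 0))"

abbreviation closed_span :: "'h::real_normed_vector set \<Rightarrow> 'h set"
  where "closed_span S \<equiv> closure (span S)"

definition infinite_dim :: "'h::real_vector set \<Rightarrow> bool"
  where "infinite_dim V \<longleftrightarrow> (\<forall>S. finite S \<longrightarrow> \<not> V \<subseteq> span S)"

text \<open>In infinite dimension, preserving inner products does not imply surjectivity, so it is a
  separate clause; these operators form the full orthogonal group.\<close>

definition orthogonal_op :: "('h::real_inner \<Rightarrow> 'h) \<Rightarrow> bool"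
  where "orthogonal_op U \<longleftrightarrow> orthogonal_transformation U \<and> surj U"

lemma orthonormal_onD:
  "orthonormal_on I e \<Longrightarrow> i \<in> I \<Longrightarrow> j \<in> I \<Longrightarrow> e i \<bullet> e j = (if i = j then 1 else 0)"
  by (simp add: orthonormal_on_def)

lemma orthonormal_on_inj: "orthonormal_on I e \<Longrightarrow> inj_on e I"
  by (rule inj_onI) (metis orthonormal_onD zero_neq_one)

lemma orthonormal_on_norm: "orthonormal_on I e \<Longrightarrow> i \<in> I \<Longrightarrow> norm (e i) = 1"
  by (simp add: norm_eq_sqrt_inner orthonormal_onD)

lemma orthonormal_on_independent:
  assumes "orthonormal_on I e"
  shows "independent (e ` I)"
proof (rule pairwise_orthogonal_independent)
  show "pairwise orthogonal (e ` I)"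
    unfolding pairwise_image using assms
    by (auto simp: pairwise_def orthogonal_def orthonormal_onD)
  show "0 \<notin> e ` I"
    using orthonormal_on_norm[OF assms] by force
qed

lemma subspace_closure:
  fixes S :: "'a::real_normed_vector set"
  assumes "subspace S"
  shows "subspace (closure S)"
  unfolding subspace_def
proof (intro conjI ballI allI)
  show "0 \<in> closure S" using assms closure_subset subspace_0 by blast
next
  fix x y assume "x \<in> closure S" "y \<in> closure S"
  then obtain X Y where "\<forall>n. X n \<in> S" "X \<longlonglongrightarrow> x" "\<forall>n. Y n \<in> S" "Y \<longlonglongrightarrow> y"
    unfolding closure_sequential by blast
  then show "x + y \<in> closure S" unfolding closure_sequential
    using assms by (intro exI[of _ "\<lambda>n. X n + Y n"]) (auto intro: subspace_add tendsto_add)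
next
  fix c x assume "x \<in> closure S"
  then obtain X where "\<forall>n. X n \<in> S" "X \<longlonglongrightarrow> x"
    unfolding closure_sequential by blast
  then show "c *\<^sub>R x \<in> closure S" unfolding closure_sequential
    using assms by (intro exI[of _ "\<lambda>n. c *\<^sub>R X n"]) (auto intro: subspace_scale tendsto_intros)
qed

lemma subspace_closed_span: "subspace (closed_span S)"
  by (rule subspace_closure[OF subspace_span])

lemma closed_span_superset: "S \<subseteq> closed_span S"
  by (meson closure_subset dual_order.trans span_superset)

lemma closed_span_base: "s \<in> S \<Longrightarrow> s \<in> closed_span S"
  using closed_span_superset by (rule subsetD)

lemma closed_span_minimal: "closed X \<Longrightarrow> subspace X \<Longrightarrow> S \<subseteq> X \<Longrightarrow> closed_span S \<subseteq> X"
  by (metis closure_minimal span_minimal)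

lemma orthogonal_closed_span:
  assumes "\<And>s. s \<in> S \<Longrightarrow> y \<bullet> s = 0" "x \<in> closed_span S"
  shows "y \<bullet> x = 0"
proof -
  have "closed_span S \<subseteq> {x. y \<bullet> x = 0}"
  proof (rule closed_span_minimal)
    show "closed {x. y \<bullet> x = 0}" by (intro closed_Collect_eq continuous_intros)
    show "subspace {x. y \<bullet> x = 0}" by (auto simp: subspace_def inner_simps)
  qed (use assms in auto)
  with assms(2) show ?thesis by blast
qed

lemma linear_eq_on_closed_span:
  assumes "bounded_linear U" "bounded_linear V" "\<And>s. s \<in> S \<Longrightarrow> U s = V s" "x \<in> closed_span S"
  shows "U x = V x"
proof -
  have l: "linear U" "linear V" using assms(1,2) by (auto dest: bounded_linear.linear)
  have "closed_span S \<subseteq> {x. U x = V x}"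
  proof (rule closed_span_minimal)
    show "closed {x. U x = V x}"
      by (intro closed_Collect_eq linear_continuous_on assms(1,2))
    show "subspace {x. U x = V x}"
      by (simp add: subspace_def l linear_add linear_0 linear_scale)
  qed (use assms in auto)
  with assms(4) show ?thesis by blast
qed

lemma linear_image_closed_span:
  assumes "bounded_linear U" "\<And>s. s \<in> S \<Longrightarrow> U s \<in> closed_span T" "x \<in> closed_span S"
  shows "U x \<in> closed_span T"
proof -
  have l: "linear U" using assms(1) by (auto dest: bounded_linear.linear)
  have "closed_span S \<subseteq> U -` closed_span T"
  proof (rule closed_span_minimal)
    show "closed (U -` closed_span T)"
      by (intro continuous_closed_vimage closed_closure linear_continuous_at assms(1))
    show "subspace (U -` closed_span T)"
      by (rule linear_subspace_vimage[OF l subspace_closed_span])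
  qed (use assms in auto)
  with assms(3) show ?thesis by blast
qed

lemma orthogonal_opD:
  assumes "orthogonal_op U"
  shows "linear U" "bounded_linear U" "U x \<bullet> U y = x \<bullet> y" "norm (U x) = norm x" "bij U" "inj U" "surj U"
proof -
  have t: "orthogonal_transformation U" and s: "surj U" using assms by (auto simp: orthogonal_op_def)
  show l: "linear U" and ip: "U x \<bullet> U y = x \<bullet> y" for x y using t by (auto simp: orthogonal_transformation_def)
  show n: "norm (U x) = norm x" for x by (simp add: norm_eq_sqrt_inner ip)
  show "bounded_linear U"
    using l by (intro bounded_linear_intro[where K = 1]) (auto simp: linear_add linear_scale n)
  show i: "inj U" using l n by (metis linear_injective_0 norm_eq_zero)
  show "surj U" by fact
  then show "bij U" using i by (simp add: bij_def)
qed

lemma orthogonal_opI: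
  assumes "linear U" "\<And>x y. U x \<bullet> U y = x \<bullet> y" "surj U"
  shows "orthogonal_op U"
  using assms by (simp add: orthogonal_op_def orthogonal_transformation_def)

lemma orthogonal_op_comp: "orthogonal_op U \<Longrightarrow> orthogonal_op V \<Longrightarrow> orthogonal_op (U \<circ> V)"
  by (intro orthogonal_opI linear_compose comp_surj) (auto simp: orthogonal_opD)

abbreviation op_inv :: "('a \<Rightarrow> 'b) \<Rightarrow> 'b \<Rightarrow> 'a"
  where "op_inv U \<equiv> inv_into UNIV U"

lemma orthogonal_op_inv:
  assumes "orthogonal_op U"
  shows "orthogonal_op (op_inv U)"
proof (rule orthogonal_opI)
  note U = orthogonal_opD[OF assms]
  have fU: "U (op_inv U x) = x" for x using U(7) by (rule surj_f_inv_f)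
  show "linear (op_inv U)"
  proof (rule linearI; rule injD[OF U(6)])
    show "U (op_inv U (x + y)) = U (op_inv U x + op_inv U y)" for x y
      by (simp add: fU linear_add[OF U(1)])
    show "U (op_inv U (c *\<^sub>R x)) = U (c *\<^sub>R op_inv U x)" for c x
      by (simp add: fU linear_scale[OF U(1)])
  qed
  show "op_inv U x \<bullet> op_inv U y = x \<bullet> y" for x y
    by (metis U(3,7) surj_f_inv_f)
  show "surj (op_inv U)" using U(6) by (rule inj_imp_surj_inv)
qed

lemma orthogonal_op_inv_cancel:
  assumes "orthogonal_op U"
  shows "op_inv U (U x) = x" "U (op_inv U x) = x" "U \<circ> op_inv U = id" "op_inv U \<circ> U = id"
  using orthogonal_opD(6,7)[OF assms] by (auto simp: surj_iff surj_f_inv_f)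

text \<open>Only the source family is total, so \<open>U\<close> may miss part of the space. Inner
  products are preserved on the algebraic span, one argument at a time; this bounds the linear map
  there and lets it extend to the closure.\<close>

lemma isometry_from_orthonormal:
  fixes e f :: "'i \<Rightarrow> 'h::{real_inner, complete_space}"
  assumes e: "orthonormal_on I e" "closed_span (e ` I) = UNIV" and f: "orthonormal_on I f"
  obtains U where "linear U" "\<And>x y. U x \<bullet> U y = x \<bullet> y" "\<And>i. i \<in> I \<Longrightarrow> U (e i) = f i"
proof -
  obtain g where g: "linear g" "\<And>x. x \<in> e ` I \<Longrightarrow> g x = f (inv_into I e x)"
    using linear_independent_extend[OF orthonormal_on_independent[OF e(1)], of "\<lambda>x. f (inv_into I e x)"]
    by blast
  have ge: "g (e i) = f i" if "i \<in> I" for i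
    using g(2) that orthonormal_on_inj[OF e(1)] by simp
  have 1: "g x \<bullet> g y = x \<bullet> y" if "x \<in> span (e ` I)" "y \<in> e ` I" for x y
  proof -
    have "span (e ` I) \<subseteq> {x. g x \<bullet> g y = x \<bullet> y}"
      using that(2) orthonormal_onD[OF e(1)] orthonormal_onD[OF f]
      by (intro span_minimal)
        (auto simp: ge subspace_def linear_0[OF g(1)] linear_add[OF g(1)] linear_scale[OF g(1)] inner_simps)
    then show ?thesis using that by blast
  qed
  have 2: "g x \<bullet> g y = x \<bullet> y" if "x \<in> span (e ` I)" "y \<in> span (e ` I)" for x y
  proof -
    have "span (e ` I) \<subseteq> {y. g x \<bullet> g y = x \<bullet> y}"
      using 1[OF that(1)]
      by (intro span_minimal)
        (auto simp: ge subspace_def linear_0[OF g(1)] linear_add[OF g(1)] linear_scale[OF g(1)] inner_simps)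
    then show ?thesis using that by blast
  qed
  obtain U where U: "bounded_linear U" "\<And>x. x \<in> span (e ` I) \<Longrightarrow> U x = g x"
  proof (rule bounded_linear_extension_dense[OF subspace_span e(2) g(1), of 1])
    show "norm (g x) \<le> 1 * norm x" if "x \<in> span (e ` I)" for x
      using 2[OF that that] by (simp add: norm_eq_sqrt_inner)
  qed blast
  have lU: "linear U" using U(1) by (rule bounded_linear.linear)
  have "norm (U x) = norm x" for x
  proof -
    have "x \<in> closure (span (e ` I))" using e(2) by simp
    then obtain X where X: "\<And>n. X n \<in> span (e ` I)" "X \<longlonglongrightarrow> x"
      unfolding closure_sequential by blast
    have "(\<lambda>n. norm (U (X n))) \<longlonglongrightarrow> norm (U x)"
      by (intro tendsto_norm bounded_linear.tendsto[OF U(1)] X(2))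
    moreover have "norm (U (X n)) = norm (X n)" for n
      using 2 X(1) by (simp add: norm_eq_sqrt_inner U(2))
    ultimately show ?thesis
      using LIMSEQ_unique tendsto_norm[OF X(2)] by simp
  qed
  then have "orthogonal_transformation U" using lU by (simp add: orthogonal_transformation)
  then have "U x \<bullet> U y = x \<bullet> y" for x y by (simp add: orthogonal_transformation_def)
  moreover have "U (e i) = f i" if "i \<in> I" for i
    using that U(2) ge by (simp add: span_base)
  ultimately show ?thesis using lU that by blast
qed

text \<open>An isometry carries the complete space onto a complete, hence closed, subspace; a dense
  range is then everything.\<close>

lemma isometry_range_closed_span:
  fixes U :: "'h::{real_inner, complete_space} \<Rightarrow> 'h"
  assumes "linear U" "\<And>x y. U x \<bullet> U y = x \<bullet> y" "closed_span (range U) = UNIV"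
  shows "surj U"
proof -
  have n: "norm (U x) = norm x" for x by (simp add: norm_eq_sqrt_inner assms(2))
  have bl: "bounded_linear U"
    using assms(1) by (intro bounded_linear_intro[where K = 1]) (auto simp: linear_add linear_scale n)
  have "complete (range U)"
    by (rule complete_isometric_image[of 1])
      (auto simp: n bl complete_UNIV)
  then have "closed (range U)" by (rule complete_imp_closed)
  moreover have "span (range U) = range U"
    using assms(1) by (metis linear_subspace_image span_eq_iff subspace_UNIV)
  ultimately have "closed_span (range U) = range U" by (metis closure_closed)
  then show ?thesis using assms(3) by simp
qed

lemma orthogonal_op_from_orthonormal_bases:
  fixes e f :: "'i \<Rightarrow> 'h::{real_inner, complete_space}"
  assumes e: "orthonormal_on I e" "closed_span (e ` I) = UNIV"
    and f: "orthonormal_on I f" "closed_span (f ` I) = UNIV"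
  obtains U where "orthogonal_op U" "\<And>i. i \<in> I \<Longrightarrow> U (e i) = f i"
proof -
  obtain U where U: "linear U" "\<And>x y. U x \<bullet> U y = x \<bullet> y" "\<And>i. i \<in> I \<Longrightarrow> U (e i) = f i"
    using isometry_from_orthonormal[OF e f(1)] by metis
  have "f ` I \<subseteq> range U" using U(3) by (metis image_subset_iff rangeI)
  then have "closed_span (f ` I) \<subseteq> closed_span (range U)" by (intro closure_mono span_mono)
  then have "surj U" using isometry_range_closed_span[OF U(1,2)] f(2) by blast
  then show ?thesis using that U orthogonal_opI by metis
qed

text \<open>Each condition \<open>v \<bullet> s = 0\<close> lowers the dimension by at most one: a
  finite spanning set of the smaller space becomes one of the larger space after adding a single
  vector \<open>w\<close> that violates the condition.\<close>

lemma infinite_dim_orthogonal_complement_finite: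
  fixes V :: "'h::real_inner set"
  assumes "finite S" "subspace V" "infinite_dim V"
  shows "infinite_dim (V \<inter> {v. \<forall>s\<in>S. v \<bullet> s = 0})"
  using assms(1)
proof (induction S)
  case empty
  then show ?case using assms(3) by simp
next
  case (insert s S)
  let ?W = "V \<inter> {v. \<forall>s\<in>S. v \<bullet> s = 0}"
  have sub: "V \<inter> {v. \<forall>s\<in>insert s S. v \<bullet> s = 0} = ?W \<inter> {v. v \<bullet> s = 0}" by auto
  have subW: "subspace ?W"
    using assms(2) by (auto simp: subspace_def inner_simps)
  show ?case unfolding sub
  proof (cases "\<forall>v\<in>?W. v \<bullet> s = 0")
    case True
    then have "?W \<inter> {v. v \<bullet> s = 0} = ?W" by blast
    then show "infinite_dim (?W \<inter> {v. v \<bullet> s = 0})" using insert.IH by simp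
  next
    case False
    then obtain w where w: "w \<in> ?W" "w \<bullet> s \<noteq> 0" by blast
    show "infinite_dim (?W \<inter> {v. v \<bullet> s = 0})"
      unfolding infinite_dim_def
    proof (intro allI impI notI)
      fix T :: "'h set" assume T: "finite T" "?W \<inter> {v. v \<bullet> s = 0} \<subseteq> span T"
      have "v \<in> span (insert w T)" if v: "v \<in> ?W" for v
      proof -
        define c where "c = (v \<bullet> s) / (w \<bullet> s)"
        have "v - c *\<^sub>R w \<in> ?W" by (intro subspace_diff[OF subW] subspace_scale[OF subW] v w(1))
        moreover have "(v - c *\<^sub>R w) \<bullet> s = 0" using w(2) by (simp add: c_def inner_simps)
        ultimately have "v - c *\<^sub>R w \<in> span T" using T(2) by blast
        then show ?thesis by (auto simp: span_insert)
      qed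
      then show False using insert.IH T(1) unfolding infinite_dim_def by blast
    qed
  qed
qed

lemma infinite_dim_unit_orthogonal:
  fixes V :: "'h::real_inner set"
  assumes "finite S" "subspace V" "infinite_dim V"
  obtains v where "v \<in> V" "norm v = 1" "\<And>s. s \<in> S \<Longrightarrow> v \<bullet> s = 0"
proof -
  have "\<not> V \<inter> {v. \<forall>s\<in>S. v \<bullet> s = 0} \<subseteq> span {}"
    using infinite_dim_orthogonal_complement_finite[OF assms] unfolding infinite_dim_def by blast
  then obtain v where v: "v \<in> V" "\<forall>s\<in>S. v \<bullet> s = 0" "v \<noteq> 0" by auto
  show ?thesis
  proof
    show "(1 / norm v) *\<^sub>R v \<in> V" using v(1) assms(2) by (rule_tac subspace_scale)
  qed (use v in auto)
qed

lemma infinite_orthonormal_imp_infinite_dim: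
  assumes "orthonormal_on I e" "infinite I" "e ` I \<subseteq> V"
  shows "infinite_dim V"
  unfolding infinite_dim_def
proof (intro allI impI notI)
  fix S assume "finite S" "V \<subseteq> span S"
  then have "finite (e ` I)"
    using independent_span_bound[OF _ orthonormal_on_independent[OF assms(1)]] assms(3) by blast
  then show False using orthonormal_on_inj[OF assms(1)] assms(2) finite_imageD by blast
qed

lemma separated_countable:
  fixes E :: "'h::metric_space set"
  assumes "separable_space (euclidean :: 'h topology)"
    and "\<delta> > 0" and "\<And>x y. x \<in> E \<Longrightarrow> y \<in> E \<Longrightarrow> x \<noteq> y \<Longrightarrow> dist x y \<ge> \<delta>"
  shows "countable E"
proof -
  obtain C :: "'h set" where C: "countable C" "closure C = UNIV"
    using assms(1) by (auto simp: separable_space_def)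
  have "\<exists>c\<in>C. dist c x < \<delta> / 2" for x
    using C(2) closure_approachable[of x C] assms(2) by (metis UNIV_I half_gt_zero)
  then obtain h where h: "\<And>x. h x \<in> C" "\<And>x. dist (h x) x < \<delta> / 2" by metis
  have "inj_on h E"
  proof (rule inj_onI, rule ccontr)
    fix x y assume xy: "x \<in> E" "y \<in> E" "h x = h y" "x \<noteq> y"
    have "dist x y \<le> dist (h x) x + dist (h y) y"
      using dist_triangle3[of x y "h x"] xy(3) by (simp add: dist_commute)
    then show False using h(2)[of x] h(2)[of y] assms(3)[OF xy(1,2,4)] by linarith
  qed
  moreover have "h ` E \<subseteq> C" using h(1) by blast
  ultimately show ?thesis using countable_image_inj_on[OF countable_subset[OF _ C(1)]] by blast
qed

text \<open>A maximal orthonormal subset of \<open>X\<close> exists by Zorn's lemma and is total in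
  \<open>X\<close> by projection. Separability makes it countable because distinct members are at
  distance at least \<open>1\<close>, and infinite dimension makes it infinite, so it can be indexed
  by all of \<open>nat\<close>.\<close>

lemma orthonormal_basis_exists:
  fixes X :: "'h::{real_inner, complete_space} set"
  assumes sep: "separable_space (euclidean :: 'h topology)"
    and X: "closed X" "subspace X" "infinite_dim X"
  obtains e :: "nat \<Rightarrow> 'h" where "orthonormal_on UNIV e" "closed_span (range e) = X"
proof -
  define \<A> where "\<A> = {S. S \<subseteq> X \<and> orthonormal_on S (\<lambda>x. x)}"
  have "\<exists>E\<in>\<A>. \<forall>S\<in>\<A>. E \<subseteq> S \<longrightarrow> S = E"
  proof (rule subset_Zorn_nonempty)
    show "\<A> \<noteq> {}" by (auto simp: \<A>_def orthonormal_on_def intro!: exI[of _ "{}"])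
    fix \<C> assume C: "\<C> \<noteq> {}" "subset.chain \<A> \<C>"
    have "orthonormal_on (\<Union>\<C>) (\<lambda>x. x)"
      unfolding orthonormal_on_def
    proof (intro ballI)
      fix x y assume "x \<in> \<Union>\<C>" "y \<in> \<Union>\<C>"
      then obtain S S' where "S \<in> \<C>" "x \<in> S" "S' \<in> \<C>" "y \<in> S'" by blast
      moreover have "S \<subseteq> S' \<or> S' \<subseteq> S"
        using C(2) calculation(1,3) unfolding subset.chain_def by blast
      ultimately obtain S where "S \<in> \<C>" "x \<in> S" "y \<in> S" by blast
      then show "x \<bullet> y = (if x = y then 1 else 0)"
        using C(2) unfolding subset.chain_def \<A>_def orthonormal_on_def by blast
    qed
    moreover have "\<Union>\<C> \<subseteq> X" using C(2) unfolding subset.chain_def \<A>_def by blast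
    ultimately show "\<Union>\<C> \<in> \<A>" by (simp add: \<A>_def)
  qed
  then obtain E where "E \<in> \<A>" and max': "\<forall>S\<in>\<A>. E \<subseteq> S \<longrightarrow> S = E" ..
  then have E: "E \<subseteq> X" "orthonormal_on E (\<lambda>x. x)" by (auto simp: \<A>_def)
  have max: "S = E" if "S \<subseteq> X" "orthonormal_on S (\<lambda>x. x)" "E \<subseteq> S" for S
    using max' that by (simp add: \<A>_def)
  have max0: "x = 0" if x: "x \<in> X" "\<And>y. y \<in> E \<Longrightarrow> x \<bullet> y = 0" for x
  proof (rule ccontr)
    assume "x \<noteq> 0"
    define u where "u = (1 / norm x) *\<^sub>R x"
    have u: "u \<bullet> u = 1" "\<And>y. y \<in> E \<Longrightarrow> u \<bullet> y = 0" "u \<in> X"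
      using \<open>x \<noteq> 0\<close> x X(2) by (auto simp: u_def subspace_scale dot_square_norm power2_eq_square)
    have "insert u E = E"
      by (rule max) (use u E in \<open>auto simp: orthonormal_on_def inner_commute\<close>)
    then show False using u by (metis insertI1 zero_neq_one)
  qed
  have span: "closed_span E = X"
  proof
    show "closed_span E \<subseteq> X" using X E(1) by (intro closed_span_minimal)
    show "X \<subseteq> closed_span E"
    proof
      fix x assume x: "x \<in> X"
      obtain p where p: "p \<in> closed_span E" "\<And>y. y \<in> closed_span E \<Longrightarrow> (x - p) \<bullet> y = 0"
        using orthogonal_projection_exists[OF closed_closure subspace_closed_span] by metis
      have "p \<in> X" using p(1) \<open>closed_span E \<subseteq> X\<close> by blast
      then have "x - p = 0" using x X(2) p(2) closed_span_superset
        by (intro max0) (auto intro: subspace_diff)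
      then show "x \<in> closed_span E" using p(1) by simp
    qed
  qed
  have "countable E"
  proof (rule separated_countable[OF sep, of 1])
    fix x y assume xy: "x \<in> E" "y \<in> E" "x \<noteq> y"
    have "1\<^sup>2 \<le> (dist x y)\<^sup>2"
      using xy orthonormal_onD[OF E(2)]
      by (simp add: dist_norm power2_norm_eq_inner inner_simps)
    then show "dist x y \<ge> 1" using power2_le_imp_le zero_le_dist by blast
  qed simp
  moreover have "infinite E"
  proof
    assume fin: "finite E"
    have "X \<subseteq> span E"
    proof
      fix x assume x: "x \<in> X"
      define s where "s = (\<Sum>y\<in>E. (x \<bullet> y) *\<^sub>R y)"
      have sE: "s \<in> span E" unfolding s_def by (intro span_sum span_scale span_base)
      then have "s \<in> X" using span closure_subset by blast
      moreover have "s \<bullet> y = x \<bullet> y" if "y \<in> E" for y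
        using that fin orthonormal_onD[OF E(2)]
        by (simp add: s_def inner_sum_left if_distrib[of "(*) _"] sum.delta cong: if_cong)
      ultimately have "x - s = 0" using x X(2)
        by (intro max0) (auto intro: subspace_diff simp: inner_simps)
      then show "x \<in> span E" using sE by simp
    qed
    then show False using X(3) fin unfolding infinite_dim_def by blast
  qed
  ultimately obtain e :: "nat \<Rightarrow> 'h" where e: "bij_betw e UNIV E"
    using bij_betw_from_nat_into by blast
  have "orthonormal_on UNIV e"
    using e E(2) unfolding orthonormal_on_def bij_betw_def inj_on_def by auto
  moreover have "range e = E" using e by (simp add: bij_betw_def)
  ultimately show ?thesis using span that by blast
qed

section \<open>Strong boundedness of the orthogonal group\<close>

text \<open>For an orthonormal basis \<open>e\<close> such operators also preserve the closed span
  of the block \<open>K\<close> (\<open>supported_ops_maps\<close>), so this is a copy of the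
  orthogonal group of that block.\<close>

definition supported_ops :: "('i \<Rightarrow> 'h::real_inner) \<Rightarrow> 'i set \<Rightarrow> ('h \<Rightarrow> 'h) set"
  where "supported_ops e K = {U. orthogonal_op U \<and> (\<forall>i. i \<notin> K \<longrightarrow> U (e i) = e i)}"

lemma orthonormal_total:
  fixes e :: "'i \<Rightarrow> 'h::{real_inner, complete_space}"
  assumes "\<And>z. (\<And>i. i \<in> I \<Longrightarrow> z \<bullet> e i = 0) \<Longrightarrow> z = 0"
  shows "closed_span (e ` I) = UNIV"
proof (rule closed_subspace_eq_UNIV[OF closed_closure subspace_closed_span])
  fix z assume z: "\<And>x. x \<in> closed_span (e ` I) \<Longrightarrow> z \<bullet> x = 0"
  show "z = 0"
    by (rule assms) (simp add: z closed_span_base)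
qed

lemma total_orthogonal_imp_zero:
  assumes "closed_span (e ` I) = UNIV" "\<And>i. i \<in> I \<Longrightarrow> z \<bullet> e i = 0"
  shows "z = 0"
proof -
  have "z \<bullet> z = 0" by (rule orthogonal_closed_span[where S = "e ` I"]) (use assms in auto)
  then show ?thesis by simp
qed

lemma closed_span_disjoint_orthogonal:
  assumes "orthonormal_on UNIV e" "K \<inter> K' = {}" "x \<in> closed_span (e ` K)" "y \<in> closed_span (e ` K')"
  shows "x \<bullet> y = 0"
proof (rule orthogonal_closed_span[OF _ assms(4)])
  fix s assume s: "s \<in> e ` K'"
  have "s \<bullet> x = 0"
    by (rule orthogonal_closed_span[OF _ assms(3)]) (use s assms(1,2) in \<open>auto simp: orthonormal_on_def\<close>)
  then show "x \<bullet> s = 0" by (simp add: inner_commute)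
qed

text \<open>The difference of \<open>x\<close> and its projection to the block is orthogonal to
  every basis vector: inside the block by projection, outside by assumption.\<close>

lemma closed_span_subfamilyI:
  fixes e :: "'i \<Rightarrow> 'h::{real_inner, complete_space}"
  assumes e: "orthonormal_on UNIV e" "closed_span (range e) = UNIV"
    and x: "\<And>j. j \<notin> K \<Longrightarrow> x \<bullet> e j = 0"
  shows "x \<in> closed_span (e ` K)"
proof -
  obtain p where p: "p \<in> closed_span (e ` K)" "\<And>y. y \<in> closed_span (e ` K) \<Longrightarrow> (x - p) \<bullet> y = 0"
    using orthogonal_projection_exists[OF closed_closure subspace_closed_span] by metis
  have "x - p = 0"
  proof (rule total_orthogonal_imp_zero[OF e(2)])
    fix i
    show "(x - p) \<bullet> e i = 0"
    proof (cases "i \<in> K")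
      case True
      then show ?thesis by (simp add: p(2) closed_span_base)
    next
      case False
      have "p \<bullet> e i = 0"
        by (rule closed_span_disjoint_orthogonal[OF e(1) _ p(1), of "{i}"])
          (use False in \<open>auto intro: closed_span_base\<close>)
      then show ?thesis using x[OF False] by (simp add: inner_simps)
    qed
  qed
  then show ?thesis using p(1) by simp
qed

lemma closed_span_subfamily_mono: "K \<subseteq> K' \<Longrightarrow> closed_span (e ` K) \<subseteq> closed_span (e ` K')"
  by (intro closure_mono span_mono image_mono)

lemma closed_span_member: "i \<in> K \<Longrightarrow> e i \<in> closed_span (e ` K)"
  by (simp add: closed_span_base)

lemma infinite_dim_closed_span:
  "orthonormal_on UNIV e \<Longrightarrow> infinite K \<Longrightarrow> infinite_dim (closed_span (e ` K))"
  by (rule infinite_orthonormal_imp_infinite_dim[of K e])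
    (auto simp: orthonormal_on_def closed_span_member)

lemma orthonormal_basis_reindex:
  assumes "orthonormal_on UNIV e" "closed_span (range e) = UNIV" "bij \<sigma>"
  shows "orthonormal_on UNIV (e \<circ> \<sigma>)" "closed_span (range (e \<circ> \<sigma>)) = UNIV"
proof -
  show "orthonormal_on UNIV (e \<circ> \<sigma>)"
    using assms(1) bij_is_inj[OF assms(3)] unfolding orthonormal_on_def by (metis UNIV_I comp_apply inj_eq)
  have "range (e \<circ> \<sigma>) = range e" using bij_is_surj[OF assms(3)] by (metis image_comp)
  then show "closed_span (range (e \<circ> \<sigma>)) = UNIV" using assms(2) by simp
qed

lemma orthogonal_op_reindex:
  fixes e :: "'i \<Rightarrow> 'h::{real_inner, complete_space}" and f :: "'j \<Rightarrow> 'h"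
  assumes "orthonormal_on UNIV e" "closed_span (range e) = UNIV"
    and f: "orthonormal_on UNIV f" "closed_span (range f) = UNIV" and "bij \<sigma>"
  obtains U where "orthogonal_op U" "\<And>i. U (e i) = f (\<sigma> i)"
proof -
  obtain U where U: "orthogonal_op U" "\<And>i. i \<in> UNIV \<Longrightarrow> U (e i) = (f \<circ> \<sigma>) i"
    by (rule orthogonal_op_from_orthonormal_bases[OF assms(1,2) orthonormal_basis_reindex[OF f assms(5)]]) (rule that)
  show ?thesis by (rule that[OF U(1)]) (simp add: U(2))
qed

lemma supported_opsD:
  "U \<in> supported_ops e K \<Longrightarrow> orthogonal_op U"
  "U \<in> supported_ops e K \<Longrightarrow> i \<notin> K \<Longrightarrow> U (e i) = e i"
  by (auto simp: supported_ops_def)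

lemma supported_ops_inv:
  assumes "U \<in> supported_ops e K" shows "op_inv U \<in> supported_ops e K"
  unfolding supported_ops_def
proof (intro CollectI conjI allI impI)
  note U = supported_opsD[OF assms]
  show "orthogonal_op (op_inv U)" by (rule orthogonal_op_inv[OF U(1)])
  fix i assume "i \<notin> K"
  then show "op_inv U (e i) = e i" using U(2)[of i] orthogonal_op_inv_cancel(1)[OF U(1), of "e i"] by simp
qed

lemma supported_ops_maps:
  fixes e :: "'i \<Rightarrow> 'h::{real_inner, complete_space}"
  assumes e: "orthonormal_on UNIV e" "closed_span (range e) = UNIV"
    and U: "U \<in> supported_ops e K" and x: "x \<in> closed_span (e ` K)"
  shows "U x \<in> closed_span (e ` K)"
proof (rule closed_span_subfamilyI[OF e])
  fix j assume j: "j \<notin> K"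
  have "U x \<bullet> e j = U x \<bullet> U (e j)" using supported_opsD(2)[OF U j] by simp
  also have "\<dots> = x \<bullet> e j" using orthogonal_opD(3)[OF supported_opsD(1)[OF U]] .
  also have "\<dots> = 0"
    by (rule closed_span_disjoint_orthogonal[OF e(1) _ x, of "{j}"]) (use j in \<open>auto intro: closed_span_base\<close>)
  finally show "U x \<bullet> e j = 0" .
qed

lemma supported_ops_fixes:
  assumes e: "orthonormal_on UNIV e"
    and U: "U \<in> supported_ops e K" and x: "x \<in> closed_span (e ` K')" "K \<inter> K' = {}"
  shows "U x = x"
proof (rule linear_eq_on_closed_span[OF _ _ _ x(1)])
  show "bounded_linear U" using orthogonal_opD(2)[OF supported_opsD(1)[OF U]] .
qed (use supported_opsD(2)[OF U] x(2) in auto)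

lemma orthogonal_op_funpow: "orthogonal_op U \<Longrightarrow> orthogonal_op (U ^^ n)"
proof (induction n)
  case 0
  have "orthogonal_op (\<lambda>x :: 'a. x)"
    by (rule orthogonal_opI) (auto simp: linear_ident surj_def)
  then show ?case by (simp add: id_def)
next
  case (Suc n)
  then show ?case unfolding funpow.simps by (intro orthogonal_op_comp)
qed

text \<open>The diagonal argument behind the strong boundedness of infinite orthogonal groups: violations
  on infinitely many orthogonal blocks are glued into a single operator \<open>W\<close>, from which each of them
  is recovered as a commutator with a shift of its block.\<close>

lemma length_bounded_on_some_block:
  fixes e :: "nat \<times> int \<times> nat \<Rightarrow> 'h::{real_inner, complete_space}"
    and L :: "('h \<Rightarrow> 'h) \<Rightarrow> real"
  assumes e: "orthonormal_on UNIV e" "closed_span (range e) = UNIV"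
    and Lcomp: "\<And>U V. orthogonal_op U \<Longrightarrow> orthogonal_op V \<Longrightarrow> L (U \<circ> V) \<le> L U + L V"
    and Linv: "\<And>U. orthogonal_op U \<Longrightarrow> L (op_inv U) \<le> L U"
  shows "\<exists>k C. \<forall>U \<in> supported_ops e {i. fst i = k \<and> fst (snd i) = 0}. L U \<le> C"
proof (rule ccontr)
  define B where "B k j = {i :: nat \<times> int \<times> nat. fst i = k \<and> fst (snd i) = j}" for k j
  assume "\<not> ?thesis"
  then have unb: "\<exists>U\<in>supported_ops e (B k 0). L U > C" for k C
    by (fastforce simp: B_def not_le)
  \<comment> \<open>For each \<open>k\<close>, a bilateral shift along \<open>j\<close> of the
    blocks \<open>B k j\<close> that fixes all blocks with another first index. Integer
    \<open>j\<close> keeps the shift invertible.\<close>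
  have "\<exists>U. orthogonal_op U \<and> (\<forall>k' j i. U (e (k', j, i)) = e (k', if k' = k then j + 1 else j, i))" for k
  proof -
    define \<pi> where "\<pi> = (\<lambda>(k', j :: int, i :: nat). (k' :: nat, if k' = k then j + 1 else j, i))"
    have "inj \<pi>" by (auto simp: inj_def \<pi>_def split: if_splits)
    have "surj \<pi>"
      unfolding surj_def
    proof
      fix y :: "nat \<times> int \<times> nat"
      obtain k' j i where y: "y = (k', j, i)" by (cases y)
      show "\<exists>x. y = \<pi> x"
        by (rule exI[of _ "(k', if k' = k then j - 1 else j, i)"]) (simp add: y \<pi>_def)
    qed
    have "bij \<pi>" using \<open>inj \<pi>\<close> \<open>surj \<pi>\<close> by (rule bijI)
    then obtain U where "orthogonal_op U" "\<And>i. U (e i) = e (\<pi> i)"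
      using orthogonal_op_reindex[OF e e] by blast
    then show ?thesis by (intro exI[of _ U]) (simp add: \<pi>_def)
  qed
  then obtain c where c: "\<And>k. orthogonal_op (c k)"
    "\<And>k k' j i. c k (e (k', j, i)) = e (k', if k' = k then j + 1 else j, i)"
    by metis
  \<comment> \<open>The threshold anticipates the commutator: \<open>T k\<close> will be a product
    of \<open>W\<close>, \<open>c k\<close> and their inverses, of length at most
    \<open>2 * L W + 2 * L (c k)\<close>, and \<open>L W \<le> real k\<close> for some
    \<open>k\<close>.\<close>
  have "\<exists>U\<in>supported_ops e (B k 0). L U > 2 * real k + 2 * L (c k)" for k
    using unb by blast
  then obtain T where T: "\<And>k. T k \<in> supported_ops e (B k 0)" "\<And>k. L (T k) > 2 * real k + 2 * L (c k)"
    by metis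
  note To = supported_opsD(1)[OF T(1)]
  \<comment> \<open>The image of the basis under the glued operator: on \<open>B k j\<close> with
    \<open>j \<ge> 0\<close> a copy of \<open>T k\<close> transported by the shift, the identity for
    \<open>j < 0\<close>.\<close>
  define f where "f = (\<lambda>(k, j, i). if j \<ge> 0 then (c k ^^ nat j) (T k (e (k, 0, i))) else e (k, j, i))"
  have cn: "(c k ^^ n) (e (k, j, i)) = e (k, j + int n, i)" for k n j i
    by (induction n) (simp_all add: c(2) algebra_simps)
  have cn_maps: "(c k ^^ n) x \<in> closed_span (e ` B k (j + int n))" if "x \<in> closed_span (e ` B k j)" for k n j x
  proof (rule linear_image_closed_span[OF orthogonal_opD(2)[OF orthogonal_op_funpow[OF c(1)]] _ that])
    fix s assume "s \<in> e ` B k j"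
    then obtain i where "s = e (k, j, i)" by (auto simp: B_def)
    then show "(c k ^^ n) s \<in> closed_span (e ` B k (j + int n))"
      by (simp add: cn) (rule closed_span_member, simp add: B_def)
  qed
  have TB: "T k (e (k, 0, i)) \<in> closed_span (e ` B k 0)" for k i
    by (rule supported_ops_maps[OF e T(1)]) (simp add: closed_span_member B_def)
  have fB: "f (k, j, i) \<in> closed_span (e ` B k j)" for k j i
  proof (cases "j \<ge> 0")
    case True
    have "(c k ^^ nat j) (T k (e (k, 0, i))) \<in> closed_span (e ` B k (0 + int (nat j)))"
      by (rule cn_maps[OF TB])
    then show ?thesis using True by (simp add: f_def)
  next
    case False
    then show ?thesis by (simp add: f_def) (rule closed_span_member, simp add: B_def)
  qed
  have f_on: "orthonormal_on UNIV f"
    unfolding orthonormal_on_def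
  proof (intro ballI)
    fix x y :: "nat \<times> int \<times> nat"
    obtain k j i k' j' i' where xy: "x = (k, j, i)" "y = (k', j', i')" by (cases x, cases y) auto
    show "f x \<bullet> f y = (if x = y then 1 else 0)"
    proof (cases "k = k' \<and> j = j'")
      case True
      then show ?thesis
        using orthonormal_onD[OF e(1), of x y] orthonormal_onD[OF e(1), of "(k, 0, i)" "(k, 0, i')"]
        by (auto simp: xy f_def orthogonal_opD(3)[OF orthogonal_op_funpow[OF c(1)]] orthogonal_opD(3)[OF To])
    next
      case False
      then have "B k j \<inter> B k' j' = {}" by (auto simp: B_def)
      then show ?thesis
        using closed_span_disjoint_orthogonal[OF e(1) _ fB fB] False by (auto simp: xy)
    qed
  qed
  obtain W where W: "linear W" "\<And>x y. W x \<bullet> W y = x \<bullet> y" "\<And>i. W (e i) = f i"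
    using isometry_from_orthonormal[OF e f_on] by auto
  have "surj W"
  proof (rule isometry_range_closed_span[OF W(1,2)])
    have "e (k, j, i) \<in> closed_span (range W)" for k j i
    proof (cases "j \<ge> 0")
      case False
      then have "e (k, j, i) = W (e (k, j, i))" by (simp add: W(3) f_def)
      then show ?thesis by (metis closed_span_base rangeI)
    next
      case True
      define y where "y = op_inv (T k) (e (k, 0, i))"
      have "op_inv (T k) \<in> supported_ops e (B k 0)" by (rule supported_ops_inv[OF T(1)])
      then have y: "y \<in> closed_span (e ` B k 0)"
        unfolding y_def by (rule supported_ops_maps[OF e]) (simp add: closed_span_member B_def)
      have "((c k ^^ nat j) \<circ> T k) y \<in> closed_span (range W)"
      proof (rule linear_image_closed_span[OF _ _ y])
        show "bounded_linear ((c k ^^ nat j) \<circ> T k)"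
          by (intro orthogonal_opD(2) orthogonal_op_comp orthogonal_op_funpow c(1) To)
        fix s assume "s \<in> e ` B k 0"
        then obtain i' where "s = e (k, 0, i')" by (auto simp: B_def)
        then have "((c k ^^ nat j) \<circ> T k) s = W (e (k, j, i'))" using True by (simp add: W(3) f_def)
        then show "((c k ^^ nat j) \<circ> T k) s \<in> closed_span (range W)" by (metis closed_span_base rangeI)
      qed
      moreover have "((c k ^^ nat j) \<circ> T k) y = e (k, j, i)"
        using True by (simp add: y_def orthogonal_op_inv_cancel(2)[OF To] cn)
      ultimately show ?thesis by simp
    qed
    then have "range e \<subseteq> closed_span (range W)" by auto
    then have "closed_span (range e) \<subseteq> closed_span (range W)"
      by (intro closed_span_minimal closed_closure subspace_closed_span)
    then show "closed_span (range W) = UNIV" using e(2) by blast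
  qed
  then have Wo: "orthogonal_op W" using W orthogonal_opI by blast
  obtain k where k: "L W \<le> real k" using real_arch_simple by blast
  \<comment> \<open>Conjugating \<open>W\<close> by the shift moves the copies of \<open>T k\<close>
    from \<open>j \<ge> 0\<close> to \<open>j \<ge> 1\<close>, so \<open>W\<close> and its conjugate
    differ exactly by the copy at \<open>j = 0\<close>. On basis vectors this shows at
    \<open>j = -1\<close>, which the shift sends into that block.\<close>
  have comm: "(W \<circ> c k) x = (T k \<circ> c k \<circ> W) x" for x
  proof (rule linear_eq_on_closed_span[of "W \<circ> c k" "T k \<circ> c k \<circ> W" "range e"])
    show "bounded_linear (W \<circ> c k)" "bounded_linear (T k \<circ> c k \<circ> W)"
      by (intro orthogonal_opD(2) orthogonal_op_comp Wo c(1) To)+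
    show "x \<in> closed_span (range e)" using e(2) by simp
    fix s assume "s \<in> range e"
    then obtain k' j i where s: "s = e (k', j, i)" by auto
    show "(W \<circ> c k) s = (T k \<circ> c k \<circ> W) s"
    proof (cases "k' = k")
      case False
      have ck: "c k x = x" if "x \<in> closed_span (e ` B k' j)" for x
      proof (rule linear_eq_on_closed_span[OF orthogonal_opD(2)[OF c(1)] bounded_linear_ident _ that])
        fix s assume "s \<in> e ` B k' j"
        then show "c k s = s" using False by (auto simp: B_def c(2))
      qed
      have "T k (f (k', j, i)) = f (k', j, i)"
        by (rule supported_ops_fixes[OF e(1) T(1) fB]) (use False in \<open>auto simp: B_def\<close>)
      then show ?thesis using False by (simp add: s c(2) W(3) ck[OF fB])
    next
      case True
      consider "j < -1" | "j = -1" | "j \<ge> 0" by linarith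
      then show ?thesis
      proof cases
        case 1
        then have "T k (e (k, j + 1, i)) = e (k, j + 1, i)"
          by (intro supported_opsD(2)[OF T(1)]) (simp add: B_def)
        then show ?thesis using True 1 by (simp add: s c(2) W(3) f_def)
      next
        case 2
        then show ?thesis using True by (simp add: s c(2) W(3) f_def)
      next
        case 3
        have "f (k, j + 1, i) = c k (f (k, j, i))"
          using 3 by (simp add: f_def nat_add_distrib)
        moreover have "T k (f (k, j + 1, i)) = f (k, j + 1, i)"
          by (rule supported_ops_fixes[OF e(1) T(1) fB]) (use 3 in \<open>auto simp: B_def\<close>)
        ultimately show ?thesis using True by (simp add: s c(2) W(3))
      qed
    qed
  qed
  have "T k x = (W \<circ> (c k \<circ> (op_inv W \<circ> op_inv (c k)))) x" for x
    using comm[of "op_inv W (op_inv (c k) x)"]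
    by (simp add: orthogonal_op_inv_cancel(2)[OF Wo] orthogonal_op_inv_cancel(2)[OF c(1)])
  then have Teq: "T k = W \<circ> (c k \<circ> (op_inv W \<circ> op_inv (c k)))" by blast
  have "L (op_inv W \<circ> op_inv (c k)) \<le> L W + L (c k)"
    using Lcomp[OF orthogonal_op_inv[OF Wo] orthogonal_op_inv[OF c(1)]] Linv[OF Wo] Linv[OF c(1)] by (rule order_trans[OF _ add_mono])
  moreover have "L (c k \<circ> (op_inv W \<circ> op_inv (c k))) \<le> L (c k) + L (op_inv W \<circ> op_inv (c k))"
    by (intro Lcomp orthogonal_op_comp orthogonal_op_inv Wo c(1))
  moreover have "L (T k) \<le> L W + L (c k \<circ> (op_inv W \<circ> op_inv (c k)))"
    unfolding Teq by (intro Lcomp orthogonal_op_comp orthogonal_op_inv Wo c(1))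
  ultimately have "L (T k) \<le> 2 * real k + 2 * L (c k)" using k by linarith
  then show False using T(2)[of k] by simp
qed

section \<open>From one bounded block to the whole orthogonal group\<close>

lemma bij_matching_infinite_subsets:
  fixes K :: "'i::countable set" and K' :: "'j::countable set"
  assumes "infinite K" "infinite (- K)" "infinite K'" "infinite (- K')"
  obtains \<sigma> where "bij \<sigma>" "\<And>i. \<sigma> i \<in> K' \<longleftrightarrow> i \<in> K"
proof -
  have ex: "\<exists>h. bij_betw h A B" if "infinite A" "infinite B" for A :: "'i set" and B :: "'j set"
  proof -
    have "bij_betw (to_nat_on A) A UNIV" "bij_betw (from_nat_into B) UNIV B"
      using that by (auto intro: to_nat_on_infinite bij_betw_from_nat_into)
    then show ?thesis using bij_betw_trans by blast
  qed
  obtain h h' where h: "bij_betw h K K'" "bij_betw h' (- K) (- K')" using ex assms by metis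
  let ?\<sigma> = "\<lambda>i. if i \<in> K then h i else h' i"
  have "bij_betw ?\<sigma> K K'" using h(1) by (subst bij_betw_cong[of K ?\<sigma> h]) auto
  moreover have "bij_betw ?\<sigma> (- K) (- K')" using h(2) by (subst bij_betw_cong[of "- K" ?\<sigma> h']) auto
  ultimately have "bij_betw ?\<sigma> (K \<union> - K) (K' \<union> - K')" by (rule bij_betw_combine) auto
  then have "bij ?\<sigma>" by simp
  moreover have "?\<sigma> i \<in> K' \<longleftrightarrow> i \<in> K" for i
    using h by (auto simp: bij_betw_def)
  ultimately show ?thesis using that by blast
qed

text \<open>Infinite index sets with infinite complement all look alike after reindexing. An
  orthogonal operator \<open>V\<close> carries the block \<open>K\<close> to the block on which
  \<open>L\<close> is already bounded, and conjugation by \<open>V\<close> changes \<open>L\<close>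
  by at most \<open>2 * L V\<close>.\<close>

lemma length_bounded_on_supported_ops:
  fixes e :: "'i::countable \<Rightarrow> 'h::{real_inner, complete_space}"
    and L :: "('h \<Rightarrow> 'h) \<Rightarrow> real"
  assumes e: "orthonormal_on UNIV e" "closed_span (range e) = UNIV"
    and Lcomp: "\<And>U V. orthogonal_op U \<Longrightarrow> orthogonal_op V \<Longrightarrow> L (U \<circ> V) \<le> L U + L V"
    and Linv: "\<And>U. orthogonal_op U \<Longrightarrow> L (op_inv U) \<le> L U"
    and K: "infinite K" "infinite (- K)"
  shows "\<exists>C. \<forall>U \<in> supported_ops e K. L U \<le> C"
proof -
  have "infinite (UNIV :: 'i set)" by (rule infinite_super[OF subset_UNIV K(1)])
  then obtain \<tau> :: "nat \<times> int \<times> nat \<Rightarrow> 'i" where \<tau>: "bij \<tau>"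
  proof -
    have "bij_betw (from_nat_into (UNIV :: 'i set)) UNIV UNIV"
      using \<open>infinite (UNIV :: 'i set)\<close> by (intro bij_betw_from_nat_into) auto
    moreover have "bij_betw (to_nat_on (UNIV :: (nat \<times> int \<times> nat) set)) UNIV UNIV"
      by (intro to_nat_on_infinite) (auto simp: finite_prod)
    ultimately have "bij (from_nat_into (UNIV :: 'i set) \<circ> to_nat_on (UNIV :: (nat \<times> int \<times> nat) set))"
      by (rule bij_betw_trans[rotated])
    then show ?thesis by (rule that)
  qed
  define e0 where "e0 = e \<circ> \<tau>"
  have e0: "orthonormal_on UNIV e0" "closed_span (range e0) = UNIV"
    unfolding e0_def by (fact orthonormal_basis_reindex[OF e \<tau>])+
  obtain k C where C: "\<forall>U \<in> supported_ops e0 {i. fst i = k \<and> fst (snd i) = 0}. L U \<le> C"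
    using length_bounded_on_some_block[OF e0 Lcomp Linv] by blast
  let ?K = "{i :: nat \<times> int \<times> nat. fst i = k \<and> fst (snd i) = 0}"
  have "inj (\<lambda>i :: nat. (k, 0 :: int, i))" "inj (\<lambda>i :: nat. (k, 1 :: int, i))" by (auto simp: inj_def)
  then have "infinite (range (\<lambda>i :: nat. (k, 0 :: int, i)))" "infinite (range (\<lambda>i :: nat. (k, 1 :: int, i)))"
    using finite_imageD infinite_UNIV_nat by blast+
  moreover have "range (\<lambda>i :: nat. (k, 0 :: int, i)) \<subseteq> ?K" "range (\<lambda>i :: nat. (k, 1 :: int, i)) \<subseteq> - ?K" by auto
  ultimately have "infinite ?K" "infinite (- ?K)" using infinite_super by blast+
  then obtain \<sigma> where \<sigma>: "bij \<sigma>" "\<And>i. \<sigma> i \<in> ?K \<longleftrightarrow> i \<in> K"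
    using bij_matching_infinite_subsets[OF K] by blast
  obtain V where V: "orthogonal_op V" "\<And>i. V (e i) = e0 (\<sigma> i)"
    using orthogonal_op_reindex[OF e e0 \<sigma>(1)] by blast
  note Vi = orthogonal_op_inv_cancel[OF V(1)]
  have "L U \<le> L V + C + L V" if U: "U \<in> supported_ops e K" for U
  proof -
    note Uo = supported_opsD(1)[OF U]
    have "V \<circ> U \<circ> op_inv V \<in> supported_ops e0 ?K"
      unfolding supported_ops_def
    proof (intro CollectI conjI allI impI)
      show "orthogonal_op (V \<circ> U \<circ> op_inv V)" by (intro orthogonal_op_comp orthogonal_op_inv V(1) Uo)
      fix j assume j: "j \<notin> ?K"
      obtain i where i: "j = \<sigma> i" using \<sigma>(1) by (metis bij_pointE)
      then have "i \<notin> K" using j \<sigma>(2) by blast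
      then show "(V \<circ> U \<circ> op_inv V) (e0 j) = e0 j"
        using supported_opsD(2)[OF U] by (simp add: i V(2)[symmetric] Vi)
    qed
    then have 1: "L (V \<circ> U \<circ> op_inv V) \<le> C" using C by blast
    have "U = op_inv V \<circ> (V \<circ> U \<circ> op_inv V) \<circ> V" by (auto simp: Vi fun_eq_iff)
    then have "L U \<le> L (op_inv V \<circ> (V \<circ> U \<circ> op_inv V)) + L V"
      using Lcomp by (metis orthogonal_op_comp orthogonal_op_inv V(1) Uo)
    moreover have "L (op_inv V \<circ> (V \<circ> U \<circ> op_inv V)) \<le> L (op_inv V) + L (V \<circ> U \<circ> op_inv V)"
      by (intro Lcomp orthogonal_op_comp orthogonal_op_inv V(1) Uo)
    ultimately show ?thesis using 1 Linv[OF V(1)] by linarith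
  qed
  then show ?thesis by blast
qed

text \<open>The family \<open>y\<close> witnesses that the part of the block orthogonal to all
  \<open>x j\<close> is infinite-dimensional. That part then has an orthonormal basis that can be
  matched with the infinite set \<open>K - J\<close>.\<close>

lemma supported_op_extending_partial_isometry:
  fixes e :: "'i::countable \<Rightarrow> 'h::{real_inner, complete_space}"
  assumes sep: "separable_space (euclidean :: 'h topology)"
    and e: "orthonormal_on UNIV e" "closed_span (range e) = UNIV"
    and J: "J \<subseteq> K" "infinite (K - J)"
    and x: "orthonormal_on J x" "x ` J \<subseteq> closed_span (e ` K)"
    and y: "orthonormal_on (UNIV :: nat set) y" "range y \<subseteq> closed_span (e ` K)"
      "\<And>n j. j \<in> J \<Longrightarrow> y n \<bullet> x j = 0"
  obtains U where "U \<in> supported_ops e K" "\<And>j. j \<in> J \<Longrightarrow> U (e j) = x j"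
proof -
  define X where "X = closed_span (e ` K) \<inter> {v. \<forall>j\<in>J. v \<bullet> x j = 0}"
  have eq: "{v. \<forall>j\<in>J. v \<bullet> x j = 0} = (\<Inter>j\<in>J. {v. v \<bullet> x j = 0})" by auto
  have "closed {v. \<forall>j\<in>J. v \<bullet> x j = 0}"
    unfolding eq by (intro closed_INT ballI closed_Collect_eq continuous_intros)
  then have "closed X" unfolding X_def by (intro closed_Int closed_closure)
  moreover have "subspace X"
    unfolding X_def by (intro subspace_inter subspace_closed_span) (auto simp: subspace_def inner_simps)
  moreover have "infinite_dim X"
    by (rule infinite_orthonormal_imp_infinite_dim[OF y(1)]) (use y in \<open>auto simp: X_def\<close>)
  ultimately obtain d :: "nat \<Rightarrow> 'h" where d: "orthonormal_on UNIV d" "closed_span (range d) = X"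
    using orthonormal_basis_exists[OF sep] by metis
  have dX: "d n \<in> X" for n
    using closed_span_base[of "d n" "range d"] d(2) by simp
  have b: "inj_on (to_nat_on (K - J)) (K - J)" "to_nat_on (K - J) ` (K - J) = UNIV"
    using to_nat_on_infinite[OF _ J(2)] by (auto simp: bij_betw_def)
  define \<phi> where "\<phi> i = (if i \<in> J then x i else if i \<in> K then d (to_nat_on (K - J) i) else e i)" for i
  have outside: "z \<bullet> e i = 0" if "z \<in> closed_span (e ` K)" "i \<notin> K" for z i
    by (rule closed_span_disjoint_orthogonal[OF e(1) _ that(1), of "{i}"])
      (use that in \<open>auto intro: closed_span_base\<close>)
  have xd: "x j \<bullet> d n = 0" "d n \<bullet> x j = 0" if "j \<in> J" for j n
    using that dX[of n] by (auto simp: X_def inner_commute)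
  have \<phi>K: "\<phi> i \<in> closed_span (e ` K)" if "i \<in> K" for i
    using that x(2) dX by (auto simp: \<phi>_def X_def)
  have "orthonormal_on UNIV \<phi>"
    unfolding orthonormal_on_def
  proof (intro ballI)
    fix i j
    consider "i \<in> K" "j \<in> K" | "i \<notin> K" "j \<in> K" | "i \<in> K" "j \<notin> K" | "i \<notin> K" "j \<notin> K" by blast
    then show "\<phi> i \<bullet> \<phi> j = (if i = j then 1 else 0)"
    proof cases
      case 1
      consider "i \<in> J" "j \<in> J" | "i \<in> J" "j \<notin> J" | "i \<notin> J" "j \<in> J" | "i \<notin> J" "j \<notin> J" by blast
      then show ?thesis
      proof cases
        case 1
        then show ?thesis using orthonormal_onD[OF x(1)] by (simp add: \<phi>_def)
      next
        case 2
        with \<open>j \<in> K\<close> have "\<phi> i \<bullet> \<phi> j = 0" "i \<noteq> j" by (auto simp: \<phi>_def xd)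
        then show ?thesis by simp
      next
        case 3
        with \<open>i \<in> K\<close> have "\<phi> i \<bullet> \<phi> j = 0" "i \<noteq> j" by (auto simp: \<phi>_def xd)
        then show ?thesis by simp
      next
        case 4
        with 1 inj_on_eq_iff[OF b(1), of i j] orthonormal_onD[OF d(1)]
        show ?thesis by (simp add: \<phi>_def)
      qed
    next
      case 2
      then show ?thesis using outside[OF \<phi>K, of j i] J(1) by (auto simp: \<phi>_def inner_commute)
    next
      case 3
      then show ?thesis using outside[OF \<phi>K, of i j] J(1) by (auto simp: \<phi>_def)
    next
      case 4
      then have "\<phi> i = e i" "\<phi> j = e j" using J(1) by (auto simp: \<phi>_def)
      then show ?thesis using orthonormal_onD[OF e(1)] by simp
    qed
  qed
  moreover have "closed_span (range \<phi>) = UNIV"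
  proof (rule orthonormal_total)
    fix z assume "\<And>i. i \<in> UNIV \<Longrightarrow> z \<bullet> \<phi> i = 0"
    then have z: "z \<bullet> \<phi> i = 0" for i by blast
    have "z \<in> closed_span (e ` K)"
    proof (rule closed_span_subfamilyI[OF e])
      fix j assume "j \<notin> K"
      then have "\<phi> j = e j" using J(1) by (auto simp: \<phi>_def)
      then show "z \<bullet> e j = 0" using z[of j] by simp
    qed
    moreover have "z \<bullet> x j = 0" if "j \<in> J" for j using z[of j] that by (simp add: \<phi>_def)
    ultimately have zX: "z \<in> closed_span (range d)" by (simp add: X_def d(2))
    have "z \<bullet> d n = 0" for n
    proof -
      obtain i where "i \<in> K - J" "n = to_nat_on (K - J) i" using b(2) by blast
      then show ?thesis using z[of i] by (simp add: \<phi>_def)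
    qed
    then have "z \<bullet> z = 0" by (intro orthogonal_closed_span[OF _ zX]) auto
    then show "z = 0" by simp
  qed
  ultimately obtain U where U: "orthogonal_op U" "\<And>i. U (e i) = \<phi> i"
    using orthogonal_op_from_orthonormal_bases[OF e, of \<phi>] by auto
  show ?thesis
  proof (rule that[of U])
    show "U \<in> supported_ops e K" using U J(1) by (auto simp: supported_ops_def \<phi>_def)
    show "U (e j) = x j" if "j \<in> J" for j using that by (simp add: U(2) \<phi>_def)
  qed
qed

text \<open>Every orthogonal operator is a product of four factors, each supported on one of two fixed blocks
  that are infinite with infinite complement.\<close>

theorem orthogonal_group_length_bounded:
  fixes L :: "('h::{real_inner, complete_space} \<Rightarrow> 'h) \<Rightarrow> real"
  assumes sep: "separable_space (euclidean :: 'h topology)"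
    and inf: "infinite_dim (UNIV :: 'h set)"
    and Lcomp: "\<And>U V. orthogonal_op U \<Longrightarrow> orthogonal_op V \<Longrightarrow> L (U \<circ> V) \<le> L U + L V"
    and Linv: "\<And>U. orthogonal_op U \<Longrightarrow> L (op_inv U) \<le> L U"
  shows "\<exists>C. \<forall>U. orthogonal_op U \<longrightarrow> L U \<le> C"
proof -
  obtain b :: "nat \<Rightarrow> 'h" where b: "orthonormal_on UNIV b" "closed_span (range b) = UNIV"
    using orthonormal_basis_exists[OF sep closed_UNIV subspace_UNIV inf] by metis
  define e where "e = b \<circ> (prod_encode :: nat \<times> nat \<Rightarrow> nat)"
  have e: "orthonormal_on UNIV e" "closed_span (range e) = UNIV"
    unfolding e_def by (fact orthonormal_basis_reindex[OF b bij_prod_encode])+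
  define row where "row S = {i :: nat \<times> nat. fst i \<in> S}" for S
  have inf_row: "infinite (row S)" if "s \<in> S" for s S
  proof -
    have "inj (Pair s :: nat \<Rightarrow> nat \<times> nat)" by (auto simp: inj_def)
    then have "infinite (range (Pair s :: nat \<Rightarrow> nat \<times> nat))"
      using finite_imageD infinite_UNIV_nat by blast
    moreover have "range (Pair s) \<subseteq> row S" using that by (auto simp: row_def)
    ultimately show ?thesis using infinite_super by blast
  qed
  have row_simps: "- row S = row (- S)" "row S - row S' = row (S - S')" "S \<subseteq> S' \<Longrightarrow> row S \<subseteq> row S'"
     "row S \<inter> row S' = row (S \<inter> S')" for S S'
    by (auto simp: row_def)
  \<comment> \<open>Rows \<open>0\<close> and \<open>1\<close> are the parts A and B, the rows from
    \<open>2\<close> on form C. Row \<open>2\<close> is added to \<open>?AB\<close> as spare room: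
    row \<open>0\<close> will have to be moved to a family inside rows \<open>0\<close> and
    \<open>1\<close> whose complement in \<open>?AB\<close> stays infinite-dimensional.\<close>
  let ?AB = "row {0, 1, 2}" and ?BC = "row (- {0})" and ?A = "row {0}" and ?J = "row (- {0, 1})"
  have bd: "\<exists>C. \<forall>U \<in> supported_ops e (row S). L U \<le> C" if "s \<in> S" "s' \<notin> S" for S s s'
    by (rule length_bounded_on_supported_ops[OF e Lcomp Linv inf_row[OF that(1)]])
      (use that inf_row[of s' "- S"] in \<open>auto simp: row_simps\<close>)
  obtain C1 where C1: "\<And>U. U \<in> supported_ops e ?AB \<Longrightarrow> L U \<le> C1" using bd[of 0 "{0,1,2}" 3] by auto
  obtain C2 where C2: "\<And>U. U \<in> supported_ops e ?BC \<Longrightarrow> L U \<le> C2" using bd[of 1 "- {0}" 0] by auto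
  have "L g \<le> C2 + C1 + C2 + C1" if g: "orthogonal_op g" for g
  proof -
    note gi = orthogonal_op_inv_cancel[OF g] and gD = orthogonal_opD[OF g]
    \<comment> \<open>Recursive choice of orthonormal \<open>a n\<close> in A and \<open>c n\<close>
      in B and C such that every \<open>g (a m)\<close> is orthogonal to every \<open>c n\<close>.
      Each choice meets finitely many linear conditions inside an infinite-dimensional
      block.\<close>
    define P where "P f n r \<longleftrightarrow> fst r \<in> closed_span (e ` ?A) \<and> norm (fst r) = 1 \<and>
        snd r \<in> closed_span (e ` ?BC) \<and> norm (snd r) = 1 \<and> g (fst r) \<bullet> snd r = 0 \<and>
        (\<forall>m<n. fst r \<bullet> fst (f m) = 0 \<and> snd r \<bullet> snd (f m) = 0 \<and>
          g (fst r) \<bullet> snd (f m) = 0 \<and> g (fst (f m)) \<bullet> snd r = 0)"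
      for f :: "nat \<Rightarrow> 'h \<times> 'h" and n :: nat and r :: "'h \<times> 'h"
    have "\<exists>f. \<forall>n. P f n (f n)"
    proof (rule dependent_wellorder_choice)
      fix r :: "'h \<times> 'h" and f f' :: "nat \<Rightarrow> 'h \<times> 'h" and n :: nat
      assume "\<And>m. m < n \<Longrightarrow> f m = f' m"
      then show "P f n r = P f' n r" by (simp add: P_def)
    next
      fix n and f :: "nat \<Rightarrow> 'h \<times> 'h"
      have "finite ((\<lambda>m. fst (f m)) ` {..<n} \<union> (\<lambda>m. op_inv g (snd (f m))) ` {..<n})" by simp
      note unit = infinite_dim_unit_orthogonal[OF this subspace_closed_span infinite_dim_closed_span[OF e(1) inf_row[of 0 "{0}"]]]
      obtain a where a: "a \<in> closed_span (e ` ?A)" "norm a = 1"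
        "\<And>m. m < n \<Longrightarrow> a \<bullet> fst (f m) = 0" "\<And>m. m < n \<Longrightarrow> a \<bullet> op_inv g (snd (f m)) = 0"
        by (rule unit) auto
      have "finite ((\<lambda>m. snd (f m)) ` {..<n} \<union> (\<lambda>m. g (fst (f m))) ` {..<n} \<union> {g a})" by simp
      note unit = infinite_dim_unit_orthogonal[OF this subspace_closed_span infinite_dim_closed_span[OF e(1) inf_row[of 1 "-{0}"]]]
      obtain c where c: "c \<in> closed_span (e ` ?BC)" "norm c = 1"
        "\<And>m. m < n \<Longrightarrow> c \<bullet> snd (f m) = 0" "\<And>m. m < n \<Longrightarrow> c \<bullet> g (fst (f m)) = 0" "c \<bullet> g a = 0"
        by (rule unit) auto
      have "g a \<bullet> snd (f m) = 0" if "m < n" for m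
        using a(4)[OF that] gD(3)[of a "op_inv g (snd (f m))"] by (simp add: gi)
      then have "P f n (a, c)" using a c by (simp add: P_def inner_commute)
      then show "\<exists>r. P f n r" by blast
    qed
    then obtain f where f: "\<And>n. P f n (f n)" by blast
    define a c where "a n = fst (f n)" and "c n = snd (f n)" for n
    have aA: "a n \<in> closed_span (e ` ?A)" and cBC: "c n \<in> closed_span (e ` ?BC)" for n
      using f[of n] by (auto simp: P_def a_def c_def)
    have a_on: "a m \<bullet> a n = (if m = n then 1 else 0)" for m n
      using f[of m] f[of n] less_linear[of m n]
      by (auto simp: P_def a_def dot_square_norm inner_commute)
    have c_on: "c m \<bullet> c n = (if m = n then 1 else 0)" for m n
      using f[of m] f[of n] less_linear[of m n]
      by (auto simp: P_def c_def dot_square_norm inner_commute)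
    have gac: "g (a m) \<bullet> c n = 0" for m n
      using f[of m] f[of n] less_linear[of m n] by (auto simp: P_def a_def c_def)
    have e_on: "orthonormal_on UNIV (\<lambda>n. e (s, n))" for s
      using orthonormal_onD[OF e(1)] by (simp add: orthonormal_on_def)
    obtain w where w: "w \<in> supported_ops e ?AB" "\<And>n. w (e (0, n)) = a n"
    proof (rule supported_op_extending_partial_isometry[OF sep e, of ?A ?AB "\<lambda>i. a (snd i)" "\<lambda>n. e (1, n)"])
      show "?A \<subseteq> ?AB" "infinite (?AB - ?A)" using inf_row[of 1] by (auto simp: row_simps)
      show "orthonormal_on ?A (\<lambda>i. a (snd i))" by (auto simp: orthonormal_on_def a_on row_def)
      show "(\<lambda>i. a (snd i)) ` ?A \<subseteq> closed_span (e ` ?AB)"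
        using aA closed_span_subfamily_mono[of ?A ?AB e] by (auto simp: row_simps)
      show "orthonormal_on UNIV (\<lambda>n. e (1, n))" by (rule e_on)
      show "range (\<lambda>n. e (1, n)) \<subseteq> closed_span (e ` ?AB)"
        by (auto intro!: closed_span_member simp: row_def)
      show "e (1, n) \<bullet> a (snd i) = 0" if "i \<in> ?A" for n i
        by (rule closed_span_disjoint_orthogonal[OF e(1) _ _ aA, of "{(1, n)}"])
          (auto intro: closed_span_base simp: row_def)
    qed (auto simp: row_def)
    \<comment> \<open>Only the even-numbered \<open>c\<close> serve as images of C; the odd-numbered
      ones keep the complement infinite-dimensional.\<close>
    obtain k where k: "k \<in> supported_ops e ?BC" "\<And>i. i \<in> ?J \<Longrightarrow> k (e i) = c (2 * prod_encode i)"
    proof (rule supported_op_extending_partial_isometry[OF sep e, of ?J ?BC "\<lambda>i. c (2 * prod_encode i)" "\<lambda>n. c (2 * n + 1)"])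
      show "?J \<subseteq> ?BC" "infinite (?BC - ?J)" using inf_row[of 1] by (auto simp: row_simps)
      show "orthonormal_on ?J (\<lambda>i. c (2 * prod_encode i))"
        by (auto simp: orthonormal_on_def c_on row_def prod_encode_eq)
      show "(\<lambda>i. c (2 * prod_encode i)) ` ?J \<subseteq> closed_span (e ` ?BC)" using cBC by auto
      show "orthonormal_on UNIV (\<lambda>n. c (2 * n + 1))" by (auto simp: orthonormal_on_def c_on)
      show "range (\<lambda>n. c (2 * n + 1)) \<subseteq> closed_span (e ` ?BC)" using cBC by auto
      show "c (2 * n + 1) \<bullet> c (2 * prod_encode i) = 0" for n i
      proof -
        have "2 * n + 1 \<noteq> 2 * prod_encode i" by presburger
        then show ?thesis unfolding c_on by (rule if_not_P)
      qed
    qed (rule that)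
    note ko = supported_opsD(1)[OF k(1)]
    \<comment> \<open>\<open>k\<close> sends the basis vectors of C to certain \<open>c n\<close>,
      to which all \<open>g (a n)\<close> are orthogonal; pulling back by \<open>k\<close> therefore
      puts these vectors into the closed span of rows \<open>0\<close> and \<open>1\<close>.\<close>
    define x where "x n = op_inv k (g (a n))" for n
    have x_on: "x m \<bullet> x n = (if m = n then 1 else 0)" for m n
      by (simp add: x_def orthogonal_opD(3)[OF orthogonal_op_inv[OF ko]] gD(3) a_on)
    have xe: "x n \<bullet> e i = 0" if "i \<in> ?J" for n i
      using orthogonal_opD(3)[OF ko, of "x n" "e i"] gac
      by (simp add: k(2)[OF that] x_def orthogonal_op_inv_cancel[OF ko])
    have xA: "x n \<in> closed_span (e ` row {0, 1})" for n
      by (rule closed_span_subfamilyI[OF e]) (use xe in \<open>auto simp: row_def\<close>)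
    obtain m where m: "m \<in> supported_ops e ?AB" "\<And>n. m (e (0, n)) = x n"
    proof (rule supported_op_extending_partial_isometry[OF sep e, of ?A ?AB "\<lambda>i. x (snd i)" "\<lambda>n. e (2, n)"])
      show "?A \<subseteq> ?AB" "infinite (?AB - ?A)" using inf_row[of 1] by (auto simp: row_simps)
      show "orthonormal_on ?A (\<lambda>i. x (snd i))" by (auto simp: orthonormal_on_def x_on row_def)
      show "(\<lambda>i. x (snd i)) ` ?A \<subseteq> closed_span (e ` ?AB)"
        using xA closed_span_subfamily_mono[of "row {0, 1}" ?AB e] by (auto simp: row_simps)
      show "orthonormal_on UNIV (\<lambda>n. e (2, n))" by (rule e_on)
      show "range (\<lambda>n. e (2, n)) \<subseteq> closed_span (e ` ?AB)"
        by (auto intro!: closed_span_member simp: row_def)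
      show "e (2, n) \<bullet> x (snd i) = 0" for n i
        using xe[of "(2, n)" "snd i"] by (simp add: row_def inner_commute)
    qed (auto simp: row_def)
    note wo = supported_opsD(1)[OF w(1)] and mo = supported_opsD(1)[OF m(1)]
    \<comment> \<open>\<open>w\<close> sends row \<open>0\<close> to the \<open>a n\<close>, then
      \<open>g\<close> and \<open>op_inv k\<close> send these to the \<open>x n\<close>, and
      \<open>op_inv m\<close> brings them back to row \<open>0\<close>. So \<open>h\<close> fixes
      row \<open>0\<close>, and solving for \<open>g\<close> gives the four factors.\<close>
    define h where "h = op_inv m \<circ> (op_inv k \<circ> (g \<circ> w))"
    have ho: "orthogonal_op h"
      unfolding h_def by (intro orthogonal_op_comp orthogonal_op_inv wo mo ko g)
    have "h (e i) = e i" if "i \<notin> ?BC" for i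
    proof -
      have i0: "fst i = 0" using that by (simp add: row_def)
      define n where "n = snd i"
      have i: "i = (0, n)" using i0 by (simp add: n_def prod_eq_iff)
      show ?thesis
        using m(2)[of n] orthogonal_op_inv_cancel(1)[OF mo, of "e i"]
        by (simp add: i h_def w(2) x_def)
    qed
    then have h: "h \<in> supported_ops e ?BC" using ho by (simp add: supported_ops_def)
    have geq: "g = k \<circ> (m \<circ> (h \<circ> op_inv w))"
      by (auto simp: fun_eq_iff h_def orthogonal_op_inv_cancel[OF mo] orthogonal_op_inv_cancel[OF ko]
          orthogonal_op_inv_cancel[OF wo])
    have "L (k \<circ> (m \<circ> (h \<circ> op_inv w))) \<le> L k + L (m \<circ> (h \<circ> op_inv w))"
      "L (m \<circ> (h \<circ> op_inv w)) \<le> L m + L (h \<circ> op_inv w)" "L (h \<circ> op_inv w) \<le> L h + L (op_inv w)"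
      by (intro Lcomp orthogonal_op_comp orthogonal_op_inv wo mo ko ho)+
    moreover have "L (op_inv w) \<le> C1" "L m \<le> C1" "L h \<le> C2" "L k \<le> C2"
      using C1 C2 supported_ops_inv w(1) m(1) h k(1) by blast+
    ultimately show ?thesis unfolding geq by linarith
  qed
  then show ?thesis by blast
qed

section \<open>Isometries of the hyperbolic space\<close>

lemma hyp_form_inner: "hyp_form x y = x \<bullet> (fst y, - snd y)"
  by (simp add: hyp_form_def inner_prod_def)

lemma hyp_form_bound: "\<bar>hyp_form x y\<bar> \<le> norm x * norm y"
proof -
  have "norm (fst y, - snd y) = norm y" by (simp add: norm_prod_def)
  then show ?thesis unfolding hyp_form_inner using Cauchy_Schwarz_ineq2 by metis
qed

lemma bounded_bilinear_hyp_form: "bounded_bilinear hyp_form"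
proof
  show "\<exists>K. \<forall>a b. norm (hyp_form a b) \<le> norm a * norm b * K"
    using hyp_form_bound by (intro exI[of _ 1]) auto
qed (simp_all add: hyp_form_simps)

lemmas tendsto_hyp_form = bounded_bilinear.tendsto[OF bounded_bilinear_hyp_form]
lemmas hyp_form_sum_left = bounded_bilinear.sum_left[OF bounded_bilinear_hyp_form]

lemma hyp_form_zero [simp]: "hyp_form 0 x = 0" "hyp_form x 0 = 0"
  by (simp_all add: hyp_form_def)

lemma hyp_form_minus: "hyp_form (- x) y = - hyp_form x y" "hyp_form x (- y) = - hyp_form x y"
  by (simp_all add: hyp_form_def)

definition hyp_base :: "real \<times> 'h::real_inner" where "hyp_base = (1, 0)"

lemma hyp_base_mem [simp]: "hyp_base \<in> hyp_space"
  by (simp add: hyp_base_def hyp_space_def hyp_form_def)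

lemma hyp_form_base: "hyp_form x hyp_base = fst x"
  by (simp add: hyp_base_def hyp_form_def)

lemma hyp_space_fst_ge_1: "x \<in> hyp_space \<Longrightarrow> fst x \<ge> 1"
  using hyp_form_ge_1[of x hyp_base] by (simp add: hyp_form_base)

lemma hyp_form_self: "x \<in> hyp_space \<Longrightarrow> hyp_form x x = 1"
  by (simp add: hyp_space_def)

lemma norm_eq_hyp_form: "(norm x)\<^sup>2 = 2 * (fst x)\<^sup>2 - hyp_form x x"
  by (simp add: norm_prod_def hyp_form_def power2_norm_eq_inner) (simp add: power2_eq_square)

text \<open>Cauchy-Schwarz makes negative definiteness on the complement of \<open>p\<close>
  quantitative, with a factor that depends only on \<open>fst p\<close>. This is how estimates on
  the indefinite form become norm estimates.\<close>

lemma norm_orthogonal_le: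
  assumes p: "p \<in> hyp_space" and w: "hyp_form w p = 0"
  shows "(norm w)\<^sup>2 \<le> 2 * (fst p)\<^sup>2 * (- hyp_form w w)"
proof -
  define s a b c where "s = fst p" "a = (norm (snd w))\<^sup>2" "b = (norm (snd p))\<^sup>2" "c = (fst w)\<^sup>2"
  note defs = this
  have s: "s\<^sup>2 = 1 + b" "s \<ge> 1" using p hyp_space_fst_ge_1[OF p]
    by (auto simp: defs hyp_space_def hyp_form_def power2_norm_eq_inner power2_eq_square[of "fst p"])
  have "fst w * s = snd w \<bullet> snd p" using w by (simp add: hyp_form_def defs)
  then have "(fst w * s)\<^sup>2 \<le> (norm (snd w) * norm (snd p))\<^sup>2"
    by (metis Cauchy_Schwarz_ineq2 abs_ge_zero power2_abs power_mono)
  then have le: "c * s\<^sup>2 \<le> a * b" by (simp add: defs power_mult_distrib)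
  have nn: "a \<ge> 0" "b \<ge> 0" "c \<ge> 0" by (auto simp: defs)
  have f: "hyp_form w w = c - a" by (simp add: defs hyp_form_def power2_norm_eq_inner power2_eq_square[of "fst w"])
  have n: "(norm w)\<^sup>2 = c + a" by (simp add: defs norm_prod_def)
  have "c + c * b \<le> a * b" using le by (simp add: s(1) algebra_simps)
  moreover have "c * b \<ge> 0" using nn by simp
  moreover have "c \<le> a"
  proof (rule ccontr)
    assume "\<not> c \<le> a"
    then have "a * b \<le> c * b" using nn by (intro mult_right_mono) auto
    then show False using \<open>c + c * b \<le> a * b\<close> \<open>\<not> c \<le> a\<close> nn by linarith
  qed
  ultimately have "c + a \<le> 2 * (1 + b) * (a - c)" using nn by (simp add: algebra_simps)
  then show ?thesis by (simp add: n f s(1)[unfolded defs(1)])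
qed

text \<open>For distances \<open>a\<close> and \<open>b\<close> the bounds are
  \<open>cosh (a + b) \<le> 2 * cosh a * cosh b\<close> and, when \<open>a = b\<close>, the
  double-angle value \<open>2 * (cosh a)\<^sup>2 - 1\<close>.\<close>

lemma hyp_form_triangle:
  assumes "x \<in> hyp_space" "y \<in> hyp_space" "z \<in> hyp_space"
  shows "hyp_form x z \<le> 2 * hyp_form x y * hyp_form y z"
    and "hyp_form x y = hyp_form y z \<Longrightarrow> hyp_form x z \<le> 2 * (hyp_form x y)\<^sup>2 - 1"
proof -
  interpret Metric_space hyp_space "hyp_dist :: real \<times> 'a \<Rightarrow> real \<times> 'a \<Rightarrow> real" by (rule Metric_space_hyp)
  let ?a = "hyp_dist x y" and ?b = "hyp_dist y z"
  have "hyp_form x z = cosh (hyp_dist x z)" using assms by (simp add: cosh_hyp_dist)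
  also have "\<dots> \<le> cosh (?a + ?b)"
    using triangle[OF assms] nonneg by (subst cosh_real_nonneg_le_iff) auto
  finally have le: "hyp_form x z \<le> cosh (?a + ?b)" .
  also have "\<dots> \<le> 2 * (cosh ?a * cosh ?b)"
  proof -
    have "sinh ?a * sinh ?b \<le> cosh ?a * cosh ?b"
      by (intro mult_mono) (auto simp: sinh_le_cosh_real)
    then show ?thesis by (simp add: cosh_add)
  qed
  finally show "hyp_form x z \<le> 2 * hyp_form x y * hyp_form y z" using assms by (simp add: cosh_hyp_dist)
  assume eq: "hyp_form x y = hyp_form y z"
  then have "?a = ?b" using assms by (simp add: hyp_dist_def)
  then have "cosh (?a + ?b) = 2 * (cosh ?a)\<^sup>2 - 1"
    using cosh_double_cosh[of ?b] by simp
  then show "hyp_form x z \<le> 2 * (hyp_form x y)\<^sup>2 - 1"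
    using le assms by (simp add: cosh_hyp_dist)
qed

lemma hyp_space_normalize:
  assumes "hyp_form x x > 0" "fst x > 0"
  shows "(1 / sqrt (hyp_form x x)) *\<^sub>R x \<in> hyp_space"
  using assms by (simp add: hyp_space_def hyp_form_simps power2_eq_square[symmetric])

lemma hyp_midpoint:
  assumes "y \<in> hyp_space" "z \<in> hyp_space"
  shows "(1 / sqrt (2 + 2 * hyp_form y z)) *\<^sub>R (y + z) \<in> hyp_space"
proof -
  have "hyp_form (y + z) (y + z) = 2 + 2 * hyp_form y z"
    using assms by (simp add: hyp_form_simps hyp_form_self hyp_form_commute[of z y])
  moreover have "fst (y + z) > 0" using assms by (simp add: hyp_space_def)
  ultimately show ?thesis
    using hyp_space_normalize[of "y + z"] hyp_form_ge_1[OF assms] by simp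
qed

text \<open>The vector \<open>y - z\<close> is orthogonal to the midpoint of \<open>y\<close> and
  \<open>z\<close>, so \<open>norm_orthogonal_le\<close> applies there. Hence, where the first
  coordinate is bounded, form values close to \<open>1\<close> mean closeness in norm.\<close>

lemma hyp_space_dist_le:
  assumes "y \<in> hyp_space" "z \<in> hyp_space"
  shows "(norm (y - z))\<^sup>2 \<le> (fst y + fst z)\<^sup>2 * (hyp_form y z - 1)"
proof -
  define c where "c = sqrt (2 + 2 * hyp_form y z)"
  define m where "m = (1 / c) *\<^sub>R (y + z)"
  have c: "c\<^sup>2 = 2 + 2 * hyp_form y z" "c \<ge> 2"
    using hyp_form_ge_1[OF assms] by (auto simp: c_def intro!: real_le_rsqrt)
  have m: "m \<in> hyp_space" unfolding m_def c_def by (rule hyp_midpoint[OF assms])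
  have "hyp_form (y - z) m = 0"
    using assms by (simp add: m_def hyp_form_simps hyp_form_self hyp_form_commute[of z y])
  from norm_orthogonal_le[OF m this]
  have "(norm (y - z))\<^sup>2 \<le> 2 * (fst m)\<^sup>2 * (2 * (hyp_form y z - 1))"
    using assms by (simp add: hyp_form_simps hyp_form_self hyp_form_commute[of z y] algebra_simps)
  also have "\<dots> = 4 * (fst m)\<^sup>2 * (hyp_form y z - 1)" by simp
  also have "\<dots> \<le> (fst y + fst z)\<^sup>2 * (hyp_form y z - 1)"
  proof (rule mult_right_mono)
    have "2 * fst m \<le> fst y + fst z"
      using c(2) mult_right_mono[OF c(2), of "fst y + fst z"]
        hyp_space_fst_ge_1[OF assms(1)] hyp_space_fst_ge_1[OF assms(2)]
      by (simp add: m_def field_simps)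
    then have "(2 * fst m)\<^sup>2 \<le> (fst y + fst z)\<^sup>2"
      using hyp_space_fst_ge_1[OF m] by (intro power_mono) auto
    then show "4 * (fst m)\<^sup>2 \<le> (fst y + fst z)\<^sup>2" by (simp add: power_mult_distrib)
  qed (use hyp_form_ge_1[OF assms] in simp)
  finally show ?thesis .
qed

section \<open>The isometry group and linear operators preserving the form\<close>

lemma carrier_Is_hyp: "carrier Is_hyp = hyp_isometries"
  by (simp add: Is_hyp_def)

lemma Is_hyp_mem: "g \<in> carrier Is_hyp \<Longrightarrow> x \<in> hyp_space \<Longrightarrow> g x \<in> hyp_space"
  by (auto simp: carrier_Is_hyp hyp_isometries_def Bij_def bij_betw_def)

lemma Is_hyp_form:
  assumes "g \<in> carrier Is_hyp" "x \<in> hyp_space" "y \<in> hyp_space"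
  shows "hyp_form (g x) (g y) = hyp_form x y"
proof -
  have "hyp_dist (g x) (g y) = hyp_dist x y"
    using assms by (auto simp: carrier_Is_hyp hyp_isometries_def)
  then show ?thesis using assms cosh_hyp_dist Is_hyp_mem by metis
qed

lemma Is_hyp_eqI:
  assumes "g \<in> carrier Is_hyp" "h \<in> carrier Is_hyp" "\<And>x. x \<in> hyp_space \<Longrightarrow> g x = h x"
  shows "g = h"
proof -
  have "g \<in> extensional hyp_space" "h \<in> extensional hyp_space"
    using assms(1,2) by (auto simp: carrier_Is_hyp hyp_isometries_def Bij_def)
  then show ?thesis using assms(3) by (rule extensionalityI)
qed

lemma Is_hyp_mult:
  assumes "g \<in> carrier Is_hyp" "h \<in> carrier Is_hyp" "x \<in> hyp_space"
  shows "(g \<otimes>\<^bsub>Is_hyp\<^esub> h) x = g (h x)"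
  using assms by (simp add: Is_hyp_def hyp_isometries_def BijGroup_def compose_eq)

lemma Is_hyp_one: "x \<in> hyp_space \<Longrightarrow> \<one>\<^bsub>Is_hyp\<^esub> x = x"
  by (simp add: Is_hyp_def BijGroup_def)

lemma Is_hyp_inv:
  assumes g: "g \<in> carrier Is_hyp" and x: "x \<in> hyp_space"
  shows "(inv\<^bsub>Is_hyp\<^esub> g) (g x) = x" "g ((inv\<^bsub>Is_hyp\<^esub> g) x) = x"
proof -
  interpret group "Is_hyp :: (real \<times> 'a \<Rightarrow> real \<times> 'a) monoid" by (rule group_Is_hyp)
  show "(inv\<^bsub>Is_hyp\<^esub> g) (g x) = x" "g ((inv\<^bsub>Is_hyp\<^esub> g) x) = x"
    using Is_hyp_mult[OF inv_closed[OF g] g x] Is_hyp_mult[OF g inv_closed[OF g] x]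
    by (simp_all add: g x Is_hyp_one)
qed

lemma is_lin_ext_lin_ext: "g \<in> carrier Is_hyp \<Longrightarrow> is_lin_ext g (lin_ext g)"
  unfolding lin_ext_def by (rule theI'[OF ex1_lin_ext])

lemma lin_ext_unique: "g \<in> carrier Is_hyp \<Longrightarrow> is_lin_ext g T \<Longrightarrow> lin_ext g = T"
  using ex1_lin_ext is_lin_ext_lin_ext by blast

lemma lin_extD:
  assumes "g \<in> carrier Is_hyp"
  shows "linear (lin_ext g)" "bij (lin_ext g)" "hyp_form (lin_ext g x) (lin_ext g y) = hyp_form x y"
    "x \<in> hyp_space \<Longrightarrow> lin_ext g x = g x"
  using is_lin_ext_lin_ext[OF assms] unfolding is_lin_ext_def by blast+

text \<open>By \<open>norm_eq_hyp_form\<close> the norm is determined by the form and the pairing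
  with the base point; a preimage \<open>q\<close> of the base point transfers that pairing to the
  source.\<close>

lemma form_preserving_bounded_linear:
  assumes l: "linear T" and f: "\<And>x y. hyp_form (T x) (T y) = hyp_form x y" and s: "surj T"
  shows "bounded_linear T"
proof -
  obtain q where q: "T q = hyp_base" using s by (metis surjD)
  have "norm (T x) \<le> norm x * sqrt (2 * (norm q)\<^sup>2 + 1)" for x
  proof (rule power2_le_imp_le)
    have "(norm (T x))\<^sup>2 = 2 * (hyp_form (T x) (T q))\<^sup>2 - hyp_form (T x) (T x)"
      by (simp add: norm_eq_hyp_form q hyp_form_base)
    also have "\<dots> = 2 * (hyp_form x q)\<^sup>2 - hyp_form x x" by (simp add: f)
    also have "\<dots> \<le> 2 * (norm x * norm q)\<^sup>2 + norm x * norm x"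
    proof -
      have "(hyp_form x q)\<^sup>2 \<le> (norm x * norm q)\<^sup>2"
        using hyp_form_bound[of x q] by (metis abs_ge_zero power2_abs power_mono)
      then show ?thesis using hyp_form_bound[of x x] by linarith
    qed
    also have "\<dots> = (norm x * sqrt (2 * (norm q)\<^sup>2 + 1))\<^sup>2"
      by (simp add: power_mult_distrib algebra_simps power2_eq_square)
    finally show "(norm (T x))\<^sup>2 \<le> (norm x * sqrt (2 * (norm q)\<^sup>2 + 1))\<^sup>2" .
  qed simp
  then show ?thesis
    using l by (intro bounded_linear_intro) (auto simp: linear_add linear_scale)
qed

lemma bounded_linear_lin_ext: "g \<in> carrier Is_hyp \<Longrightarrow> bounded_linear (lin_ext g)"
  by (rule form_preserving_bounded_linear) (auto simp: lin_extD bij_is_surj)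

text \<open>Vectors with form value \<open>1\<close> make up two opposite sheets; the form is at
  least \<open>1\<close> within a sheet and at most \<open>-1\<close> across. One point
  \<open>z\<close> with image in \<open>hyp_space\<close> thus shows that \<open>T\<close> does not
  exchange the sheets.\<close>

lemma Is_hyp_of_linear:
  fixes T :: "real \<times> 'h::real_inner \<Rightarrow> real \<times> 'h"
  assumes l: "linear T" and f: "\<And>x y. hyp_form (T x) (T y) = hyp_form x y" and s: "surj T"
    and z: "z \<in> hyp_space" "T z \<in> hyp_space"
  shows "restrict T hyp_space \<in> carrier Is_hyp" "lin_ext (restrict T hyp_space) = T"
proof -
  have inj: "inj T"
  proof (subst linear_injective_0[OF l], intro allI impI)
    fix x assume "T x = 0"
    then have "hyp_form x w = 0" for w using f[of x w] by simp
    then show "x = 0" by (rule hyp_form_nondegenerate)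
  qed
  have sgn: "x \<in> hyp_space \<or> - x \<in> hyp_space" if "hyp_form x x = 1" for x
  proof -
    have "fst x \<noteq> 0"
    proof
      assume "fst x = 0"
      then have "hyp_form x x \<le> 0" by (simp add: hyp_form_def)
      then show False using that by simp
    qed
    then show ?thesis using that by (auto simp: hyp_space_def hyp_form_minus)
  qed
  have iff: "T x \<in> hyp_space \<longleftrightarrow> x \<in> hyp_space" for x
  proof
    assume x: "x \<in> hyp_space"
    show "T x \<in> hyp_space"
    proof (rule ccontr)
      assume "T x \<notin> hyp_space"
      then have "- T x \<in> hyp_space" using sgn[of "T x"] x by (simp add: f hyp_form_self)
      then have "hyp_form (- T x) (T z) \<ge> 1" using z(2) by (rule hyp_form_ge_1)
      moreover have "hyp_form x z \<ge> 1" using x z(1) by (rule hyp_form_ge_1)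
      ultimately show False by (simp add: f hyp_form_minus)
    qed
  next
    assume x: "T x \<in> hyp_space"
    show "x \<in> hyp_space"
    proof (rule ccontr)
      assume "x \<notin> hyp_space"
      moreover have "hyp_form x x = 1" using hyp_form_self[OF x] by (simp add: f)
      ultimately have "- x \<in> hyp_space" using sgn[of "x"] by blast
      then have "hyp_form (- x) z \<ge> 1" using z(1) by (rule hyp_form_ge_1)
      moreover have "hyp_form (T x) (T z) \<ge> 1" using x z(2) by (rule hyp_form_ge_1)
      ultimately show False by (simp add: f hyp_form_minus)
    qed
  qed
  have im: "T ` hyp_space = hyp_space"
  proof
    show "hyp_space \<subseteq> T ` hyp_space"
    proof
      fix y :: "real \<times> 'h" assume y: "y \<in> hyp_space"
      obtain x where "y = T x" using s by (metis surjD)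
      then show "y \<in> T ` hyp_space" using iff y by blast
    qed
  qed (use iff in blast)
  have "bij_betw T hyp_space hyp_space"
    using inj im by (metis bij_betw_def inj_on_subset subset_UNIV)
  then have "bij_betw (restrict T hyp_space) hyp_space hyp_space"
    by (subst bij_betw_cong[of _ _ T]) auto
  then show g: "restrict T hyp_space \<in> carrier Is_hyp"
    using iff by (simp add: carrier_Is_hyp hyp_isometries_def Bij_def hyp_dist_def f)
  have "is_lin_ext (restrict T hyp_space) T"
    using l f inj s im by (simp add: is_lin_ext_def bij_def)
  then show "lin_ext (restrict T hyp_space) = T" by (rule lin_ext_unique[OF g])
qed

text \<open>The reflection in \<open>x - y\<close> swaps \<open>x\<close> and \<open>y\<close>.\<close>

lemma Is_hyp_reflection:
  fixes x y :: "real \<times> 'h::real_inner"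
  assumes x: "x \<in> hyp_space" and y: "y \<in> hyp_space"
  obtains g where "g \<in> carrier Is_hyp" "g x = y"
    "\<And>z. z \<in> hyp_space \<Longrightarrow> hyp_form z x = hyp_form z y \<Longrightarrow> g z = z"
proof (cases "x = y")
  case True
  interpret group "Is_hyp :: (real \<times> 'h \<Rightarrow> real \<times> 'h) monoid" by (rule group_Is_hyp)
  show ?thesis by (rule that[OF one_closed]) (use True x in \<open>simp_all add: Is_hyp_one\<close>)
next
  case False
  define w where "w = x - y"
  define c where "c = hyp_form w w"
  have c: "c = 2 * (1 - hyp_form x y)"
    using x y by (simp add: c_def w_def hyp_form_simps hyp_form_self hyp_form_commute[of y x])
  have "c \<noteq> 0"
  proof
    assume "c = 0"
    then have "(norm (x - y))\<^sup>2 \<le> 0" using hyp_space_dist_le[OF x y] c by simp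
    then show False using False by simp
  qed
  define R where "R v = v - (2 * hyp_form v w / c) *\<^sub>R w" for v
  have lin: "linear R"
    by (rule linearI) (simp_all add: R_def hyp_form_simps algebra_simps add_divide_distrib)
  have form: "hyp_form (R u) (R v) = hyp_form u v" for u v
    unfolding R_def hyp_form_simps hyp_form_commute[of w v] c_def[symmetric]
    using \<open>c \<noteq> 0\<close> by (simp add: field_simps)
  have Rw: "hyp_form (R v) w = - hyp_form v w" for v
    unfolding R_def hyp_form_simps c_def[symmetric] using \<open>c \<noteq> 0\<close> by simp
  have "R (R v) = v" for v
    unfolding R_def[of "R v"] Rw by (simp add: R_def)
  then have "surj R" by (metis surjI)
  have "2 * hyp_form x w / c = 1"
    using x \<open>c \<noteq> 0\<close> c by (simp add: w_def hyp_form_simps hyp_form_self)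
  then have Rx: "R x = y" by (simp add: R_def w_def)
  show ?thesis
  proof (rule that)
    show "restrict R hyp_space \<in> carrier Is_hyp"
      by (rule Is_hyp_of_linear[OF lin form \<open>surj R\<close> x]) (simp add: Rx y)
    show "restrict R hyp_space x = y" using x Rx by simp
    show "restrict R hyp_space z = z" if "z \<in> hyp_space" "hyp_form z x = hyp_form z y" for z
      using that by (simp add: R_def w_def hyp_form_simps)
  qed
qed

text \<open>After moving \<open>x\<close> to \<open>x'\<close>, the image of \<open>y\<close> is
  reflected to \<open>y'\<close>: the point \<open>x'\<close> has the same form value with both, so
  the reflection fixes it.\<close>

lemma Is_hyp_two_point_homogeneous:
  fixes x y x' y' :: "real \<times> 'h::real_inner"
  assumes "x \<in> hyp_space" "y \<in> hyp_space" "x' \<in> hyp_space" "y' \<in> hyp_space"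
    and eq: "hyp_form x y = hyp_form x' y'"
  obtains g where "g \<in> carrier Is_hyp" "g x = x'" "g y = y'"
proof -
  interpret group "Is_hyp :: (real \<times> 'h \<Rightarrow> real \<times> 'h) monoid" by (rule group_Is_hyp)
  obtain g where g: "g \<in> carrier Is_hyp" "g x = x'" using Is_hyp_reflection assms(1,3) by metis
  have gy: "g y \<in> hyp_space" using g(1) assms(2) by (rule Is_hyp_mem)
  obtain h where h: "h \<in> carrier Is_hyp" "h (g y) = y'"
    "\<And>z. z \<in> hyp_space \<Longrightarrow> hyp_form z (g y) = hyp_form z y' \<Longrightarrow> h z = z"
    using Is_hyp_reflection[OF gy assms(4)] by metis
  have "h x' = x'"
    using Is_hyp_form[OF g(1) assms(1,2)] eq by (intro h(3) assms) (simp add: g(2))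
  then show ?thesis
    using g h assms by (intro that[of "h \<otimes>\<^bsub>Is_hyp\<^esub> g"]) (simp_all add: Is_hyp_mult)
qed

section \<open>The stabilizer of the base point as an orthogonal group\<close>

definition orthogonal_lift :: "('h::real_inner \<Rightarrow> 'h) \<Rightarrow> real \<times> 'h \<Rightarrow> real \<times> 'h"
  where "orthogonal_lift U = restrict (\<lambda>v. (fst v, U (snd v))) hyp_space"

lemma orthogonal_lift:
  assumes "orthogonal_op U"
  shows "orthogonal_lift U \<in> carrier Is_hyp" "lin_ext (orthogonal_lift U) = (\<lambda>v. (fst v, U (snd v)))"
    "orthogonal_lift U hyp_base = hyp_base"
proof -
  note U = orthogonal_opD[OF assms]
  let ?T = "\<lambda>v. (fst v, U (snd v))"
  have "linear ?T" by (rule linearI) (simp_all add: linear_add[OF U(1)] linear_scale[OF U(1)])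
  moreover have "hyp_form (?T x) (?T y) = hyp_form x y" for x y by (simp add: hyp_form_def U(3))
  moreover have "surj ?T"
  proof (rule surjI)
    show "?T (fst v, op_inv U (snd v)) = v" for v by (simp add: orthogonal_op_inv_cancel(2)[OF assms])
  qed
  moreover have b: "?T hyp_base = hyp_base" by (simp add: hyp_base_def linear_0[OF U(1)])
  ultimately show "orthogonal_lift U \<in> carrier Is_hyp" "lin_ext (orthogonal_lift U) = ?T"
    using Is_hyp_of_linear[of ?T hyp_base] unfolding orthogonal_lift_def by auto
  show "orthogonal_lift U hyp_base = hyp_base" using b by (simp add: orthogonal_lift_def)
qed

lemma orthogonal_lift_comp:
  assumes "orthogonal_op U" "orthogonal_op V"
  shows "orthogonal_lift (U \<circ> V) = orthogonal_lift U \<otimes>\<^bsub>Is_hyp\<^esub> orthogonal_lift V"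
proof (rule Is_hyp_eqI)
  interpret group "Is_hyp :: (real \<times> 'a \<Rightarrow> real \<times> 'a) monoid" by (rule group_Is_hyp)
  note c = orthogonal_lift(1)[OF assms(1)] orthogonal_lift(1)[OF assms(2)]
  show "orthogonal_lift (U \<circ> V) \<in> carrier Is_hyp"
    by (intro orthogonal_lift orthogonal_op_comp assms)
  show "orthogonal_lift U \<otimes>\<^bsub>Is_hyp\<^esub> orthogonal_lift V \<in> carrier Is_hyp" using c by simp
  show "orthogonal_lift (U \<circ> V) x = (orthogonal_lift U \<otimes>\<^bsub>Is_hyp\<^esub> orthogonal_lift V) x"
    if "x \<in> hyp_space" for x
    using that Is_hyp_mem[OF c(2) that] by (simp add: Is_hyp_mult c) (simp add: orthogonal_lift_def)
qed

text \<open>Pairing with \<open>hyp_base\<close> is the first coordinate. The linear extension of an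
  isometry fixing \<open>hyp_base\<close> preserves this coordinate, hence also the vectors
  \<open>(0, h)\<close>, on which the form is minus the inner product.\<close>

lemma base_stabilizer_eq_orthogonal_lift:
  assumes k: "k \<in> carrier Is_hyp" "k hyp_base = hyp_base"
  obtains U where "orthogonal_op U" "k = orthogonal_lift U"
proof -
  note T = lin_extD[OF k(1)]
  let ?T = "lin_ext k"
  have Tb: "?T hyp_base = hyp_base" using T(4) k(2) by simp
  have fst: "fst (?T v) = fst v" for v
    using T(3)[of v hyp_base] by (simp add: Tb hyp_form_base)
  define U where "U h = snd (?T (0, h))" for h
  have T0: "?T (0, h) = (0, U h)" for h using fst[of "(0, h)"] by (simp add: U_def prod_eq_iff)
  have Tv: "?T v = (fst v, U (snd v))" for v
  proof -
    have "v = fst v *\<^sub>R hyp_base + (0, snd v)" by (simp add: hyp_base_def prod_eq_iff)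
    then have "?T v = fst v *\<^sub>R ?T hyp_base + ?T (0, snd v)"
      by (metis linear_add[OF T(1)] linear_scale[OF T(1)])
    then show ?thesis by (simp add: Tb T0) (simp add: hyp_base_def)
  qed
  have "orthogonal_op U"
  proof (rule orthogonal_opI)
    show "linear U"
    proof (rule linearI)
      show "U (x + y) = U x + U y" for x y
        using linear_add[OF T(1), of "(0, x)" "(0, y)"] by (simp add: Tv)
      show "U (c *\<^sub>R x) = c *\<^sub>R U x" for c x
        using linear_scale[OF T(1), of c "(0, x)"] by (simp add: Tv)
    qed
    show "U x \<bullet> U y = x \<bullet> y" for x y
      using T(3)[of "(0, x)" "(0, y)"] by (simp add: Tv hyp_form_def)
    show "surj U"
    proof -
      have "\<exists>x. y = U x" for y
      proof -
        obtain v where "?T v = (0, y)" using bij_is_surj[OF T(2)] by (metis surjD)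
        then show ?thesis by (auto simp: Tv)
      qed
      then show ?thesis by (auto simp: surj_def)
    qed
  qed
  moreover have "k = orthogonal_lift U"
  proof (rule Is_hyp_eqI[OF k(1) orthogonal_lift(1)[OF calculation]])
    show "k x = orthogonal_lift U x" if "x \<in> hyp_space" for x
      using T(4)[OF that] that by (simp add: Tv orthogonal_lift_def)
  qed
  ultimately show ?thesis using that by blast
qed


section \<open>Completeness, circumcenters and the fixed point\<close>

lemma hyp_space_complete:
  fixes X :: "nat \<Rightarrow> real \<times> 'h::{real_inner, complete_space}"
  assumes X: "\<And>n. X n \<in> hyp_space" and b: "\<And>n. fst (X n) \<le> M"
    and C: "\<And>\<epsilon>. \<epsilon> > 0 \<Longrightarrow> \<exists>N. \<forall>m\<ge>N. \<forall>n\<ge>N. hyp_form (X m) (X n) \<le> 1 + \<epsilon>"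
  obtains x where "x \<in> hyp_space" "X \<longlonglongrightarrow> x"
proof -
  have M: "M \<ge> 1" using b[of 0] hyp_space_fst_ge_1[OF X[of 0]] by linarith
  have "Cauchy X"
  proof (rule metric_CauchyI)
    fix e :: real assume e: "e > 0"
    define \<epsilon> where "\<epsilon> = e\<^sup>2 / (2 * (2 * M)\<^sup>2)"
    have "\<epsilon> > 0" using e M by (simp add: \<epsilon>_def)
    then obtain N where N: "\<And>m n. m \<ge> N \<Longrightarrow> n \<ge> N \<Longrightarrow> hyp_form (X m) (X n) \<le> 1 + \<epsilon>" using C by meson
    have "dist (X m) (X n) < e" if "m \<ge> N" "n \<ge> N" for m n
    proof -
      have "(norm (X m - X n))\<^sup>2 \<le> (fst (X m) + fst (X n))\<^sup>2 * (hyp_form (X m) (X n) - 1)"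
        by (rule hyp_space_dist_le[OF X X])
      also have "\<dots> \<le> (2 * M)\<^sup>2 * \<epsilon>"
      proof (rule mult_mono)
        show "(fst (X m) + fst (X n))\<^sup>2 \<le> (2 * M)\<^sup>2"
          using b[of m] b[of n] hyp_space_fst_ge_1[OF X[of m]] hyp_space_fst_ge_1[OF X[of n]]
          by (intro power_mono) auto
      qed (use N[OF that] hyp_form_ge_1[OF X X] in auto)
      also have "\<dots> < e\<^sup>2" using e M by (simp add: \<epsilon>_def)
      finally show ?thesis using e by (simp add: dist_norm power2_less_imp_less)
    qed
    then show "\<exists>N. \<forall>m\<ge>N. \<forall>n\<ge>N. dist (X m) (X n) < e" by blast
  qed
  then obtain x where x: "X \<longlonglongrightarrow> x" using Cauchy_convergent convergent_def by blast
  have "(\<lambda>n. hyp_form (X n) (X n)) \<longlonglongrightarrow> hyp_form x x" by (intro tendsto_hyp_form x)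
  then have 1: "hyp_form x x = 1" using X by (simp add: hyp_form_self LIMSEQ_const_iff)
  have "(\<lambda>n. fst (X n)) \<longlonglongrightarrow> fst x" by (intro tendsto_intros x)
  then have "fst x \<ge> 1" by (rule LIMSEQ_le_const) (use hyp_space_fst_ge_1[OF X] in auto)
  with 1 have "x \<in> hyp_space" by (simp add: hyp_space_def)
  then show ?thesis using x that by blast
qed

text \<open>The fixed point is the circumcenter: if \<open>r\<close> is the infimum of the radii of balls containing \<open>S\<close>,
  midpoints show that the centers of almost optimal balls are close to each other.\<close>

lemma hyp_bounded_set_circumcenter:
  fixes S :: "(real \<times> 'h::{real_inner, complete_space}) set"
  assumes S: "S \<subseteq> hyp_space" "S \<noteq> {}" and bdd: "\<And>x. x \<in> S \<Longrightarrow> fst x \<le> M"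
  obtains p where "p \<in> hyp_space" "\<And>g. g \<in> carrier Is_hyp \<Longrightarrow> S \<subseteq> g ` S \<Longrightarrow> g p = p"
proof -
  define A where "A = {R. \<exists>y\<in>hyp_space. \<forall>x\<in>S. hyp_form x y \<le> R}"
  define r where "r = Inf A"
  obtain x0 where x0: "x0 \<in> S" using S(2) by blast
  then have x0h: "x0 \<in> hyp_space" using S(1) by blast
  have ge1: "R \<ge> 1" if "R \<in> A" for R
  proof -
    obtain y where "y \<in> hyp_space" "hyp_form x0 y \<le> R" using \<open>R \<in> A\<close> x0 unfolding A_def by blast
    then show ?thesis using hyp_form_ge_1[OF x0h] by fastforce
  qed
  then have bb: "bdd_below A" by (rule bdd_belowI)
  have "M \<in> A" unfolding A_def using bdd by (auto intro!: bexI[of _ hyp_base] simp: hyp_form_base)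
  then have ne: "A \<noteq> {}" by blast
  have r1: "r \<ge> 1" unfolding r_def by (rule cInf_greatest[OF ne ge1])
  have close: "hyp_form y z \<le> 2 * (1 + \<epsilon>)\<^sup>2 - 1"
    if y: "y \<in> hyp_space" "\<And>x. x \<in> S \<Longrightarrow> hyp_form x y \<le> r + \<epsilon>"
      and z: "z \<in> hyp_space" "\<And>x. x \<in> S \<Longrightarrow> hyp_form x z \<le> r + \<epsilon>" and e: "\<epsilon> \<ge> 0" for y z \<epsilon>
  proof -
    define c where "c = sqrt (2 + 2 * hyp_form y z)"
    have c: "c\<^sup>2 = 2 + 2 * hyp_form y z" "c > 0"
      using hyp_form_ge_1[OF y(1) z(1)] by (auto simp: c_def)
    \<comment> \<open>The normalized midpoint is the center of a ball with this form radius;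
      minimality of \<open>r\<close> then bounds \<open>c\<close>, hence
      \<open>hyp_form y z\<close>. The bound \<open>r \<ge> 1\<close> turns the additive error
      \<open>\<epsilon>\<close> into a multiplicative one.\<close>
    have "2 * (r + \<epsilon>) / c \<in> A"
      unfolding A_def
    proof (intro CollectI bexI ballI)
      show "(1 / c) *\<^sub>R (y + z) \<in> hyp_space" unfolding c_def by (rule hyp_midpoint[OF y(1) z(1)])
      show "hyp_form x ((1 / c) *\<^sub>R (y + z)) \<le> 2 * (r + \<epsilon>) / c" if "x \<in> S" for x
      proof -
        have "hyp_form x y + hyp_form x z \<le> 2 * (r + \<epsilon>)" using add_mono[OF y(2)[OF that] z(2)[OF that]] by simp
        then have "(hyp_form x y + hyp_form x z) / c \<le> 2 * (r + \<epsilon>) / c" using c(2) by (intro divide_right_mono) auto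
        then show ?thesis by (simp add: hyp_form_simps)
      qed
    qed
    then have "r \<le> 2 * (r + \<epsilon>) / c" unfolding r_def[symmetric] by (simp add: r_def cInf_lower bb)
    then have "c * r \<le> 2 * (r + \<epsilon>)" using c(2) by (simp add: field_simps)
    also have "\<dots> \<le> 2 * (1 + \<epsilon>) * r" using r1 e mult_left_mono[of 1 r \<epsilon>] by (simp add: algebra_simps)
    finally have "c \<le> 2 * (1 + \<epsilon>)" using r1 by simp
    then have "c\<^sup>2 \<le> (2 * (1 + \<epsilon>))\<^sup>2" using c(2) by (intro power_mono) auto
    then have "2 + 2 * hyp_form y z \<le> 4 * (1 + \<epsilon>)\<^sup>2" unfolding c(1) power_mult_distrib by simp
    then show ?thesis by linarith
  qed
  have "\<exists>y\<in>hyp_space. \<forall>x\<in>S. hyp_form x y \<le> r + 1 / Suc n" for n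
  proof -
    obtain R where "R \<in> A" "R < r + 1 / Suc n"
      using cInf_lessD[OF ne, of "r + 1 / Suc n"] by (auto simp: r_def)
    then obtain y where "y \<in> hyp_space" "\<And>x. x \<in> S \<Longrightarrow> hyp_form x y \<le> R" unfolding A_def by blast
    moreover have "hyp_form x y \<le> r + 1 / Suc n" if "x \<in> S" for x
      using calculation(2)[OF that] \<open>R < r + 1 / Suc n\<close> by simp
    ultimately show ?thesis by blast
  qed
  then obtain Y where Y: "\<And>n. Y n \<in> hyp_space" "\<And>n x. x \<in> S \<Longrightarrow> hyp_form x (Y n) \<le> r + 1 / Suc n"
    by metis
  obtain p where p: "p \<in> hyp_space" "Y \<longlonglongrightarrow> p"
  proof (rule hyp_space_complete[OF Y(1)])
    show "fst (Y n) \<le> 2 * (r + 1) * fst x0" for n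
    proof -
      have "fst (Y n) \<le> 2 * hyp_form (Y n) x0 * hyp_form x0 hyp_base"
        using hyp_form_triangle(1)[OF Y(1)[of n] x0h hyp_base_mem] by (simp add: hyp_form_base)
      also have "\<dots> \<le> 2 * (r + 1) * fst x0"
      proof -
        have "hyp_form x0 (Y n) \<le> r + 1 / Suc n" by (rule Y(2)[OF x0])
        also have "\<dots> \<le> r + 1" by simp
        finally show ?thesis using hyp_space_fst_ge_1[OF x0h]
          by (simp add: hyp_form_base hyp_form_commute[of x0])
      qed
      finally show ?thesis .
    qed
    fix \<epsilon> :: real assume e: "\<epsilon> > 0"
    have "(\<lambda>n. 2 * (1 + 1 / real (Suc n))\<^sup>2 - 1) \<longlonglongrightarrow> 2 * (1 + 0)\<^sup>2 - 1"
      by (intro tendsto_intros LIMSEQ_Suc[OF lim_1_over_n])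
    then have "eventually (\<lambda>n. 2 * (1 + 1 / real (Suc n))\<^sup>2 - 1 < 1 + \<epsilon>) sequentially"
      by (rule order_tendstoD) (use e in simp)
    then obtain N where N: "2 * (1 + 1 / real (Suc N))\<^sup>2 - 1 < 1 + \<epsilon>"
      by (auto simp: eventually_sequentially)
    have near: "hyp_form x (Y m) \<le> r + 1 / real (Suc N)" if "x \<in> S" "m \<ge> N" for x m
      using Y(2)[OF that(1), of m] that(2) frac_le[of 1 1 "real (Suc N)" "real (Suc m)"] by simp
    have "hyp_form (Y m) (Y n) \<le> 1 + \<epsilon>" if "m \<ge> N" "n \<ge> N" for m n
      using close[OF Y(1) near[OF _ that(1)] Y(1) near[OF _ that(2)]] N by fastforce
    then show "\<exists>N. \<forall>m\<ge>N. \<forall>n\<ge>N. hyp_form (Y m) (Y n) \<le> 1 + \<epsilon>" by blast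
  qed (rule that)
  have pr: "hyp_form x p \<le> r" if "x \<in> S" for x
  proof (rule LIMSEQ_le)
    show "(\<lambda>n. hyp_form x (Y n)) \<longlonglongrightarrow> hyp_form x p" by (intro tendsto_hyp_form tendsto_const p)
    have "(\<lambda>n. r + 1 / real (Suc n)) \<longlonglongrightarrow> r + 0" by (intro tendsto_intros LIMSEQ_Suc[OF lim_1_over_n])
    then show "(\<lambda>n. r + 1 / real (Suc n)) \<longlonglongrightarrow> r" by simp
  qed (use Y(2)[OF that] in blast)
  \<comment> \<open>\<open>g p\<close> is the center of another ball of the same minimal radius, so
    \<open>close\<close> with \<open>\<epsilon> = 0\<close> forces it to coincide with
    \<open>p\<close>.\<close>
  have "g p = p" if g: "g \<in> carrier Is_hyp" "S \<subseteq> g ` S" for g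
  proof -
    have gp: "g p \<in> hyp_space" by (rule Is_hyp_mem[OF g(1) p(1)])
    have "hyp_form x (g p) \<le> r" if "x \<in> S" for x
    proof -
      have "x \<in> g ` S" using g(2) that by (rule subsetD)
      then obtain x' where x': "x' \<in> S" "x = g x'" by (rule imageE)
      then have "hyp_form x (g p) = hyp_form x' p" using Is_hyp_form[OF g(1) _ p(1)] S(1) by blast
      then show ?thesis using pr[OF x'(1)] by simp
    qed
    then have "hyp_form (g p) p \<le> 1" using close[OF gp _ p(1), of 0] pr by simp
    then have "(fst (g p) + fst p)\<^sup>2 * (hyp_form (g p) p - 1) \<le> 0"
      by (simp add: mult_nonneg_nonpos)
    then have "(norm (g p - p))\<^sup>2 \<le> 0" using hyp_space_dist_le[OF gp p(1)] by linarith
    then show ?thesis by simp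
  qed
  then show ?thesis using p(1) that by blast
qed

lemma base_stabilizer_has_fixed_point:
  fixes \<rho> :: "(real \<times> 'h \<Rightarrow> real \<times> 'h::{real_inner, complete_space}) \<Rightarrow> real \<times> 'k \<Rightarrow> real \<times> 'k::{real_inner, complete_space}"
  assumes sep: "separable_space (euclidean :: 'h topology)"
    and inf: "infinite_dim (UNIV :: 'h set)" and \<rho>: "\<rho> \<in> hom Is_hyp Is_hyp"
  obtains p where "p \<in> hyp_space" "\<And>k. k \<in> carrier Is_hyp \<Longrightarrow> k hyp_base = hyp_base \<Longrightarrow> \<rho> k p = p"
proof -
  interpret M: Metric_space hyp_space "hyp_dist :: real \<times> 'k \<Rightarrow> real \<times> 'k \<Rightarrow> real" by (rule Metric_space_hyp)
  define \<phi> where "\<phi> U = \<rho> (orthogonal_lift U)" for U :: "'h \<Rightarrow> 'h"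
  have \<phi>c: "\<phi> U \<in> carrier Is_hyp" if "orthogonal_op U" for U
    unfolding \<phi>_def using \<rho> orthogonal_lift(1)[OF that] by (auto simp: hom_def)
  have \<phi>m: "\<phi> (U \<circ> V) x = \<phi> U (\<phi> V x)" if "orthogonal_op U" "orthogonal_op V" "x \<in> hyp_space" for U V x
  proof -
    have "\<phi> (U \<circ> V) = \<phi> U \<otimes>\<^bsub>Is_hyp\<^esub> \<phi> V"
      unfolding \<phi>_def orthogonal_lift_comp[OF that(1,2)]
      by (rule hom_mult[OF \<rho>]) (simp_all add: orthogonal_lift that)
    then show ?thesis using Is_hyp_mult \<phi>c that by metis
  qed
  have dist: "hyp_dist (\<phi> U x) (\<phi> U y) = hyp_dist x y"
    if "orthogonal_op U" "x \<in> hyp_space" "y \<in> hyp_space" for U x y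
    using \<phi>c[OF that(1)] that(2,3) by (auto simp: carrier_Is_hyp hyp_isometries_def)
  have oid: "orthogonal_op (id :: 'h \<Rightarrow> 'h)"
    by (rule orthogonal_opI) (auto simp: linear_id)
  \<comment> \<open>The image of the identity is idempotent, and an idempotent isometry is the
    identity.\<close>
  have \<phi>id: "\<phi> id x = x" if x: "x \<in> hyp_space" for x
  proof -
    have xm: "\<phi> id x \<in> hyp_space" using \<phi>c[OF oid] x by (rule Is_hyp_mem)
    have "\<phi> id (\<phi> id x) = \<phi> id x" using \<phi>m[OF oid oid x] by simp
    then have "hyp_dist (\<phi> id x) x = 0" using dist[OF oid xm x] xm by simp
    then show ?thesis using xm x by simp
  qed
  let ?o = "hyp_base :: real \<times> 'k"
  \<comment> \<open>The displacement of a point is a length function, by the triangle inequality;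
    its boundedness is boundedness of the orbit \<open>S\<close>.\<close>
  define L where "L U = hyp_dist (\<phi> U ?o) ?o" for U
  have mem: "\<phi> U ?o \<in> hyp_space" if "orthogonal_op U" for U using \<phi>c[OF that] by (simp add: Is_hyp_mem)
  have "\<exists>C. \<forall>U. orthogonal_op U \<longrightarrow> L U \<le> C"
  proof (rule orthogonal_group_length_bounded[OF sep inf])
    show "L (U \<circ> V) \<le> L U + L V" if "orthogonal_op U" "orthogonal_op V" for U V
      using M.triangle[OF mem[OF orthogonal_op_comp[OF that]] mem[OF that(1)] hyp_base_mem]
        dist[OF that(1) mem[OF that(2)] hyp_base_mem]
      by (simp add: L_def \<phi>m that)
    show "L (op_inv U) \<le> L U" if U: "orthogonal_op U" for U
    proof -
      have "\<phi> U (\<phi> (op_inv U) ?o) = ?o"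
        using \<phi>m[OF U orthogonal_op_inv[OF U], of ?o]
        by (simp add: orthogonal_op_inv_cancel(3)[OF U] \<phi>id)
      then show ?thesis
        using dist[OF U mem[OF orthogonal_op_inv[OF U]] hyp_base_mem] M.commute
        by (simp add: L_def)
    qed
  qed
  then obtain C where C: "\<And>U. orthogonal_op U \<Longrightarrow> L U \<le> C" by blast
  define S where "S = (\<lambda>U. \<phi> U ?o) ` {U. orthogonal_op U}"
  have S: "S \<subseteq> hyp_space" "S \<noteq> {}" unfolding S_def using mem oid by blast+
  have "fst x \<le> cosh C" if "x \<in> S" for x
  proof -
    obtain U where U: "orthogonal_op U" "x = \<phi> U ?o" using \<open>x \<in> S\<close> unfolding S_def by blast
    have "cosh (hyp_dist x ?o) \<le> cosh C"
      using C[OF U(1)] M.nonneg[of x ?o] order_trans[OF M.nonneg C[OF U(1), unfolded L_def]]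
      by (subst cosh_real_nonneg_le_iff) (auto simp: L_def U(2))
    then show ?thesis using mem[OF U(1)] by (simp add: U(2) cosh_hyp_dist hyp_form_base)
  qed
  then obtain p where p: "p \<in> hyp_space" "\<And>g. g \<in> carrier Is_hyp \<Longrightarrow> S \<subseteq> g ` S \<Longrightarrow> g p = p"
    using hyp_bounded_set_circumcenter[OF S] by blast
  have "\<rho> k p = p" if k: "k \<in> carrier Is_hyp" "k hyp_base = hyp_base" for k
  proof -
    obtain V where V: "orthogonal_op V" "k = orthogonal_lift V"
      using base_stabilizer_eq_orthogonal_lift[OF k] by blast
    have "S \<subseteq> \<phi> V ` S"
    proof
      fix x assume "x \<in> S"
      then obtain U where U: "orthogonal_op U" "x = \<phi> U ?o" unfolding S_def by blast
      have o: "orthogonal_op (op_inv V \<circ> U)" by (intro orthogonal_op_comp orthogonal_op_inv U V)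
      have "V \<circ> (op_inv V \<circ> U) = U" by (simp add: o_assoc orthogonal_op_inv_cancel(3)[OF V(1)])
      then have "x = \<phi> V (\<phi> (op_inv V \<circ> U) ?o)" using \<phi>m[OF V(1) o hyp_base_mem] U(2) by simp
      then show "x \<in> \<phi> V ` S" unfolding S_def using o by blast
    qed
    then show ?thesis using p(2)[OF \<phi>c[OF V(1)]] by (simp add: \<phi>_def V(2))
  qed
  then show ?thesis using p(1) that by blast
qed

section \<open>Averages over frames\<close>

lemma Is_hyp_transitive:
  assumes "x \<in> hyp_space" "y \<in> hyp_space"
  obtains g where "g \<in> carrier Is_hyp" "g x = y"
  using Is_hyp_reflection[OF assms] by metis

text \<open>A vector of positive form is a nonzero multiple of a point of \<open>hyp_space\<close>,
  so the component \<open>z\<close> of \<open>x\<close> orthogonal to it has nonpositive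
  form.\<close>

lemma hyp_form_reverse_Cauchy_Schwarz:
  assumes y: "hyp_form y y > 0"
  shows "hyp_form x x * hyp_form y y \<le> (hyp_form x y)\<^sup>2"
proof -
  define c where "c = hyp_form x y / hyp_form y y"
  define z where "z = x - c *\<^sub>R y"
  have "fst y \<noteq> 0"
  proof
    assume "fst y = 0"
    then have "hyp_form y y \<le> 0" by (simp add: hyp_form_def)
    then show False using y by simp
  qed
  then consider "fst y > 0" | "fst (- y) > 0" by fastforce
  then obtain q a where q: "q \<in> hyp_space" "q = a *\<^sub>R y"
  proof cases
    case 1
    then show ?thesis using hyp_space_normalize[OF y] that by blast
  next
    case 2
    then show ?thesis
      using hyp_space_normalize[of "- y"] y that[of _ "- 1 / sqrt (hyp_form y y)"]
      by (simp add: hyp_form_minus)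
  qed
  have "hyp_form z y = 0" using y by (simp add: z_def c_def hyp_form_simps)
  then have "hyp_form z q = 0" by (simp add: q(2) hyp_form_simps)
  then have "hyp_form z z \<le> 0"
    using hyp_form_orthogonal_neg[OF q(1), of z] by (cases "z = 0") auto
  moreover have "hyp_form z z = hyp_form x x - (hyp_form x y)\<^sup>2 / hyp_form y y"
    using y unfolding z_def c_def hyp_form_simps hyp_form_commute[of y x]
    by (simp add: power2_eq_square field_simps)
  ultimately show ?thesis using y by (simp add: field_simps)
qed

lemma bounded_linear_hyp_form: "bounded_linear (\<lambda>x. hyp_form x y)" "bounded_linear (hyp_form x)"
  by (rule bounded_bilinear.bounded_linear_left[OF bounded_bilinear_hyp_form]
      bounded_bilinear.bounded_linear_right[OF bounded_bilinear_hyp_form])+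

lemmas linear_hyp_form = bounded_linear_hyp_form[THEN bounded_linear.linear]

section \<open>Spheres around the base point and orthonormal frames\<close>

definition sphere_point :: "real \<Rightarrow> 'h \<Rightarrow> real \<times> 'h::real_inner"
  where "sphere_point u e = (u, sqrt (u\<^sup>2 - 1) *\<^sub>R e)"

lemma sphere_point_mem:
  assumes "u \<ge> 1" "norm e = 1"
  shows "sphere_point u e \<in> hyp_space"
proof -
  have "u\<^sup>2 - 1 \<ge> 0" using assms(1) by simp
  moreover have "e \<bullet> e = 1" using assms(2) by (simp add: dot_square_norm)
  ultimately show ?thesis
    using assms(1) by (simp add: sphere_point_def hyp_space_def hyp_form_def power2_eq_square[symmetric])
qed

lemma fst_sphere_point [simp]: "fst (sphere_point u e) = u"
  by (simp add: sphere_point_def)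

text \<open>The source of the multiplicative law: a direction orthogonal to the vector part of
  \<open>z\<close> contributes nothing, so only the product of first coordinates survives.\<close>

lemma hyp_form_sphere_point: "e \<bullet> snd z = 0 \<Longrightarrow> hyp_form (sphere_point u e) z = u * fst z"
  by (simp add: sphere_point_def hyp_form_def)

definition frame :: "'h::real_inner set \<Rightarrow> bool"
  where "frame E \<longleftrightarrow> finite E \<and> E \<noteq> {} \<and> orthonormal_on E (\<lambda>e. e)"

lemma frame_norm: "frame E \<Longrightarrow> e \<in> E \<Longrightarrow> norm e = 1"
  using orthonormal_on_norm[of E "\<lambda>e. e"] by (simp add: frame_def)

lemma frame_card: "frame E \<Longrightarrow> real (card E) > 0"
  by (simp add: frame_def card_gt_0_iff)

lemma frame_exists:
  assumes inf: "infinite_dim (UNIV :: 'h::real_inner set)" and S: "finite (S :: 'h set)"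
  obtains E where "frame E" "card E = Suc n" "\<And>e s. e \<in> E \<Longrightarrow> s \<in> S \<Longrightarrow> e \<bullet> s = 0"
proof -
  have "\<exists>E. frame E \<and> card E = Suc n \<and> (\<forall>e\<in>E. \<forall>s\<in>S. e \<bullet> s = 0)"
  proof (induction n)
    case 0
    obtain e where "norm e = 1" "\<And>s. s \<in> S \<Longrightarrow> e \<bullet> s = 0"
      using infinite_dim_unit_orthogonal[OF S subspace_UNIV inf] by metis
    then show ?case
      by (intro exI[of _ "{e}"]) (simp add: frame_def orthonormal_on_def dot_square_norm)
  next
    case (Suc n)
    then obtain E where E: "frame E" "card E = Suc n" "\<forall>e\<in>E. \<forall>s\<in>S. e \<bullet> s = 0" by (elim exE conjE)
    then have fin: "finite E" by (simp add: frame_def)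
    obtain e where e: "norm e = 1" "\<And>s. s \<in> S \<union> E \<Longrightarrow> e \<bullet> s = 0"
      using infinite_dim_unit_orthogonal[OF finite_UnI[OF S fin] subspace_UNIV inf] by metis
    have "e \<notin> E"
    proof
      assume "e \<in> E"
      then have "e \<bullet> e = 0" using e(2) by blast
      then show False using e(1) by simp
    qed
    moreover have "frame (insert e E)"
      unfolding frame_def orthonormal_on_def
    proof (intro conjI ballI)
      fix a b assume "a \<in> insert e E" "b \<in> insert e E"
      then show "a \<bullet> b = (if a = b then 1 else 0)"
        using \<open>e \<notin> E\<close> E(1) e(1) e(2)[of a] e(2)[of b]
        by (cases "a = e"; cases "b = e") (auto simp: dot_square_norm frame_def orthonormal_on_def inner_commute)
    qed (use fin in auto)
    ultimately show ?case
      using E e fin by (intro exI[of _ "insert e E"]) auto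
  qed
  then show ?thesis using that by blast
qed

text \<open>The locale is interpreted twice in \<open>irreducible_rep_power_equivariant\<close>:
  first for a fixed point \<open>p\<close> that comes from a circumcenter, then for the normalized
  eigenvector \<open>q\<close>.\<close>

locale base_fixed_rep =
  fixes \<rho> :: "(real \<times> 'h \<Rightarrow> real \<times> 'h::{real_inner, complete_space}) \<Rightarrow> real \<times> 'k \<Rightarrow> real \<times> 'k::{real_inner, complete_space}"
    and p :: "real \<times> 'k"
  assumes infinite_dim: "infinite_dim (UNIV :: 'h set)"
    and hom: "\<rho> \<in> hom Is_hyp Is_hyp"
    and p_mem: "p \<in> hyp_space"
    and p_fixed: "\<And>k. k \<in> carrier Is_hyp \<Longrightarrow> k hyp_base = hyp_base \<Longrightarrow> \<rho> k p = p"
begin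

lemma exists_unit: "\<exists>e :: 'h. norm e = 1"
  using infinite_dim_unit_orthogonal[OF finite.emptyI subspace_UNIV infinite_dim] by metis

lemma frame_sequence_exists: "\<exists>E :: nat \<Rightarrow> 'h set. (\<forall>n. frame (E n)) \<and> (\<forall>n. card (E n) = Suc n)"
proof -
  have "\<exists>E :: 'h set. frame E \<and> card E = Suc n" for n
    using frame_exists[OF infinite_dim finite.emptyI] by metis
  then show ?thesis by metis
qed

lemma rho_carrier: "g \<in> carrier Is_hyp \<Longrightarrow> \<rho> g \<in> carrier Is_hyp"
  using hom by (auto simp: hom_def)

lemma rho_mult:
  assumes "g \<in> carrier Is_hyp" "h \<in> carrier Is_hyp" "x \<in> hyp_space"
  shows "\<rho> (g \<otimes>\<^bsub>Is_hyp\<^esub> h) x = \<rho> g (\<rho> h x)"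
  using hom_mult[OF hom assms(1,2)] assms by (simp add: Is_hyp_mult rho_carrier)

text \<open>The value does not depend on the chosen \<open>g\<close>: two choices differ by an
  element of the stabilizer, whose image fixes \<open>p\<close>
  (\<open>orbit_map_image\<close>).\<close>

definition orbit_map :: "real \<times> 'h \<Rightarrow> real \<times> 'k"
  where "orbit_map x = \<rho> (SOME g. g \<in> carrier Is_hyp \<and> g hyp_base = x) p"

lemma orbit_map_image:
  assumes g: "g \<in> carrier Is_hyp"
  shows "orbit_map (g hyp_base) = \<rho> g p"
proof -
  interpret G: group "Is_hyp :: (real \<times> 'h \<Rightarrow> real \<times> 'h) monoid" by (rule group_Is_hyp)
  define h where "h = (SOME h. h \<in> carrier Is_hyp \<and> h hyp_base = g hyp_base)"
  have h: "h \<in> carrier Is_hyp" "h hyp_base = g hyp_base"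
    using someI[of "\<lambda>h. h \<in> carrier Is_hyp \<and> h hyp_base = g hyp_base" g] g by (auto simp: h_def)
  define k where "k = inv\<^bsub>Is_hyp\<^esub> g \<otimes>\<^bsub>Is_hyp\<^esub> h"
  have k: "k \<in> carrier Is_hyp" using g h(1) by (simp add: k_def)
  have "k hyp_base = hyp_base"
    using g h by (simp add: k_def Is_hyp_mult Is_hyp_inv)
  then have "\<rho> k p = p" by (rule p_fixed[OF k])
  moreover have "h = g \<otimes>\<^bsub>Is_hyp\<^esub> k" using g h(1) by (simp add: k_def G.m_assoc[symmetric])
  ultimately have "\<rho> h p = \<rho> g p" using rho_mult[OF g k p_mem] by simp
  then show ?thesis by (simp add: orbit_map_def h_def)
qed

lemma orbit_map_base: "orbit_map hyp_base = p"
proof -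
  interpret G: group "Is_hyp :: (real \<times> 'h \<Rightarrow> real \<times> 'h) monoid" by (rule group_Is_hyp)
  show ?thesis
    using orbit_map_image[OF G.one_closed] p_fixed[OF G.one_closed] by (simp add: Is_hyp_one)
qed

lemma orbit_map_mem:
  assumes "x \<in> hyp_space" shows "orbit_map x \<in> hyp_space"
proof -
  obtain g where "g \<in> carrier Is_hyp" "g hyp_base = x" using Is_hyp_transitive[OF hyp_base_mem assms] .
  then show ?thesis using orbit_map_image Is_hyp_mem[OF rho_carrier p_mem] by metis
qed

lemma orbit_map_equivariant:
  assumes g: "g \<in> carrier Is_hyp" and x: "x \<in> hyp_space"
  shows "orbit_map (g x) = \<rho> g (orbit_map x)"
proof -
  interpret G: group "Is_hyp :: (real \<times> 'h \<Rightarrow> real \<times> 'h) monoid" by (rule group_Is_hyp)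
  obtain h where h: "h \<in> carrier Is_hyp" "h hyp_base = x" using Is_hyp_transitive[OF hyp_base_mem x] .
  have "orbit_map (g x) = \<rho> (g \<otimes>\<^bsub>Is_hyp\<^esub> h) p"
    using orbit_map_image[OF G.m_closed[OF g h(1)]] by (simp add: Is_hyp_mult g h)
  then show ?thesis using rho_mult[OF g h(1) p_mem] orbit_map_image[OF h(1)] h(2) by simp
qed

lemma lin_ext_orbit_map:
  "g \<in> carrier Is_hyp \<Longrightarrow> x \<in> hyp_space \<Longrightarrow> lin_ext (\<rho> g) (orbit_map x) = orbit_map (g x)"
  by (simp add: lin_extD(4) rho_carrier orbit_map_mem orbit_map_equivariant)

text \<open>This is the function \<open>F\<close>, read off along one ray; two-point homogeneity
  makes the direction irrelevant.\<close>

definition radial_kernel :: "real \<Rightarrow> real"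
  where "radial_kernel u = hyp_form (orbit_map (sphere_point u (SOME e. norm e = 1))) p"

lemma radial_kernel:
  assumes x: "x \<in> hyp_space" and y: "y \<in> hyp_space"
  shows "hyp_form (orbit_map x) (orbit_map y) = radial_kernel (hyp_form x y)"
proof -
  let ?e = "SOME e :: 'h. norm e = 1" and ?u = "hyp_form x y"
  have e: "norm ?e = 1" using exists_unit by (rule someI_ex)
  have s: "sphere_point ?u ?e \<in> hyp_space" by (rule sphere_point_mem[OF hyp_form_ge_1[OF x y] e])
  obtain g where g: "g \<in> carrier Is_hyp" "g (sphere_point ?u ?e) = x" "g hyp_base = y"
    by (rule Is_hyp_two_point_homogeneous[OF s hyp_base_mem x y]) (simp_all add: hyp_form_base)
  have "hyp_form (orbit_map x) (orbit_map y)
      = hyp_form (\<rho> g (orbit_map (sphere_point ?u ?e))) (\<rho> g p)"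
    using orbit_map_equivariant[OF g(1) s] orbit_map_image[OF g(1)] g(2,3) by simp
  also have "\<dots> = radial_kernel ?u"
    using Is_hyp_form[OF rho_carrier[OF g(1)] orbit_map_mem[OF s] p_mem] by (simp add: radial_kernel_def)
  finally show ?thesis .
qed

lemma radial_kernel_ge_1:
  assumes "u \<ge> 1" shows "radial_kernel u \<ge> 1"
proof -
  obtain e :: 'h where e: "norm e = 1" using exists_unit by blast
  note s = sphere_point_mem[OF assms e]
  have "hyp_form (orbit_map (sphere_point u e)) (orbit_map hyp_base) \<ge> 1"
    by (intro hyp_form_ge_1 orbit_map_mem s hyp_base_mem)
  then show ?thesis using radial_kernel[OF s hyp_base_mem] by (simp add: hyp_form_base)
qed

section \<open>Averages of the orbit map over frames\<close>

definition frame_average :: "real \<Rightarrow> 'h set \<Rightarrow> real \<times> 'k"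
  where "frame_average u E = (1 / card E) *\<^sub>R (\<Sum>e\<in>E. orbit_map (sphere_point u e))"

lemma linear_frame_average:
  assumes "linear l" "frame E" "\<And>e. e \<in> E \<Longrightarrow> l (orbit_map (sphere_point u e)) = c"
  shows "l (frame_average u E) = c"
  using assms(2,3) frame_card[OF assms(2)]
  by (simp add: frame_average_def linear_scale[OF assms(1)] linear_sum[OF assms(1)] sum_constant_scaleR)

lemma frame_average_orbit_map:
  assumes "u \<ge> 1" "frame E" "z \<in> hyp_space" "\<And>e. e \<in> E \<Longrightarrow> e \<bullet> snd z = 0"
  shows "hyp_form (frame_average u E) (orbit_map z) = radial_kernel (u * fst z)"
  using assms
  by (intro linear_frame_average[OF linear_hyp_form(1)])
    (simp_all add: radial_kernel sphere_point_mem frame_norm hyp_form_sphere_point)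

lemma frame_average_p:
  "u \<ge> 1 \<Longrightarrow> frame E \<Longrightarrow> hyp_form (frame_average u E) p = radial_kernel u"
  using frame_average_orbit_map[of u E hyp_base] by (simp add: orbit_map_base) (simp add: hyp_base_def)

lemma frame_average_orthogonal:
  assumes "u \<ge> 1" "frame E" "frame E'" "\<And>e e'. e \<in> E \<Longrightarrow> e' \<in> E' \<Longrightarrow> e \<bullet> e' = 0"
  shows "hyp_form (frame_average u E) (frame_average u E') = radial_kernel (u\<^sup>2)"
proof (rule linear_frame_average[OF linear_hyp_form(2) assms(3)])
  fix e' assume e': "e' \<in> E'"
  show "hyp_form (frame_average u E) (orbit_map (sphere_point u e')) = radial_kernel (u\<^sup>2)"
    using frame_average_orbit_map[OF assms(1,2) sphere_point_mem[OF assms(1) frame_norm[OF assms(3) e']]] assms(4) e'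
    by (simp add: power2_eq_square) (simp add: sphere_point_def)
qed

text \<open>Distinct members of the frame give points with form value \<open>u\<^sup>2\<close>; the
  diagonal pairs give \<open>1\<close> instead of the kernel value, an error that vanishes like one
  over the size of the frame.\<close>

lemma frame_average_self:
  assumes u: "u \<ge> 1" and E: "frame E"
  shows "hyp_form (frame_average u E) (frame_average u E)
    = radial_kernel (u\<^sup>2) + (1 / card E) * (1 - radial_kernel (u\<^sup>2))"
proof (rule linear_frame_average[OF linear_hyp_form(2) E])
  fix e' assume e': "e' \<in> E"
  let ?s = "sphere_point u"
  have s: "?s e \<in> hyp_space" if "e \<in> E" for e using that u E by (simp add: sphere_point_mem frame_norm)
  have fin: "finite E" using E by (simp add: frame_def)
  have k: "hyp_form (orbit_map (?s e)) (orbit_map (?s e')) = radial_kernel (u\<^sup>2) + (if e = e' then 1 - radial_kernel (u\<^sup>2) else 0)"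
    if "e \<in> E" for e
  proof (cases "e = e'")
    case True
    then show ?thesis using hyp_form_self[OF orbit_map_mem[OF s[OF that]]] by simp
  next
    case False
    then have "e \<bullet> e' = 0" using E that e' by (simp add: frame_def orthonormal_on_def)
    then have "hyp_form (?s e) (?s e') = u\<^sup>2"
      using hyp_form_sphere_point[of e "?s e'" u] by (simp add: power2_eq_square) (simp add: sphere_point_def)
    then show ?thesis using radial_kernel[OF s[OF that] s[OF e']] False by simp
  qed
  have "(\<Sum>e\<in>E. hyp_form (orbit_map (?s e)) (orbit_map (?s e')))
      = card E * radial_kernel (u\<^sup>2) + (1 - radial_kernel (u\<^sup>2))"
    using e' fin by (simp add: k sum.distrib)
  then show "hyp_form (frame_average u E) (orbit_map (?s e'))
      = radial_kernel (u\<^sup>2) + (1 / card E) * (1 - radial_kernel (u\<^sup>2))"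
    using frame_card[OF E]
    by (simp add: frame_average_def hyp_form_simps hyp_form_sum_left field_simps)
qed

text \<open>Two large frames are compared through a third one which is orthogonal to both.\<close>

lemma frame_average_close:
  assumes u: "u \<ge> 1" and E: "frame E" "card E \<ge> N" and E': "frame E'" "card E' \<ge> N" and N: "N > 0"
  shows "norm (frame_average u E - frame_average u E') \<le> 4 * fst p * sqrt ((radial_kernel (u\<^sup>2) - 1) / N)"
proof -
  define k where "k = radial_kernel (u\<^sup>2) - 1"
  have k0: "k \<ge> 0" using radial_kernel_ge_1[of "u\<^sup>2"] u by (simp add: k_def)
  have p1: "fst p \<ge> 1" by (rule hyp_space_fst_ge_1[OF p_mem])
  have fin: "finite (E \<union> E')" using E E' by (simp add: frame_def)
  obtain D where D: "frame D" "card D = Suc N" "\<And>e s. e \<in> D \<Longrightarrow> s \<in> E \<union> E' \<Longrightarrow> e \<bullet> s = 0"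
    using frame_exists[OF infinite_dim fin] by metis
  have *: "norm (frame_average u E - frame_average u D) \<le> 2 * fst p * sqrt (k / N)"
    if E: "frame E" "card E \<ge> N" "\<And>e s. e \<in> D \<Longrightarrow> s \<in> E \<Longrightarrow> e \<bullet> s = 0" for E
  proof (rule power2_le_imp_le)
    let ?d = "frame_average u E - frame_average u D"
    \<comment> \<open>All frame averages have the same form value with \<open>p\<close>, so a
      difference is orthogonal to \<open>p\<close> and its norm is controlled by its form, in which
      only the diagonal errors remain.\<close>
    have "hyp_form ?d p = 0" by (simp add: hyp_form_simps frame_average_p u E D)
    then have "(norm ?d)\<^sup>2 \<le> 2 * (fst p)\<^sup>2 * (- hyp_form ?d ?d)" by (rule norm_orthogonal_le[OF p_mem])
    also have "- hyp_form ?d ?d = (1 / card E + 1 / card D) * k"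
    proof -
      have "hyp_form (frame_average u D) (frame_average u E) = radial_kernel (u\<^sup>2)"
        by (rule frame_average_orthogonal[OF u D(1) E(1) E(3)])
      then show ?thesis
        using frame_average_self[OF u E(1)] frame_average_self[OF u D(1)]
        by (simp add: hyp_form_simps hyp_form_commute[of "frame_average u E" "frame_average u D"] k_def algebra_simps)
    qed
    also have "2 * (fst p)\<^sup>2 * ((1 / card E + 1 / card D) * k) \<le> 2 * (fst p)\<^sup>2 * ((1 / N + 1 / N) * k)"
      using E(2) D(2) N k0 by (intro mult_left_mono mult_right_mono add_mono divide_left_mono) auto
    also have "\<dots> = (2 * fst p * sqrt (k / N))\<^sup>2"
      using k0 by (simp add: power_mult_distrib)
    finally show "(norm ?d)\<^sup>2 \<le> (2 * fst p * sqrt (k / N))\<^sup>2" .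
  qed (use k0 p1 in simp)
  have "norm (frame_average u E - frame_average u E')
      \<le> norm (frame_average u E - frame_average u D) + norm (frame_average u E' - frame_average u D)"
    using norm_triangle_ineq4[of "frame_average u E - frame_average u D" "frame_average u E' - frame_average u D"]
    by simp
  also have "\<dots> \<le> 2 * fst p * sqrt (k / N) + 2 * fst p * sqrt (k / N)"
    using E E' D(3) by (intro add_mono *) auto
  finally show ?thesis by (simp add: k_def)
qed

text \<open>The uniform estimate makes one sequence Cauchy, and comparison with it shows that the
  limit is the same for all sequences of growing frames. This freedom is used to choose frames
  orthogonal to given vectors (\<open>average_eqI\<close>) and to move frames by an operator
  (\<open>average_fixed\<close>).\<close>

lemma frame_average_limit:
  assumes u: "u \<ge> 1"
  shows "\<exists>v. \<forall>E. (\<forall>n. frame (E n) \<and> card (E n) \<ge> Suc n) \<longrightarrow> (\<lambda>n. frame_average u (E n)) \<longlonglongrightarrow> v"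
proof -
  define b where "b n = 4 * fst p * sqrt ((radial_kernel (u\<^sup>2) - 1) / Suc n)" for n :: nat
  have "(\<lambda>n. 4 * fst p * sqrt ((radial_kernel (u\<^sup>2) - 1) * (1 / Suc n))) \<longlonglongrightarrow> 4 * fst p * sqrt ((radial_kernel (u\<^sup>2) - 1) * 0)"
    by (intro tendsto_intros LIMSEQ_Suc[OF lim_1_over_n])
  then have b: "b \<longlonglongrightarrow> 0" by (simp add: b_def[abs_def])
  obtain D :: "nat \<Rightarrow> 'h set" where D: "\<And>n. frame (D n)" "\<And>n. card (D n) = Suc n"
    using frame_sequence_exists by blast
  have "Cauchy (\<lambda>n. frame_average u (D n))"
  proof (rule metric_CauchyI)
    fix e :: real assume "e > 0"
    then have "eventually (\<lambda>n. b n < e) sequentially" using b order_tendstoD(2) by blast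
    then obtain N where N: "b N < e" by (auto simp: eventually_sequentially)
    have "dist (frame_average u (D m)) (frame_average u (D n)) < e" if "m \<ge> N" "n \<ge> N" for m n
      using frame_average_close[OF u D(1)[of m] _ D(1)[of n], of "Suc N"] that N
      by (simp add: D(2) dist_norm b_def)
    then show "\<exists>N. \<forall>m\<ge>N. \<forall>n\<ge>N. dist (frame_average u (D m)) (frame_average u (D n)) < e" by blast
  qed
  then obtain v where v: "(\<lambda>n. frame_average u (D n)) \<longlonglongrightarrow> v" using Cauchy_convergent convergent_def by blast
  have "(\<lambda>n. frame_average u (E n)) \<longlonglongrightarrow> v" if E: "\<forall>n. frame (E n) \<and> card (E n) \<ge> Suc n" for E
  proof -
    have "norm (frame_average u (E n) - frame_average u (D n)) \<le> b n" for n
      using frame_average_close[OF u, of "E n" "Suc n" "D n"] E D unfolding b_def by simp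
    then have "(\<lambda>n. frame_average u (E n) - frame_average u (D n)) \<longlonglongrightarrow> 0"
      by (intro Lim_null_comparison[OF _ b]) (auto intro: always_eventually)
    from tendsto_add[OF this v] show ?thesis by simp
  qed
  then show ?thesis by blast
qed

definition average :: "real \<Rightarrow> real \<times> 'k"
  where "average u = (SOME v. \<forall>E. (\<forall>n. frame (E n) \<and> card (E n) \<ge> Suc n) \<longrightarrow> (\<lambda>n. frame_average u (E n)) \<longlonglongrightarrow> v)"

lemma average_limit:
  assumes "u \<ge> 1" "\<And>n. frame (E n)" "\<And>n. card (E n) \<ge> Suc n"
  shows "(\<lambda>n. frame_average u (E n)) \<longlonglongrightarrow> average u"
  using someI_ex[OF frame_average_limit[OF assms(1)]] assms(2,3) unfolding average_def by blast

text \<open>A continuous linear quantity of the average may be computed along frames orthogonal to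
  any finite set \<open>S\<close>, so it only has to be known in such directions.\<close>

lemma average_eqI:
  fixes l :: "real \<times> 'k \<Rightarrow> 'b::real_normed_vector"
  assumes u: "u \<ge> 1" and S: "finite S" and l: "bounded_linear l"
    and c: "\<And>e. norm e = 1 \<Longrightarrow> (\<And>s. s \<in> S \<Longrightarrow> e \<bullet> s = 0) \<Longrightarrow> l (orbit_map (sphere_point u e)) = c"
  shows "l (average u) = c"
proof -
  have "\<exists>E. frame E \<and> card E = Suc n \<and> (\<forall>e\<in>E. \<forall>s\<in>S. e \<bullet> s = 0)" for n
    using frame_exists[OF infinite_dim S] by metis
  then obtain E where E: "\<And>n. frame (E n)" "\<And>n. card (E n) = Suc n" "\<And>n. \<forall>e\<in>E n. \<forall>s\<in>S. e \<bullet> s = 0"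
    by metis
  have "l (frame_average u (E n)) = c" for n
    using c E(1,3) frame_norm
    by (intro linear_frame_average[OF bounded_linear.linear[OF l]]) blast+
  moreover have "(\<lambda>n. l (frame_average u (E n))) \<longlonglongrightarrow> l (average u)"
    using E by (intro bounded_linear.tendsto[OF l] average_limit u) auto
  ultimately show ?thesis by (simp add: LIMSEQ_const_iff)
qed

lemma average_orbit_map:
  assumes u: "u \<ge> 1" and z: "z \<in> hyp_space"
  shows "hyp_form (average u) (orbit_map z) = radial_kernel (u * fst z)"
  by (rule average_eqI[OF u, of "{snd z}"])
    (use u z in \<open>simp_all add: bounded_linear_hyp_form radial_kernel sphere_point_mem hyp_form_sphere_point\<close>)

lemma average_average:
  assumes u: "u \<ge> 1" and w: "w \<ge> 1"
  shows "hyp_form (average u) (average w) = radial_kernel (u * w)"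
  by (rule average_eqI[OF w finite.emptyI bounded_linear_hyp_form(2)])
    (use u w in \<open>simp add: average_orbit_map sphere_point_mem\<close>)

text \<open>For \<open>e\<close> orthogonal to the vector part of the preimage of the base point,
  \<open>g\<close> multiplies the height of \<open>sphere_point u e\<close> by
  \<open>fst (g hyp_base)\<close>. Seen through the averages, \<open>\<rho> g\<close> is the
  dilation of the parameter by this number.\<close>

lemma translated_average_average:
  assumes g: "g \<in> carrier Is_hyp" and u: "u \<ge> 1" and w: "w \<ge> 1"
  shows "hyp_form (lin_ext (\<rho> g) (average u)) (average w) = radial_kernel (fst (g hyp_base) * u * w)"
proof -
  interpret G: group "Is_hyp :: (real \<times> 'h \<Rightarrow> real \<times> 'h) monoid" by (rule group_Is_hyp)
  let ?q = "(inv\<^bsub>Is_hyp\<^esub> g) hyp_base"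
  have q: "?q \<in> hyp_space" using g by (simp add: Is_hyp_mem)
  have shift: "fst (g x) = hyp_form x ?q" if "x \<in> hyp_space" for x
    using Is_hyp_form[OF g that q] Is_hyp_inv(2)[OF g hyp_base_mem] by (simp add: hyp_form_base)
  have fq: "fst ?q = fst (g hyp_base)"
    using shift[OF hyp_base_mem] hyp_form_commute[of hyp_base ?q] by (simp add: hyp_form_base)
  show ?thesis
  proof (rule average_eqI[OF u, of "{snd ?q}"])
    show "bounded_linear (\<lambda>x. hyp_form (lin_ext (\<rho> g) x) (average w))"
      by (rule bounded_linear_compose[OF bounded_linear_hyp_form(1) bounded_linear_lin_ext[OF rho_carrier[OF g]]])
    fix e :: 'h assume e: "norm e = 1" "\<And>s. s \<in> {snd ?q} \<Longrightarrow> e \<bullet> s = 0"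
    note s = sphere_point_mem[OF u e(1)]
    have "fst (g (sphere_point u e)) = u * fst (g hyp_base)"
      using shift[OF s] hyp_form_sphere_point[of e ?q u] e(2) by (simp add: fq)
    then show "hyp_form (lin_ext (\<rho> g) (orbit_map (sphere_point u e))) (average w) = radial_kernel (fst (g hyp_base) * u * w)"
      using average_orbit_map[OF w Is_hyp_mem[OF g s]] hyp_form_commute[of "average w"]
      by (simp add: lin_ext_orbit_map[OF g s] mult_ac)
  qed simp
qed

text \<open>The stabilizer turns frames into frames of the same size, and the limit does not depend
  on the frames.\<close>

lemma average_fixed:
  assumes k: "k \<in> carrier Is_hyp" "k hyp_base = hyp_base" and u: "u \<ge> 1"
  shows "lin_ext (\<rho> k) (average u) = average u"
proof -
  obtain U where U: "orthogonal_op U" "k = orthogonal_lift U"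
    using base_stabilizer_eq_orthogonal_lift[OF k] by blast
  note UD = orthogonal_opD[OF U(1)]
  obtain E :: "nat \<Rightarrow> 'h set" where E: "\<And>n. frame (E n)" "\<And>n. card (E n) = Suc n"
    using frame_sequence_exists by blast
  have inj: "inj_on U A" for A using UD(6) by (rule inj_on_subset) simp
  have UE: "frame (U ` E n)" "card (U ` E n) = Suc n" for n
    using E(1)[of n] E(2)[of n] inj_eq[OF UD(6)]
    by (auto simp: frame_def orthonormal_on_def UD(3) card_image[OF inj])
  have "lin_ext (\<rho> k) (frame_average u (E n)) = frame_average u (U ` E n)" for n
  proof -
    have l: "linear (lin_ext (\<rho> k))" using k(1) by (simp add: lin_extD(1) rho_carrier)
    have "lin_ext (\<rho> k) (orbit_map (sphere_point u e)) = orbit_map (sphere_point u (U e))" if "e \<in> E n" for e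
    proof -
      note s = sphere_point_mem[OF u frame_norm[OF E(1) that]]
      have "k (sphere_point u e) = sphere_point u (U e)"
        using s by (simp add: U(2) orthogonal_lift_def sphere_point_def linear_scale[OF UD(1)])
      then show ?thesis by (simp add: lin_ext_orbit_map[OF k(1) s])
    qed
    then show ?thesis
      by (simp add: frame_average_def linear_scale[OF l] linear_sum[OF l] card_image[OF inj] sum.reindex[OF inj])
  qed
  moreover have "(\<lambda>n. lin_ext (\<rho> k) (frame_average u (E n))) \<longlonglongrightarrow> lin_ext (\<rho> k) (average u)"
    using E by (intro bounded_linear.tendsto[OF bounded_linear_lin_ext[OF rho_carrier[OF k(1)]]] average_limit u) auto
  moreover have "(\<lambda>n. frame_average u (U ` E n)) \<longlonglongrightarrow> average u"
    using UE by (intro average_limit u) auto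
  ultimately show ?thesis using LIMSEQ_unique by simp
qed

text \<open>Keeps the averages away from zero, so that they can be normalized by the first
  coordinate.\<close>

lemma fst_average_ge_1:
  assumes u: "u \<ge> 1" shows "fst (average u) \<ge> 1"
proof -
  obtain E :: "nat \<Rightarrow> 'h set" where E: "\<And>n. frame (E n)" "\<And>n. card (E n) = Suc n"
    using frame_sequence_exists by blast
  have "fst (frame_average u (E n)) \<ge> 1" for n
  proof -
    have "(\<Sum>e\<in>E n. fst (orbit_map (sphere_point u e))) \<ge> of_nat (card (E n)) * 1"
      by (rule sum_bounded_below)
        (simp add: hyp_space_fst_ge_1 orbit_map_mem sphere_point_mem[OF u frame_norm[OF E(1)]])
    then show ?thesis by (simp add: frame_average_def fst_sum E(2) field_simps)
  qed
  moreover have "(\<lambda>n. fst (frame_average u (E n))) \<longlonglongrightarrow> fst (average u)"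
    using E by (intro tendsto_fst average_limit u) auto
  ultimately show ?thesis by (intro LIMSEQ_le_const) auto
qed

end

section \<open>A common eigenvector\<close>

text \<open>Concavity is available only at midpoints and without regularity, so increments over a
  step \<open>a\<close> are compared along progressions of step \<open>a\<close>. Nonnegativity
  excludes negative increments. The integer increments decrease to \<open>t\<close>, and the
  resulting linear bounds on \<open>\<psi>\<close> transfer this limit to every \<open>a\<close>.
  The doubled arguments match \<open>F (u\<^sup>2) * F (w\<^sup>2) \<le> (F (u * w))\<^sup>2\<close>
  at \<open>u = exp s\<close>.\<close>

lemma midpoint_concave_increments:
  fixes \<psi> :: "real \<Rightarrow> real"
  assumes nonneg: "\<And>s. s \<ge> 0 \<Longrightarrow> \<psi> s \<ge> 0"
    and conc: "\<And>s t. s \<ge> 0 \<Longrightarrow> t \<ge> 0 \<Longrightarrow> \<psi> (2 * s) + \<psi> (2 * t) \<le> 2 * \<psi> (s + t)"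
  obtains t where "t \<ge> 0" "\<And>a. a \<ge> 0 \<Longrightarrow> ((\<lambda>s. \<psi> (s + a) - \<psi> s) \<longlongrightarrow> t * a) at_top"
proof -
  have step: "\<psi> (s + a + a) - \<psi> (s + a) \<le> \<psi> (s + a) - \<psi> s" if "s \<ge> 0" "a \<ge> 0" for s a
  proof -
    have eqs: "2 * (s / 2) = s" "2 * (s / 2 + a) = s + a + a" "s / 2 + (s / 2 + a) = s + a" by simp_all
    show ?thesis using conc[of "s / 2" "s / 2 + a"] that unfolding eqs by simp
  qed
  have steps: "\<psi> (s + n * a + a) - \<psi> (s + n * a) \<le> \<psi> (s + a) - \<psi> s" if "s \<ge> 0" "a \<ge> 0" for s a :: real and n :: nat
  proof (induction n)
    case (Suc n)
    have "\<psi> (s + n * a + a + a) - \<psi> (s + n * a + a) \<le> \<psi> (s + n * a + a) - \<psi> (s + n * a)"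
      using that by (intro step) auto
    then show ?case using Suc by (simp add: algebra_simps)
  qed simp
  have sum_le: "\<psi> (s + n * a) \<le> \<psi> s + n * (\<psi> (s + a) - \<psi> s)" if "s \<ge> 0" "a \<ge> 0" for s a :: real and n :: nat
  proof (induction n)
    case (Suc n)
    then show ?case using steps[OF that, of n] by (simp add: algebra_simps)
  qed simp
  have arch: "x \<ge> 0" if "\<And>n :: nat. C + n * x \<ge> 0" for x C :: real
  proof (rule ccontr)
    assume "\<not> x \<ge> 0"
    then obtain n :: nat where "C < n * (- x)" using reals_Archimedean3[of "- x"] by auto
    then show False using that[of n] by simp
  qed
  have inc: "\<psi> s \<le> \<psi> (s + a)" if "s \<ge> 0" "a \<ge> 0" for s a
  proof -
    have "\<psi> s + n * (\<psi> (s + a) - \<psi> s) \<ge> 0" for n :: nat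
      using order_trans[OF nonneg sum_le[OF that, of n]] that by simp
    from arch[OF this] show ?thesis by simp
  qed
  have mono: "\<psi> x \<le> \<psi> y" if "0 \<le> x" "x \<le> y" for x y
    using inc[of x "y - x"] that by simp
  define D where "D n = \<psi> (real n + 1) - \<psi> (real n)" for n
  have "decseq D"
  proof (rule decseq_SucI)
    show "D (Suc n) \<le> D n" for n using step[of "real n" 1] by (simp add: D_def add_ac)
  qed
  moreover have "D n \<ge> 0" for n using inc[of "real n" 1] by (simp add: D_def)
  ultimately obtain t where t: "D \<longlonglongrightarrow> t" "\<And>n. t \<le> D n"
    using decseq_convergent[of D 0] by metis
  have t0: "t \<ge> 0" by (rule LIMSEQ_le_const[OF t(1)]) (use \<open>\<And>n. D n \<ge> 0\<close> in auto)
  have lower_nat: "n * t \<le> \<psi> (real n)" for n :: nat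
  proof (induction n)
    case (Suc n)
    then show ?case using t(2)[of n] by (simp add: D_def algebra_simps)
  qed (simp add: nonneg)
  \<comment> \<open>Rounding \<open>x\<close> down to an integer costs at most one step, hence
    \<open>x - 1\<close>; rounding up accounts for \<open>x + 1\<close> in
    \<open>upper\<close>.\<close>
  have lower: "(x - 1) * t \<le> \<psi> x" if "x \<ge> 0" for x
  proof -
    have "(x - 1) * t \<le> real (nat \<lfloor>x\<rfloor>) * t" using t0 that by (intro mult_right_mono) linarith+
    also have "\<dots> \<le> \<psi> (real (nat \<lfloor>x\<rfloor>))" by (rule lower_nat)
    also have "\<dots> \<le> \<psi> x" using that by (intro mono) auto
    finally show ?thesis .
  qed
  have upper: "\<exists>C. \<forall>x\<ge>0. \<psi> x \<le> C + (x + 1) * (t + \<epsilon>)" if e: "\<epsilon> > 0" for \<epsilon>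
  proof -
    have "eventually (\<lambda>n. D n < t + \<epsilon>) sequentially" using t(1) by (rule order_tendstoD) (use e in simp)
    then obtain N where N: "\<And>n. n \<ge> N \<Longrightarrow> D n < t + \<epsilon>" by (auto simp: eventually_sequentially)
    have *: "\<psi> (real n) \<le> \<psi> (real N) + n * (t + \<epsilon>)" for n :: nat
    proof (induction n)
      case 0
      show ?case using mono[of 0 "real N"] by simp
    next
      case (Suc n)
      show ?case
      proof (cases "n \<ge> N")
        case True
        then show ?thesis using Suc N[OF True] by (simp add: D_def algebra_simps)
      next
        case False
        have "\<psi> (real (Suc n)) \<le> \<psi> (real N)" using False by (intro mono) auto
        also have "\<dots> \<le> \<psi> (real N) + real (Suc n) * (t + \<epsilon>)" using t0 e by simp
        finally show ?thesis .
      qed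
    qed
    have "\<psi> x \<le> \<psi> (real N) + (x + 1) * (t + \<epsilon>)" if x: "x \<ge> 0" for x
    proof -
      have "\<psi> x \<le> \<psi> (real (nat \<lceil>x\<rceil>))" using x by (intro mono) linarith+
      also have "\<dots> \<le> \<psi> (real N) + real (nat \<lceil>x\<rceil>) * (t + \<epsilon>)" by (rule *)
      also have "\<dots> \<le> \<psi> (real N) + (x + 1) * (t + \<epsilon>)"
        using t0 e x by (intro add_left_mono mult_right_mono) linarith+
      finally show ?thesis .
    qed
    then show ?thesis by blast
  qed
  have ge: "t * a \<le> \<psi> (s + a) - \<psi> s" if "s \<ge> 0" "a \<ge> 0" for s a
  proof -
    have "(\<psi> s - (s - 1) * t) + n * (\<psi> (s + a) - \<psi> s - t * a) \<ge> 0" for n :: nat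
      using sum_le[OF that, of n] lower[of "s + n * a"] that by (simp add: algebra_simps)
    from arch[OF this] show ?thesis by simp
  qed
  have lim: "((\<lambda>s. \<psi> (s + a) - \<psi> s) \<longlongrightarrow> t * a) at_top" if a: "a > 0" for a
  proof (rule tendstoI)
    fix e :: real assume e: "e > 0"
    define \<epsilon> where "\<epsilon> = e / (4 * a)"
    have eps: "\<epsilon> > 0" using e a by (simp add: \<epsilon>_def)
    obtain C where C: "\<And>x. x \<ge> 0 \<Longrightarrow> \<psi> x \<le> C + (x + 1) * (t + \<epsilon>)" using upper[OF eps] by blast
    define K where "K = C + (a + 1) * (t + \<epsilon>)"
    \<comment> \<open>Spread over at least \<open>n0\<close> steps, the constant \<open>K\<close>
      contributes less than \<open>e / 2\<close> per step; together with
      \<open>\<epsilon> * a = e / 4\<close> the error stays below \<open>e\<close>.\<close>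
    obtain n0 :: nat where n0: "n0 * (e / 2) > K" "n0 > 0"
    proof -
      obtain m :: nat where m: "m * (e / 2) > K" using reals_Archimedean3[of "e / 2"] e by auto
      have "real (Suc m) * (e / 2) > K" using m e by (simp add: algebra_simps)
      then show ?thesis using that by blast
    qed
    have "\<psi> (s + a) - \<psi> s < t * a + e" if s: "s \<ge> n0 * a" for s
    proof -
      \<comment> \<open>Walk back from \<open>s\<close> in steps of \<open>a\<close> to the
        remainder \<open>s'\<close>. The increment at \<open>s\<close> is at most each of the
        \<open>n\<close> earlier ones, so \<open>n\<close> times it is at most the growth from
        \<open>s'\<close> to \<open>s\<close>.\<close>
      define n where "n = nat \<lfloor>s / a\<rfloor>"
      have sa: "s / a \<ge> n0" using s a by (simp add: field_simps)
      have n: "n \<ge> n0" unfolding n_def using sa by (simp add: le_nat_floor)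
      have rn: "real n \<le> s / a" "s / a < n + 1" using sa by (auto simp: n_def) linarith+
      define s' where "s' = s - n * a"
      have s': "0 \<le> s'" "s' < a" using rn a by (auto simp: s'_def field_simps)
      have s_eq: "s = s' + n * a" by (simp add: s'_def)
      have inc_le: "\<psi> (s + a) - \<psi> s \<le> \<psi> (s' + j * a + a) - \<psi> (s' + j * a)" if "j < n" for j :: nat
        using steps[of "s' + j * a" a "n - j"] s' a that by (simp add: s_eq of_nat_diff algebra_simps)
      have tele: "m * (\<psi> (s + a) - \<psi> s) \<le> \<psi> (s' + m * a) - \<psi> s'" if "m \<le> n" for m :: nat
        using that
      proof (induction m)
        case (Suc m)
        then show ?case using inc_le[of m] by (simp add: algebra_simps)
      qed simp
      have "n * (\<psi> (s + a) - \<psi> s) \<le> \<psi> s - \<psi> s'" using tele[of n] by (simp add: s_eq)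
      also have "\<dots> \<le> \<psi> s" using nonneg[OF s'(1)] by simp
      also have "\<dots> \<le> C + (s + 1) * (t + \<epsilon>)" using s' a by (intro C) (simp add: s_eq)
      also have "\<dots> \<le> C + ((n + 1) * a + 1) * (t + \<epsilon>)"
        using s' t0 eps by (intro add_left_mono mult_right_mono) (auto simp: s_eq algebra_simps)
      also have "\<dots> = n * (t * a + \<epsilon> * a) + (C + (a + 1) * (t + \<epsilon>))" by (simp add: algebra_simps)
      also have "\<dots> = n * (t * a + \<epsilon> * a) + K" by (simp add: K_def)
      also have "K < n * (e / 2)"
        using n e by (intro less_le_trans[OF n0(1)] mult_right_mono) auto
      also have "n * (t * a + \<epsilon> * a) + n * (e / 2) = n * (t * a + \<epsilon> * a + e / 2)" by (simp add: algebra_simps)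
      finally have "\<psi> (s + a) - \<psi> s < t * a + \<epsilon> * a + e / 2" using n n0(2) by simp
      then show ?thesis using a e by (simp add: \<epsilon>_def)
    qed
    moreover have "s \<ge> 0" if "s \<ge> n0 * a" for s
      using that a by (meson of_nat_0_le_iff order_trans less_imp_le mult_nonneg_nonneg)
    ultimately have "dist (\<psi> (s + a) - \<psi> s) (t * a) < e" if "s \<ge> n0 * a" for s
      using ge[of s a] a that by (fastforce simp: dist_real_def)
    then show "eventually (\<lambda>s. dist (\<psi> (s + a) - \<psi> s) (t * a) < e) at_top"
      unfolding eventually_at_top_linorder by blast
  qed
  show ?thesis
  proof (rule that[OF t0])
    show "((\<lambda>s. \<psi> (s + a) - \<psi> s) \<longlongrightarrow> t * a) at_top" if "a \<ge> 0" for a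
      using lim[of a] that by (cases "a = 0") auto
  qed
qed


context base_fixed_rep
begin

lemma radial_kernel_log_concave:
  assumes u: "u \<ge> 1" and w: "w \<ge> 1"
  shows "radial_kernel (u\<^sup>2) * radial_kernel (w\<^sup>2) \<le> (radial_kernel (u * w))\<^sup>2"
proof -
  have "1 \<le> w\<^sup>2" using w by simp
  then have "radial_kernel (w\<^sup>2) > 0" using radial_kernel_ge_1 by fastforce
  then show ?thesis
    using hyp_form_reverse_Cauchy_Schwarz[of "average w" "average u"]
    by (simp add: average_average u w power2_eq_square)
qed

text \<open>In logarithmic coordinates multiplication by \<open>u\<close> is translation by
  \<open>ln u\<close>, applied at \<open>real n + ln w\<close>; exponentiating the limit
  \<open>t * ln u\<close> gives \<open>u powr t\<close>.\<close>

lemma radial_kernel_ratio_limit: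
  obtains t where "t \<ge> 0"
    "\<And>u w. u \<ge> 1 \<Longrightarrow> w \<ge> 1 \<Longrightarrow> (\<lambda>n. radial_kernel (u * exp (real n) * w) / radial_kernel (exp (real n) * w)) \<longlonglongrightarrow> u powr t"
proof -
  define \<psi> where "\<psi> s = ln (radial_kernel (exp s))" for s
  have pos: "radial_kernel (exp s) > 0" "radial_kernel (exp s) \<ge> 1" if "s \<ge> 0" for s
    using radial_kernel_ge_1[of "exp s"] that by auto
  obtain t where t: "t \<ge> 0" "\<And>a. a \<ge> 0 \<Longrightarrow> ((\<lambda>s. \<psi> (s + a) - \<psi> s) \<longlongrightarrow> t * a) at_top"
  proof (rule midpoint_concave_increments[of \<psi>])
    show "\<psi> s \<ge> 0" if "s \<ge> 0" for s using pos[OF that] by (simp add: \<psi>_def)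
    show "\<psi> (2 * s) + \<psi> (2 * t) \<le> 2 * \<psi> (s + t)" if "s \<ge> 0" "t \<ge> 0" for s t
    proof -
      have "radial_kernel (exp (2 * s)) * radial_kernel (exp (2 * t)) \<le> (radial_kernel (exp (s + t)))\<^sup>2"
        using radial_kernel_log_concave[of "exp s" "exp t"] that by (simp add: exp_double exp_add)
      then have "ln (radial_kernel (exp (2 * s)) * radial_kernel (exp (2 * t))) \<le> ln ((radial_kernel (exp (s + t)))\<^sup>2)"
        using pos(1)[of "2 * s"] pos(1)[of "2 * t"] pos(1)[of "s + t"] that by (subst ln_le_cancel_iff) auto
      then show ?thesis
        using pos(1)[of "2 * s"] pos(1)[of "2 * t"] pos(1)[of "s + t"] that
        by (simp add: \<psi>_def ln_mult ln_realpow)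
    qed
  qed (rule that)
  have "(\<lambda>n. radial_kernel (u * exp (real n) * w) / radial_kernel (exp (real n) * w)) \<longlonglongrightarrow> u powr t"
    if u: "u \<ge> 1" and w: "w \<ge> 1" for u w
  proof -
    have "filterlim (\<lambda>n. real n + ln w) at_top sequentially"
      using filterlim_tendsto_add_at_top[OF tendsto_const[of "ln w"] filterlim_real_sequentially]
      by (simp add: add.commute)
    from filterlim_compose[OF t(2)[of "ln u"] this]
    have "(\<lambda>n. exp (\<psi> (real n + ln w + ln u) - \<psi> (real n + ln w))) \<longlonglongrightarrow> exp (t * ln u)"
      using u by (intro tendsto_exp) simp
    moreover have "exp (\<psi> (real n + ln w + ln u) - \<psi> (real n + ln w))
        = radial_kernel (u * exp (real n) * w) / radial_kernel (exp (real n) * w)" for n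
    proof -
      have "exp (real n + ln w + ln u) = u * exp (real n) * w" "exp (real n + ln w) = exp (real n) * w"
        using u w by (simp_all add: exp_add)
      then show ?thesis
        using pos(1)[of "real n + ln w + ln u"] pos(1)[of "real n + ln w"] u w
        by (simp add: \<psi>_def exp_diff)
    qed
    ultimately show ?thesis using u by (simp add: powr_def)
  qed
  then show ?thesis using t(1) that by blast
qed

text \<open>The vector \<open>x\<close> is a common eigenvector, in the closed forward cone, of the compressions of the
  operators \<open>lin_ext (\<rho> g)\<close> to the vectors fixed by the stabilizer of the base point. It is a limit
  point, in the sense of nested closed convex hulls, of the normalized averages over larger and
  larger spheres.\<close>

lemma fixed_eigenvector:
  obtains x t where "fst x = 1" "hyp_form x x \<ge> 0" "t \<ge> 0"
    "\<And>k. k \<in> carrier Is_hyp \<Longrightarrow> k hyp_base = hyp_base \<Longrightarrow> lin_ext (\<rho> k) x = x"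
    "\<And>g. g \<in> carrier Is_hyp \<Longrightarrow> hyp_form (lin_ext (\<rho> g) x) x = fst (g hyp_base) powr t * hyp_form x x"
proof -
  obtain t where t: "t \<ge> 0"
    "\<And>u w. u \<ge> 1 \<Longrightarrow> w \<ge> 1 \<Longrightarrow> (\<lambda>n. radial_kernel (u * exp (real n) * w) / radial_kernel (exp (real n) * w)) \<longlonglongrightarrow> u powr t"
    by (rule radial_kernel_ratio_limit) (rule that)
  define V where "V n = average (exp (real n))" for n
  \<comment> \<open>With first coordinate \<open>1\<close> and nonnegative form, the squared norm
    \<open>2 * (fst v)\<^sup>2 - hyp_form v v\<close> is at most \<open>2\<close>, so the normalized
    averages are bounded.\<close>
  define W where "W n = (1 / fst (V n)) *\<^sub>R V n" for n
  have V1: "fst (V n) \<ge> 1" for n by (simp add: V_def fst_average_ge_1)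
  have VV: "hyp_form (V n) (V n) \<ge> 0" for n
    using radial_kernel_ge_1[of "exp (real n) * exp (real n)"]
    by (simp add: V_def average_average mult_ge1_I)
  have W1: "fst (W n) = 1" for n using V1[of n] by (simp add: W_def)
  have WW: "hyp_form (W n) (W n) \<ge> 0" for n using VV[of n] by (simp add: W_def hyp_form_simps)
  have Wn: "(norm (W n))\<^sup>2 \<le> 2" for n using WW[of n] by (simp add: norm_eq_hyp_form W1)
  define C where "C n = closure (convex hull (W ` {n..}))" for n
  have C_sub: "C n \<subseteq> S" if "closed S" "convex S" "\<And>m. m \<ge> n \<Longrightarrow> W m \<in> S" for n S
    unfolding C_def using that by (intro closure_minimal hull_minimal) auto
  have "(\<Inter>n. C n) \<noteq> {}"
  proof (rule nested_bounded_convex_Inter_nonempty)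
    show "closed (C n)" "convex (C n)" for n by (simp_all add: C_def convex_closure)
    show "C n \<noteq> {}" for n by (auto simp: C_def)
    show "decseq C" unfolding C_def by (intro decseq_SucI closure_mono hull_mono image_mono) auto
    have "C 0 \<subseteq> cball 0 (sqrt 2)"
      by (rule C_sub) (use Wn in \<open>auto intro: real_le_rsqrt\<close>)
    then show "bounded (C 0)" using bounded_cball bounded_subset by blast
  qed
  then obtain x where x: "\<And>n. x \<in> C n" by blast
  have xS: "x \<in> S" if "closed S" "convex S" "\<And>m. W m \<in> S" for S using C_sub[of S 0] that x by blast
  have "x \<in> {v. fst v = 1}"
    by (rule xS) (auto intro!: closed_Collect_eq continuous_intros simp: convex_def W1 algebra_simps)
  then have x1: "fst x = 1" by simp
  have "x \<in> cball 0 (sqrt 2)"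
    by (rule xS) (use Wn in \<open>auto intro: real_le_rsqrt\<close>)
  then have "(norm x)\<^sup>2 \<le> (sqrt 2)\<^sup>2" by (intro power_mono) auto
  then have xx: "hyp_form x x \<ge> 0" by (simp add: norm_eq_hyp_form x1)
  have xk: "lin_ext (\<rho> k) x = x" if k: "k \<in> carrier Is_hyp" "k hyp_base = hyp_base" for k
  proof -
    note bl = bounded_linear_lin_ext[OF rho_carrier[OF k(1)]]
    note l = bounded_linear.linear[OF bl]
    have "x \<in> {v. lin_ext (\<rho> k) v = v}"
    proof (rule xS)
      show "closed {v. lin_ext (\<rho> k) v = v}"
        by (intro closed_Collect_eq linear_continuous_on[OF bl] continuous_intros)
      show "convex {v. lin_ext (\<rho> k) v = v}"
        by (simp add: convex_def linear_add[OF l] linear_scale[OF l])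
      show "W m \<in> {v. lin_ext (\<rho> k) v = v}" for m
        by (simp add: W_def V_def linear_scale[OF l] average_fixed[OF k])
    qed
    then show ?thesis by simp
  qed
  have "hyp_form (lin_ext (\<rho> g) x) x = fst (g hyp_base) powr t * hyp_form x x" if g: "g \<in> carrier Is_hyp" for g
  proof -
    note bl = bounded_linear_lin_ext[OF rho_carrier[OF g]]
    note l = bounded_linear.linear[OF bl]
    define u where "u = fst (g hyp_base)"
    have u: "u \<ge> 1" unfolding u_def by (intro hyp_space_fst_ge_1 Is_hyp_mem[OF g] hyp_base_mem)
    \<comment> \<open>\<open>y\<close> itself is not claimed to vanish. It is shown to be orthogonal
      to all averages, hence to \<open>x\<close>, which lies in the closed convex hull of multiples
      of averages; pairing with \<open>x\<close> then gives the eigenvalue equation.\<close>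
    define y where "y = lin_ext (\<rho> g) x - (u powr t) *\<^sub>R x"
    have yV: "hyp_form y (average w) = 0" if w: "w \<ge> 1" for w
    proof -
      define r where "r n = radial_kernel (u * exp (real n) * w) / radial_kernel (exp (real n) * w)" for n
      define F where "F v = hyp_form (lin_ext (\<rho> g) v - (u powr t) *\<^sub>R v) (average w)" for v
      have Fl: "bounded_linear F"
        unfolding F_def
        by (intro bounded_linear_compose[OF bounded_linear_hyp_form(1)] bounded_linear_sub bl bounded_linear_scaleR_right)
      \<comment> \<open>A factor that stays bounded in \<open>n\<close>, times the ratio error,
        which tends to \<open>0\<close>.\<close>
      have FW: "F (W n) = hyp_form (W n) (average w) * (r n - u powr t)" for n
      proof -
        have en: "exp (real n) \<ge> 1" by simp
        have k: "radial_kernel (exp (real n) * w) > 0"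
          using radial_kernel_ge_1[of "exp (real n) * w"] mult_ge1_I[OF en w] by fastforce
        have 1: "hyp_form (lin_ext (\<rho> g) (V n)) (average w) = radial_kernel (u * exp (real n) * w)"
          unfolding V_def u_def by (rule translated_average_average[OF g en w])
        have 2: "hyp_form (V n) (average w) = radial_kernel (exp (real n) * w)"
          unfolding V_def by (rule average_average[OF en w])
        have "fst (V n) > 0" using V1[of n] by linarith
        then show ?thesis using k
          by (simp add: F_def W_def linear_scale[OF l] hyp_form_simps 1 2 r_def) (simp add: field_simps)
      qed
      have "(\<lambda>n. F (W n)) \<longlonglongrightarrow> 0"
      proof (rule Lim_null_comparison)
        show "eventually (\<lambda>n. norm (F (W n)) \<le> (sqrt 2 * norm (average w)) * \<bar>r n - u powr t\<bar>) sequentially"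
        proof (intro always_eventually allI)
          fix n
          have "norm (W n) \<le> sqrt 2" using Wn by (intro real_le_rsqrt)
          then have "\<bar>hyp_form (W n) (average w)\<bar> \<le> sqrt 2 * norm (average w)"
            using hyp_form_bound[of "W n" "average w"] mult_right_mono[of "norm (W n)" "sqrt 2" "norm (average w)"]
            by simp
          then show "norm (F (W n)) \<le> (sqrt 2 * norm (average w)) * \<bar>r n - u powr t\<bar>"
            by (simp add: FW abs_mult mult_right_mono)
        qed
        have "(\<lambda>n. \<bar>r n - u powr t\<bar>) \<longlonglongrightarrow> \<bar>u powr t - u powr t\<bar>"
          unfolding r_def by (intro tendsto_intros t(2) u w)
        then show "(\<lambda>n. (sqrt 2 * norm (average w)) * \<bar>r n - u powr t\<bar>) \<longlonglongrightarrow> 0"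
          by (intro tendsto_mult_right_zero) simp
      qed
      then have lim: "eventually (\<lambda>n. dist (F (W n)) 0 < \<epsilon>) sequentially" if "\<epsilon> > 0" for \<epsilon>
        using that by (rule tendstoD)
      have "norm (F x) \<le> \<epsilon>" if e: "\<epsilon> > 0" for \<epsilon>
      proof -
        obtain N where N: "\<And>n. n \<ge> N \<Longrightarrow> dist (F (W n)) 0 < \<epsilon>"
          using lim[OF e] by (auto simp: eventually_sequentially)
        \<comment> \<open>The closed convex hull of a tail inherits the bound on the linear
          functional \<open>F\<close>, and \<open>x\<close> lies in all these hulls.\<close>
        have "C N \<subseteq> F -` cball 0 \<epsilon>"
        proof (rule C_sub)
          show "closed (F -` cball 0 \<epsilon>)"
            by (intro continuous_closed_vimage closed_cball linear_continuous_at Fl)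
          show "convex (F -` cball 0 \<epsilon>)"
            by (rule convex_linear_vimage[OF bounded_linear.linear[OF Fl] convex_cball])
        qed (use N in \<open>auto simp: less_imp_le\<close>)
        from subsetD[OF this x] show ?thesis by simp
      qed
      then have "norm (F x) \<le> 0" using field_le_epsilon[of "norm (F x)" 0] by simp
      then show ?thesis by (simp add: F_def y_def)
    qed
    have "x \<in> {v. hyp_form y v = 0}"
    proof (rule xS)
      show "closed {v. hyp_form y v = 0}"
        by (intro closed_Collect_eq linear_continuous_on bounded_linear_hyp_form continuous_intros)
      show "convex {v. hyp_form y v = 0}" by (simp add: convex_def hyp_form_simps)
      show "W m \<in> {v. hyp_form y v = 0}" for m using yV by (simp add: W_def V_def hyp_form_simps)
    qed
    then show ?thesis by (simp add: y_def hyp_form_simps u_def)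
  qed
  then show ?thesis using x1 xx t(1) xk that by blast
qed

end

section \<open>Classification\<close>

lemma irreducible_repD:
  assumes "irreducible_rep G \<rho>"
  shows "\<rho> \<in> hom G Is_hyp"
    "\<And>V. subspace V \<Longrightarrow> closed V \<Longrightarrow> (\<And>g v. g \<in> carrier G \<Longrightarrow> v \<in> V \<Longrightarrow> lin_ext (\<rho> g) v \<in> V) \<Longrightarrow> V = {0} \<or> V = UNIV"
  using assms unfolding irreducible_rep_def image_subset_iff by blast+

text \<open>By \<open>fst x = 1\<close> the line through \<open>x\<close> is the solution set of
  \<open>v = fst v *\<^sub>R x\<close>, which is visibly closed. Irreducibility would make it the
  whole space, which is contradicted by a unit vector \<open>h\<close> in the form
  \<open>(0, h)\<close>.\<close>

lemma irreducible_rep_no_invariant_line: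
  fixes \<rho> :: "'g \<Rightarrow> real \<times> 'k \<Rightarrow> real \<times> 'k::{real_inner, complete_space}"
  assumes irr: "irreducible_rep G \<rho>" and inf: "infinite_dim (UNIV :: 'k set)" and x: "fst x = 1"
    and inv: "\<And>g. g \<in> carrier G \<Longrightarrow> \<exists>c. lin_ext (\<rho> g) x = c *\<^sub>R x"
  shows False
proof -
  define V where "V = {v. v = fst v *\<^sub>R x}"
  have "subspace V"
    unfolding subspace_def V_def mem_Collect_eq
  proof (intro conjI ballI allI)
    show "c *\<^sub>R v = fst (c *\<^sub>R v) *\<^sub>R x" if "v \<in> {v. v = fst v *\<^sub>R x}" for c v
    proof -
      have "v = fst v *\<^sub>R x" using that by (rule CollectD)
      then have "c *\<^sub>R v = c *\<^sub>R (fst v *\<^sub>R x)" by (rule arg_cong)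
      then show ?thesis by (simp add: x)
    qed
  qed (simp_all add: scaleR_add_left)
  moreover have "closed V"
    unfolding V_def by (intro closed_Collect_eq continuous_intros)
  moreover have "lin_ext (\<rho> g) v \<in> V" if g: "g \<in> carrier G" and v: "v \<in> V" for g v
  proof -
    have "\<rho> g \<in> carrier Is_hyp" using irreducible_repD(1)[OF irr] g by (auto simp: hom_def)
    then have l: "linear (lin_ext (\<rho> g))" by (rule lin_extD)
    obtain c where c: "lin_ext (\<rho> g) x = c *\<^sub>R x" using inv[OF g] by blast
    have "lin_ext (\<rho> g) (fst v *\<^sub>R x) = (fst v * c) *\<^sub>R x" by (simp add: linear_scale[OF l] c)
    then have "lin_ext (\<rho> g) v = (fst v * c) *\<^sub>R x" using v by (simp add: V_def)
    then show ?thesis by (simp add: V_def x)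
  qed
  ultimately have "V = {0} \<or> V = UNIV" by (rule irreducible_repD(2)[OF irr])
  moreover have "x \<in> V" "x \<noteq> 0" using x by (auto simp: V_def)
  ultimately have V: "V = UNIV" by blast
  obtain h :: 'k where "norm h = 1"
    using infinite_dim_unit_orthogonal[OF finite.emptyI subspace_UNIV inf] by metis
  moreover have "(0 :: real, h) \<in> V" using V by blast
  ultimately show False by (auto simp: V_def prod_eq_iff)
qed

text \<open>The clauses of \<open>is_rho\<close> about the map \<open>f\<close>, with the form in
  place of \<open>cosh\<close> of the distance.\<close>

definition power_equivariant ::
    "((real \<times> 'h \<Rightarrow> real \<times> 'h::real_inner) \<Rightarrow> real \<times> 'k \<Rightarrow> real \<times> 'k::real_inner) \<Rightarrow> real \<Rightarrow> (real \<times> 'h \<Rightarrow> real \<times> 'k) \<Rightarrow> bool"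
  where "power_equivariant \<rho> t f \<longleftrightarrow> f \<in> hyp_space \<rightarrow> hyp_space \<and>
    (\<forall>g\<in>carrier Is_hyp. \<forall>x\<in>hyp_space. f (g x) = \<rho> g (f x)) \<and>
    (\<forall>x\<in>hyp_space. \<forall>y\<in>hyp_space. hyp_form (f x) (f y) = hyp_form x y powr t)"

lemma power_equivariantD:
  assumes "power_equivariant \<rho> t f"
  shows "x \<in> hyp_space \<Longrightarrow> f x \<in> hyp_space"
    "g \<in> carrier Is_hyp \<Longrightarrow> x \<in> hyp_space \<Longrightarrow> f (g x) = \<rho> g (f x)"
    "x \<in> hyp_space \<Longrightarrow> y \<in> hyp_space \<Longrightarrow> hyp_form (f x) (f y) = hyp_form x y powr t"
  using assms unfolding power_equivariant_def by blast+

text \<open>Two antipodal points at height \<open>u\<close> have the base point as midpoint and form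
  value \<open>2 * u\<^sup>2 - 1\<close>. The triangle inequality bounds its power by
  \<open>2 * (u powr t)\<^sup>2\<close>; dividing and letting \<open>u\<close> grow yields
  \<open>2 powr t \<le> 2\<close>.\<close>

lemma power_equivariant_exponent_le_1:
  fixes f :: "real \<times> 'h::real_inner \<Rightarrow> real \<times> 'k::real_inner"
  assumes f: "power_equivariant \<rho> t f" and t: "t > 0" and e: "norm (e :: 'h) = 1"
  shows "t \<le> 1"
proof -
  have le: "((2 * u\<^sup>2 - 1) / u\<^sup>2) powr t \<le> 2" if u: "u \<ge> 1" for u
  proof -
    let ?x = "sphere_point u e" and ?z = "sphere_point u (- e)"
    note fD = power_equivariantD[OF f]
    have x: "?x \<in> hyp_space" "?z \<in> hyp_space" using u e by (auto intro: sphere_point_mem)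
    have u2: "u\<^sup>2 \<ge> 1" using u by simp
    have xz: "hyp_form ?x ?z = 2 * u\<^sup>2 - 1"
      using u2 e by (simp add: sphere_point_def hyp_form_def dot_square_norm) (simp add: power2_eq_square)
    have "hyp_form (f ?x) (f ?z) \<le> 2 * (hyp_form (f ?x) (f hyp_base))\<^sup>2 - 1"
      by (rule hyp_form_triangle(2))
        (simp_all add: fD x hyp_form_base hyp_form_commute[of hyp_base])
    then have "(2 * u\<^sup>2 - 1) powr t \<le> 2 * (u powr t)\<^sup>2"
      by (simp add: fD x xz hyp_form_base)
    also have "(u powr t)\<^sup>2 = u\<^sup>2 powr t"
      using u by (simp add: power2_eq_square powr_mult)
    finally have "(2 * u\<^sup>2 - 1) powr t / u\<^sup>2 powr t \<le> 2" using u by (simp add: divide_le_eq)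
    moreover have "(2 * u\<^sup>2 - 1) powr t / u\<^sup>2 powr t = ((2 * u\<^sup>2 - 1) / u\<^sup>2) powr t"
      using u2 by (subst powr_divide) auto
    ultimately show ?thesis by simp
  qed
  have "(\<lambda>n. (2 - (1 / real (Suc n)) * (1 / real (Suc n))) powr t) \<longlonglongrightarrow> (2 - 0 * 0) powr t"
    by (intro tendsto_intros LIMSEQ_Suc[OF lim_1_over_n]) auto
  then have "(2 - 0 * 0) powr t \<le> 2"
  proof (rule LIMSEQ_le_const2)
    have "(2 - (1 / real (Suc n)) * (1 / real (Suc n))) powr t \<le> 2" for n
    proof -
      have "(2 * (real (Suc n))\<^sup>2 - 1) / (real (Suc n))\<^sup>2 = 2 - (1 / real (Suc n)) * (1 / real (Suc n))"
        by (simp add: diff_divide_distrib power2_eq_square)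
      then show ?thesis using le[of "real (Suc n)"] by simp
    qed
    then show "\<exists>N. \<forall>n\<ge>N. (2 - (1 / real (Suc n)) * (1 / real (Suc n))) powr t \<le> 2" by blast
  qed
  then have "2 powr t \<le> 2 powr (1 :: real)" by simp
  then show ?thesis by (subst (asm) powr_le_cancel_iff) auto
qed

theorem irreducible_rep_power_equivariant:
  fixes \<rho> :: "(real \<times> 'h \<Rightarrow> real \<times> 'h::{real_inner, complete_space}) \<Rightarrow> real \<times> 'k \<Rightarrow> real \<times> 'k::{real_inner, complete_space}"
  assumes sep: "separable_space (euclidean :: 'h topology)"
    and inf: "infinite_dim (UNIV :: 'h set)" "infinite_dim (UNIV :: 'k set)"
    and irr: "irreducible_rep Is_hyp \<rho>"
  obtains t f where "0 < t" "t \<le> 1" "power_equivariant \<rho> t f"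
proof -
  note hom = irreducible_repD(1)[OF irr]
  have \<rho>c: "\<rho> g \<in> carrier Is_hyp" if "g \<in> carrier Is_hyp" for g using hom that by (auto simp: hom_def)
  obtain p where p: "p \<in> hyp_space" "\<And>k. k \<in> carrier Is_hyp \<Longrightarrow> k hyp_base = hyp_base \<Longrightarrow> \<rho> k p = p"
    by (rule base_stabilizer_has_fixed_point[OF sep inf(1) hom]) (rule that)
  interpret P: base_fixed_rep \<rho> p by unfold_locales (use inf(1) hom p in auto)
  obtain x t where x: "fst x = 1" "hyp_form x x \<ge> 0" "t \<ge> 0"
    "\<And>k. k \<in> carrier Is_hyp \<Longrightarrow> k hyp_base = hyp_base \<Longrightarrow> lin_ext (\<rho> k) x = x"
    "\<And>g. g \<in> carrier Is_hyp \<Longrightarrow> hyp_form (lin_ext (\<rho> g) x) x = fst (g hyp_base) powr t * hyp_form x x"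
    by (rule P.fixed_eigenvector) (rule that)
  have xpos: "hyp_form x x > 0"
  proof (rule ccontr)
    assume "\<not> hyp_form x x > 0"
    then have x0: "hyp_form x x = 0" using x(2) by simp
    show False
    proof (rule irreducible_rep_no_invariant_line[OF irr inf(2) x(1)])
      fix g :: "real \<times> 'h \<Rightarrow> real \<times> 'h" assume g: "g \<in> carrier Is_hyp"
      \<comment> \<open>The image \<open>y\<close> of the isotropic \<open>x\<close> is isotropic
        and orthogonal to \<open>x\<close>. Subtracting the multiple of \<open>x\<close> with the
        same first coordinate leaves an isotropic vector with first coordinate \<open>0\<close>,
        which must vanish.\<close>
      define y where "y = lin_ext (\<rho> g) x"
      define z where "z = y - fst y *\<^sub>R x"
      have "hyp_form y y = 0" "hyp_form y x = 0"
        using x(5)[OF g] by (simp_all add: y_def lin_extD(3)[OF \<rho>c[OF g]] x0)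
      then have "hyp_form z z = 0" by (simp add: z_def hyp_form_simps x0 hyp_form_commute[of x y])
      moreover have "fst z = 0" by (simp add: z_def x(1))
      ultimately have "z = 0" by (simp add: hyp_form_def prod_eq_iff)
      then show "\<exists>c. lin_ext (\<rho> g) x = c *\<^sub>R x" by (auto simp: z_def y_def)
    qed
  qed
  define q where "q = (1 / sqrt (hyp_form x x)) *\<^sub>R x"
  have q: "q \<in> hyp_space" unfolding q_def by (rule hyp_space_normalize) (use xpos x(1) in auto)
  have qk: "\<rho> k q = q" if k: "k \<in> carrier Is_hyp" "k hyp_base = hyp_base" for k
  proof -
    note l = lin_extD(1)[OF \<rho>c[OF k(1)]]
    have "\<rho> k q = lin_ext (\<rho> k) q" using lin_extD(4)[OF \<rho>c[OF k(1)] q] by simp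
    also have "\<dots> = q" by (simp add: q_def linear_scale[OF l] x(4)[OF k])
    finally show ?thesis .
  qed
  \<comment> \<open>With \<open>q\<close> as the fixed point, the eigenvalue equation makes the
    kernel an exact power.\<close>
  interpret Q: base_fixed_rep \<rho> q by unfold_locales (use inf(1) hom q qk in auto)
  have qg: "hyp_form (\<rho> g q) q = fst (g hyp_base) powr t" if g: "g \<in> carrier Is_hyp" for g
  proof -
    note l = lin_extD(1)[OF \<rho>c[OF g]]
    have "\<rho> g q = (1 / sqrt (hyp_form x x)) *\<^sub>R lin_ext (\<rho> g) x"
      using lin_extD(4)[OF \<rho>c[OF g] q] by (simp add: q_def linear_scale[OF l])
    then have "hyp_form (\<rho> g q) q = (1 / sqrt (hyp_form x x))\<^sup>2 * hyp_form (lin_ext (\<rho> g) x) x"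
      by (simp add: q_def hyp_form_simps power2_eq_square)
    then show ?thesis using xpos by (simp add: x(5)[OF g] power_divide)
  qed
  have f: "power_equivariant \<rho> t Q.orbit_map"
    unfolding power_equivariant_def
  proof (intro conjI ballI funcsetI)
    fix a b :: "real \<times> 'h" assume ab: "a \<in> hyp_space" "b \<in> hyp_space"
    obtain g where g: "g \<in> carrier Is_hyp" "g hyp_base = b" using Is_hyp_transitive[OF hyp_base_mem ab(2)] .
    interpret G: group "Is_hyp :: (real \<times> 'h \<Rightarrow> real \<times> 'h) monoid" by (rule group_Is_hyp)
    obtain h where h: "h \<in> carrier Is_hyp" "h hyp_base = (inv\<^bsub>Is_hyp\<^esub> g) a"
      using Is_hyp_transitive[OF hyp_base_mem Is_hyp_mem[OF G.inv_closed[OF g(1)] ab(1)]] .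
    have a: "a = g (h hyp_base)" using Is_hyp_inv(2)[OF g(1) ab(1)] h(2) by simp
    have hb: "h hyp_base \<in> hyp_space" using h(1) by (simp add: Is_hyp_mem)
    have "hyp_form (Q.orbit_map a) (Q.orbit_map b)
        = hyp_form (\<rho> g (\<rho> h q)) (\<rho> g q)"
      using Q.orbit_map_equivariant[OF g(1) hb] Q.orbit_map_image[OF h(1)] Q.orbit_map_image[OF g(1)]
      by (simp add: a g(2))
    also have "\<dots> = hyp_form (\<rho> h q) q"
      by (rule Is_hyp_form[OF \<rho>c[OF g(1)] Is_hyp_mem[OF \<rho>c[OF h(1)] q] q])
    also have "\<dots> = fst (h hyp_base) powr t" by (rule qg[OF h(1)])
    also have "fst (h hyp_base) = hyp_form a b"
      using Is_hyp_form[OF g(1) hb hyp_base_mem] by (simp add: a g(2) hyp_form_base)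
    finally show "hyp_form (Q.orbit_map a) (Q.orbit_map b) = hyp_form a b powr t" .
  qed (auto simp: Q.orbit_map_mem Q.orbit_map_equivariant)
  \<comment> \<open>For \<open>t = 0\<close> no \<open>\<rho> g\<close> would displace
    \<open>q\<close>, and \<open>q\<close> would span an invariant line.\<close>
  have "t \<noteq> 0"
  proof
    assume t0: "t = 0"
    show False
    proof (rule irreducible_rep_no_invariant_line[OF irr inf(2) x(1)])
      fix g :: "real \<times> 'h \<Rightarrow> real \<times> 'h" assume g: "g \<in> carrier Is_hyp"
      note l = lin_extD(1)[OF \<rho>c[OF g]]
      have "fst (g hyp_base) > 0" using Is_hyp_mem[OF g hyp_base_mem] by (simp add: hyp_space_def)
      then have "hyp_form (\<rho> g q) q = 1" using qg[OF g] t0 by simp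
      then have "(norm (\<rho> g q - q))\<^sup>2 \<le> 0"
        using hyp_space_dist_le[OF Is_hyp_mem[OF \<rho>c[OF g] q] q] by simp
      then have "\<rho> g q = q" by simp
      then have "(1 / sqrt (hyp_form x x)) *\<^sub>R lin_ext (\<rho> g) x = (1 / sqrt (hyp_form x x)) *\<^sub>R x"
        using lin_extD(4)[OF \<rho>c[OF g] q] by (simp add: q_def linear_scale[OF l])
      then have "lin_ext (\<rho> g) x = x" using xpos by simp
      then show "\<exists>c. lin_ext (\<rho> g) x = c *\<^sub>R x" by (intro exI[of _ 1]) simp
    qed
  qed
  then have "t > 0" using x(3) by simp
  moreover obtain e :: 'h where "norm e = 1" using Q.exists_unit by blast
  ultimately show ?thesis using power_equivariant_exponent_le_1[OF f] f that by blast
qed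

section \<open>Conjugacy and the exponent\<close>

lemma irreducible_rep_equivariant_image_total:
  fixes \<rho> :: "(real \<times> 'h \<Rightarrow> real \<times> 'h::real_inner) \<Rightarrow> real \<times> 'k \<Rightarrow> real \<times> 'k::real_inner"
  assumes irr: "irreducible_rep Is_hyp \<rho>" and f: "power_equivariant \<rho> t f"
  shows "closed_span (f ` hyp_space) = UNIV"
proof -
  note fD = power_equivariantD[OF f]
  have \<rho>c: "\<rho> g \<in> carrier Is_hyp" if "g \<in> carrier Is_hyp" for g
    using irreducible_repD(1)[OF irr] that by (auto simp: hom_def)
  have "closed_span (f ` hyp_space) = {0} \<or> closed_span (f ` hyp_space) = UNIV"
  proof (rule irreducible_repD(2)[OF irr subspace_closed_span closed_closure])
    fix g :: "real \<times> 'h \<Rightarrow> real \<times> 'h" and v assume g: "g \<in> carrier Is_hyp" and v: "v \<in> closed_span (f ` hyp_space)"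
    show "lin_ext (\<rho> g) v \<in> closed_span (f ` hyp_space)"
    proof (rule linear_image_closed_span[OF bounded_linear_lin_ext[OF \<rho>c[OF g]] _ v])
      fix s assume "s \<in> f ` hyp_space"
      then obtain x where x: "x \<in> hyp_space" "s = f x" by blast
      have "lin_ext (\<rho> g) s = f (g x)" using lin_extD(4)[OF \<rho>c[OF g] fD(1)[OF x(1)]] fD(2)[OF g x(1)] x(2) by simp
      then show "lin_ext (\<rho> g) s \<in> closed_span (f ` hyp_space)"
        using Is_hyp_mem[OF g x(1)] by (simp add: closed_span_base)
    qed
  qed
  moreover have "f hyp_base \<in> closed_span (f ` hyp_space)" by (simp add: closed_span_base)
  moreover have "f hyp_base \<noteq> 0" using fD(1)[OF hyp_base_mem] by (auto simp: hyp_space_def)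
  ultimately show ?thesis by blast
qed

text \<open>Consistency comes from nondegeneracy: an error vector is orthogonal to the total family
  \<open>\<psi>\<close>, hence zero. Preserving an indefinite form does not by itself bound norms;
  the bound comes from splitting off the component along \<open>\<psi> x0\<close>, on whose
  complement the form controls the norm.\<close>

lemma form_isometry_extension:
  fixes \<phi> \<psi> :: "'a \<Rightarrow> real \<times> 'k::{real_inner, complete_space}"
  assumes form: "\<And>x y. x \<in> X \<Longrightarrow> y \<in> X \<Longrightarrow> hyp_form (\<psi> x) (\<psi> y) = hyp_form (\<phi> x) (\<phi> y)"
    and total: "closed_span (\<phi> ` X) = UNIV" "closed_span (\<psi> ` X) = UNIV"
    and x0: "x0 \<in> X" "\<psi> x0 \<in> hyp_space"
  obtains A where "bounded_linear A" "\<And>x. x \<in> X \<Longrightarrow> A (\<phi> x) = \<psi> x" "\<And>v w. hyp_form (A v) (A w) = hyp_form v w"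
proof -
  \<comment> \<open>A linear map can be prescribed freely only on an independent set; that it sends
    the remaining \<open>\<phi> x\<close> to \<open>\<psi> x\<close> as well is
    \<open>g\<phi>\<close>.\<close>
  obtain B where B: "B \<subseteq> \<phi> ` X" "independent B" "\<phi> ` X \<subseteq> span B"
    using maximal_independent_subset by metis
  obtain g where g: "linear g" "\<And>b. b \<in> B \<Longrightarrow> g b = \<psi> (inv_into X \<phi> b)"
    using linear_independent_extend[OF B(2), of "\<lambda>b. \<psi> (inv_into X \<phi> b)"] by blast
  have gform: "hyp_form (g v) (\<psi> y) = hyp_form v (\<phi> y)" if "v \<in> span B" "y \<in> X" for v y
  proof -
    have "span B \<subseteq> {v. hyp_form (g v) (\<psi> y) = hyp_form v (\<phi> y)}"
    proof (rule span_minimal)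
      show "B \<subseteq> {v. hyp_form (g v) (\<psi> y) = hyp_form v (\<phi> y)}"
      proof
        fix b assume b: "b \<in> B"
        then have "b \<in> \<phi> ` X" using B(1) by blast
        then have "inv_into X \<phi> b \<in> X" "\<phi> (inv_into X \<phi> b) = b"
          by (rule inv_into_into, rule f_inv_into_f)
        then show "b \<in> {v. hyp_form (g v) (\<psi> y) = hyp_form v (\<phi> y)}"
          using form[OF _ that(2)] g(2)[OF b] by simp
      qed
      show "subspace {v. hyp_form (g v) (\<psi> y) = hyp_form v (\<phi> y)}"
        by (simp add: subspace_def linear_0[OF g(1)] linear_add[OF g(1)] linear_scale[OF g(1)] hyp_form_simps)
    qed
    then show ?thesis using that(1) by blast
  qed
  have g\<phi>: "g (\<phi> x) = \<psi> x" if x: "x \<in> X" for x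
  proof -
    have "\<phi> x \<in> span B" using B(3) x by blast
    then have 0: "hyp_form (g (\<phi> x) - \<psi> x) s = 0" if "s \<in> \<psi> ` X" for s
    proof -
      obtain y where y: "y \<in> X" "s = \<psi> y" using \<open>s \<in> \<psi> ` X\<close> by blast
      show ?thesis unfolding y(2) hyp_form_simps gform[OF \<open>\<phi> x \<in> span B\<close> y(1)] form[OF x y(1)] by simp
    qed
    have "hyp_form (g (\<phi> x) - \<psi> x) w = 0" for w
    proof (rule linear_eq_on_closed_span[where V = "\<lambda>_. 0" and S = "\<psi> ` X"])
      show "bounded_linear (hyp_form (g (\<phi> x) - \<psi> x))" by (rule bounded_linear_hyp_form)
    qed (use 0 total(2) in \<open>auto simp: bounded_linear_zero\<close>)
    then have "g (\<phi> x) - \<psi> x = 0" by (intro hyp_form_nondegenerate)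
    then show ?thesis by simp
  qed
  have gg: "hyp_form (g v) (g w) = hyp_form v w" if "v \<in> span B" "w \<in> span B" for v w
  proof -
    have "span B \<subseteq> {w. hyp_form (g v) (g w) = hyp_form v w}"
    proof (rule span_minimal)
      show "B \<subseteq> {w. hyp_form (g v) (g w) = hyp_form v w}"
        using B(1) gform[OF that(1)] g\<phi> by auto
      show "subspace {w. hyp_form (g v) (g w) = hyp_form v w}"
        by (simp add: subspace_def linear_0[OF g(1)] linear_add[OF g(1)] linear_scale[OF g(1)] hyp_form_simps)
    qed
    then show ?thesis using that(2) by blast
  qed
  define p q where "p = \<phi> x0" and "q = \<psi> x0"
  have q: "q \<in> hyp_space" using x0 by (simp add: q_def)
  \<comment> \<open>The first summand bounds the component along \<open>q\<close>, the second the
    component orthogonal to \<open>q\<close>, by \<open>norm_orthogonal_le\<close>.\<close>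
  define K where "K = norm p * norm q + sqrt (2 * (fst q)\<^sup>2 * ((norm p)\<^sup>2 + 1))"
  have bound: "norm (g v) \<le> K * norm v" if v: "v \<in> span B" for v
  proof -
    define c where "c = hyp_form v p"
    define w where "w = g v - c *\<^sub>R q"
    have gq: "hyp_form (g v) q = c" using gform[OF v x0(1)] by (simp add: c_def p_def q_def)
    have c: "\<bar>c\<bar> \<le> norm v * norm p" unfolding c_def by (rule hyp_form_bound)
    then have c2: "c\<^sup>2 \<le> (norm v * norm p)\<^sup>2" by (metis abs_ge_zero power2_abs power_mono)
    have "hyp_form w q = 0" by (simp add: w_def hyp_form_simps gq hyp_form_self[OF q])
    then have "(norm w)\<^sup>2 \<le> 2 * (fst q)\<^sup>2 * (- hyp_form w w)" by (rule norm_orthogonal_le[OF q])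
    also have "- hyp_form w w = c\<^sup>2 - hyp_form v v"
      unfolding w_def hyp_form_simps hyp_form_commute[of q "g v"] gq hyp_form_self[OF q] gg[OF v v]
      by (simp add: power2_eq_square)
    also have "2 * (fst q)\<^sup>2 * (c\<^sup>2 - hyp_form v v) \<le> 2 * (fst q)\<^sup>2 * (((norm p)\<^sup>2 + 1) * (norm v)\<^sup>2)"
    proof (rule mult_left_mono)
      show "c\<^sup>2 - hyp_form v v \<le> ((norm p)\<^sup>2 + 1) * (norm v)\<^sup>2"
      proof -
        have "- hyp_form v v \<le> (norm v)\<^sup>2" unfolding power2_eq_square using hyp_form_bound[of v v] by linarith
        then have "c\<^sup>2 + - hyp_form v v \<le> (norm v * norm p)\<^sup>2 + (norm v)\<^sup>2" by (rule add_mono[OF c2])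
        then show ?thesis unfolding power_mult_distrib by (simp add: algebra_simps)
      qed
    qed simp
    also have "\<dots> = (sqrt (2 * (fst q)\<^sup>2 * ((norm p)\<^sup>2 + 1)) * norm v)\<^sup>2" by (simp add: power_mult_distrib)
    finally have "norm w \<le> sqrt (2 * (fst q)\<^sup>2 * ((norm p)\<^sup>2 + 1)) * norm v"
      by (rule power2_le_imp_le) simp
    moreover have "norm (g v) \<le> \<bar>c\<bar> * norm q + norm w"
      using norm_triangle_ineq[of "c *\<^sub>R q" w] by (simp add: w_def)
    moreover have "\<bar>c\<bar> * norm q \<le> norm v * norm p * norm q" using c by (intro mult_right_mono) auto
    ultimately show ?thesis by (simp add: K_def algebra_simps)
  qed
  have dense: "closure (span B) = UNIV"
  proof -
    have "span (\<phi> ` X) \<subseteq> span B" using B(3) by (intro span_minimal) auto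
    then have "closure (span (\<phi> ` X)) \<subseteq> closure (span B)" by (rule closure_mono)
    then show ?thesis using total(1) by blast
  qed
  obtain A where A: "bounded_linear A" "\<And>v. v \<in> span B \<Longrightarrow> A v = g v"
    by (rule bounded_linear_extension_dense[OF subspace_span dense g(1), of K]) (erule bound, rule that)
  have "hyp_form (A v) (A w) = hyp_form v w" for v w
  proof -
    have "v \<in> closure (span B)" "w \<in> closure (span B)" using dense by auto
    then obtain Xs Ys where X: "\<And>n. Xs n \<in> span B" "Xs \<longlonglongrightarrow> v" and Y: "\<And>n. Ys n \<in> span B" "Ys \<longlonglongrightarrow> w"
      unfolding closure_sequential by blast
    have "(\<lambda>n. hyp_form (A (Xs n)) (A (Ys n))) \<longlonglongrightarrow> hyp_form (A v) (A w)"
      by (intro tendsto_hyp_form bounded_linear.tendsto[OF A(1)] X Y)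
    moreover have "(\<lambda>n. hyp_form (Xs n) (Ys n)) \<longlonglongrightarrow> hyp_form v w" by (intro tendsto_hyp_form X Y)
    ultimately show ?thesis using LIMSEQ_unique by (simp add: A(2) X(1) Y(1) gg)
  qed
  moreover have "A (\<phi> x) = \<psi> x" if "x \<in> X" for x
  proof -
    have "\<phi> x \<in> span B" using B(3) that by blast
    then show ?thesis by (simp add: A(2) g\<phi> that)
  qed
  ultimately show ?thesis using A(1) that by blast
qed

text \<open>The families \<open>f'\<close> and \<open>f\<close> are total with equal form values, so
  \<open>A\<close> matches them, and the map \<open>A'\<close> in the opposite direction shows that
  \<open>A\<close> is onto. Equivariance on the total family \<open>f'\<close> makes
  \<open>A\<close> intertwine the linear extensions.\<close>

lemma equal_exponent_imp_conjugate:
  fixes \<rho> \<sigma> :: "(real \<times> 'h \<Rightarrow> real \<times> 'h::real_inner) \<Rightarrow> real \<times> 'k \<Rightarrow> real \<times> 'k::{real_inner, complete_space}"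
  assumes \<rho>: "irreducible_rep Is_hyp \<rho>" "power_equivariant \<rho> t f"
    and \<sigma>: "irreducible_rep Is_hyp \<sigma>" "power_equivariant \<sigma> t f'"
  shows "conjugate_reps Is_hyp \<rho> \<sigma>"
proof -
  interpret K: group "Is_hyp :: (real \<times> 'k \<Rightarrow> real \<times> 'k) monoid" by (rule group_Is_hyp)
  note fD = power_equivariantD[OF \<rho>(2)] and fD' = power_equivariantD[OF \<sigma>(2)]
  note tot = irreducible_rep_equivariant_image_total[OF \<rho>] irreducible_rep_equivariant_image_total[OF \<sigma>]
  have \<rho>c: "\<rho> g \<in> carrier Is_hyp" and \<sigma>c: "\<sigma> g \<in> carrier Is_hyp" if "g \<in> carrier Is_hyp" for g
    using irreducible_repD(1)[OF \<rho>(1)] irreducible_repD(1)[OF \<sigma>(1)] that by (auto simp: hom_def)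
  obtain A where A: "bounded_linear A" "\<And>x. x \<in> hyp_space \<Longrightarrow> A (f' x) = f x"
    "\<And>v w. hyp_form (A v) (A w) = hyp_form v w"
    by (rule form_isometry_extension[of hyp_space f f' hyp_base]) (use fD fD' tot in auto)
  obtain A' where A': "bounded_linear A'" "\<And>x. x \<in> hyp_space \<Longrightarrow> A' (f x) = f' x"
    by (rule form_isometry_extension[of hyp_space f' f hyp_base]) (use fD fD' tot in auto)
  have "(A \<circ> A') v = id v" for v
  proof (rule linear_eq_on_closed_span[of "A \<circ> A'" id "f ` hyp_space"])
    show "bounded_linear (A \<circ> A')" unfolding comp_def by (rule bounded_linear_compose[OF A(1) A'(1)])
    show "bounded_linear (id :: real \<times> 'k \<Rightarrow> _)" by (simp add: id_def bounded_linear_ident)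
  qed (use A(2) A'(2) tot(1) in auto)
  then have "surj A" by (intro surjI[of _ A']) simp
  define a where "a = restrict A hyp_space"
  note a = Is_hyp_of_linear[OF bounded_linear.linear[OF A(1)] A(3) \<open>surj A\<close> fD'(1)[OF hyp_base_mem]]
  have ac: "a \<in> carrier Is_hyp" unfolding a_def by (rule a(1)) (simp add: A(2) fD)
  have aA: "a v = A v" if "v \<in> hyp_space" for v using that by (simp add: a_def)
  have "\<rho> g = a \<otimes>\<^bsub>Is_hyp\<^esub> \<sigma> g \<otimes>\<^bsub>Is_hyp\<^esub> inv\<^bsub>Is_hyp\<^esub> a" (is "_ = ?c") if g: "g \<in> carrier Is_hyp" for g
  proof -
    have comm: "(lin_ext (\<rho> g) \<circ> A) v = (A \<circ> lin_ext (\<sigma> g)) v" for v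
    proof (rule linear_eq_on_closed_span[of "lin_ext (\<rho> g) \<circ> A" "A \<circ> lin_ext (\<sigma> g)" "f' ` hyp_space"])
      show "bounded_linear (lin_ext (\<rho> g) \<circ> A)" "bounded_linear (A \<circ> lin_ext (\<sigma> g))"
        unfolding comp_def
        by (rule bounded_linear_compose[OF bounded_linear_lin_ext[OF \<rho>c[OF g]] A(1)]
            bounded_linear_compose[OF A(1) bounded_linear_lin_ext[OF \<sigma>c[OF g]]])+
      fix s assume "s \<in> f' ` hyp_space"
      then obtain x where x: "x \<in> hyp_space" "s = f' x" by blast
      show "(lin_ext (\<rho> g) \<circ> A) s = (A \<circ> lin_ext (\<sigma> g)) s"
        using lin_extD(4)[OF \<rho>c[OF g] fD(1)[OF x(1)]] lin_extD(4)[OF \<sigma>c[OF g] fD'(1)[OF x(1)]]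
        by (simp add: x A(2) fD(2)[OF g x(1), symmetric] fD'(2)[OF g x(1), symmetric] Is_hyp_mem[OF g])
    qed (use tot in auto)
    show "\<rho> g = ?c"
    proof (rule Is_hyp_eqI[OF \<rho>c[OF g]])
      show "?c \<in> carrier Is_hyp"
        by (intro K.m_closed K.inv_closed ac \<sigma>c[OF g])
      fix v :: "real \<times> 'k" assume v: "v \<in> hyp_space"
      define w where "w = (inv\<^bsub>Is_hyp\<^esub> a) v"
      have w: "w \<in> hyp_space" "v = A w"
        using v Is_hyp_inv(2)[OF ac v] aA by (auto simp: w_def Is_hyp_mem ac)
      have "?c v = a (\<sigma> g w)"
        using v w(1) by (simp add: Is_hyp_mult ac \<sigma>c[OF g] w_def[symmetric])
      also have "\<dots> = A (lin_ext (\<sigma> g) w)"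
        using lin_extD(4)[OF \<sigma>c[OF g] w(1)] aA Is_hyp_mem[OF \<sigma>c[OF g] w(1)] by simp
      also have "\<dots> = lin_ext (\<rho> g) v" using comm[of w] by (simp add: w(2))
      also have "\<dots> = \<rho> g v" by (rule lin_extD(4)[OF \<rho>c[OF g] v])
      finally show "\<rho> g v = ?c v" by simp
    qed
  qed
  then show ?thesis unfolding conjugate_reps_def using ac by blast
qed

text \<open>Conjugation changes the displacement of a point only by a bounded amount, while the
  displacement of \<open>f hyp_base\<close> grows like \<open>t * ln u\<close>.\<close>

lemma conjugate_imp_exponent_le:
  fixes \<rho> \<sigma> :: "(real \<times> 'h \<Rightarrow> real \<times> 'h::real_inner) \<Rightarrow> real \<times> 'k \<Rightarrow> real \<times> 'k::real_inner"
  assumes conj: "conjugate_reps Is_hyp \<rho> \<sigma>" and e: "norm (e :: 'h) = 1"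
    and \<rho>: "\<rho> \<in> hom Is_hyp Is_hyp" "power_equivariant \<rho> s f"
    and \<sigma>: "\<sigma> \<in> hom Is_hyp Is_hyp" "power_equivariant \<sigma> t f'"
  shows "s \<le> t"
proof (rule ccontr)
  assume "\<not> s \<le> t"
  interpret K: group "Is_hyp :: (real \<times> 'k \<Rightarrow> real \<times> 'k) monoid" by (rule group_Is_hyp)
  note fD = power_equivariantD[OF \<rho>(2)] and fD' = power_equivariantD[OF \<sigma>(2)]
  obtain a where a: "a \<in> carrier Is_hyp"
    "\<And>g. g \<in> carrier Is_hyp \<Longrightarrow> \<rho> g = a \<otimes>\<^bsub>Is_hyp\<^esub> \<sigma> g \<otimes>\<^bsub>Is_hyp\<^esub> inv\<^bsub>Is_hyp\<^esub> a"
    using conj unfolding conjugate_reps_def by blast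
  define x y where "x = f hyp_base" and "y = a (f' hyp_base)"
  have xy: "x \<in> hyp_space" "y \<in> hyp_space" "f' hyp_base \<in> hyp_space"
    by (auto simp: x_def y_def fD fD' Is_hyp_mem[OF a(1)])
  \<comment> \<open>Two triangle inequalities, along \<open>\<rho> g x\<close>,
    \<open>\<rho> g y\<close>, \<open>y\<close>, \<open>x\<close>, each contribute a factor
    \<open>2 * hyp_form x y\<close>.\<close>
  define C where "C = 4 * (hyp_form x y)\<^sup>2"
  have le: "u powr s \<le> C * u powr t" if u: "u \<ge> 1" for u
  proof -
    obtain g where g: "g \<in> carrier Is_hyp" "g hyp_base = sphere_point u e"
      using Is_hyp_transitive[OF hyp_base_mem sphere_point_mem[OF u e]] .
    have \<rho>g: "\<rho> g \<in> carrier Is_hyp" and \<sigma>g: "\<sigma> g \<in> carrier Is_hyp"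
      using \<rho>(1) \<sigma>(1) g(1) by (auto simp: hom_def)
    have fg: "hyp_form (sphere_point u e) hyp_base = u" by (simp add: hyp_form_base)
    have "u powr s = hyp_form (\<rho> g x) x"
      using fD(3)[of "g hyp_base" hyp_base] fD(2)[OF g(1) hyp_base_mem] sphere_point_mem[OF u e]
      by (simp add: g(2) fg x_def)
    also have "\<dots> \<le> 2 * hyp_form (\<rho> g x) (\<rho> g y) * hyp_form (\<rho> g y) x"
      by (intro hyp_form_triangle(1) Is_hyp_mem[OF \<rho>g] xy)
    also have "hyp_form (\<rho> g x) (\<rho> g y) = hyp_form x y" by (rule Is_hyp_form[OF \<rho>g xy(1,2)])
    also have "2 * hyp_form x y * hyp_form (\<rho> g y) x \<le> 2 * hyp_form x y * (2 * hyp_form (\<rho> g y) y * hyp_form y x)"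
      using hyp_form_ge_1[OF xy(1,2)] by (intro mult_left_mono hyp_form_triangle(1) Is_hyp_mem[OF \<rho>g] xy) auto
    also have "\<rho> g y = a (\<sigma> g (f' hyp_base))"
      using a(2)[OF g(1)] xy by (simp add: Is_hyp_mult a(1) \<sigma>g y_def Is_hyp_inv Is_hyp_mem)
    also have "hyp_form (a (\<sigma> g (f' hyp_base))) y = hyp_form (\<sigma> g (f' hyp_base)) (f' hyp_base)"
      unfolding y_def by (intro Is_hyp_form a(1) Is_hyp_mem[OF \<sigma>g] xy)
    also have "\<dots> = u powr t"
      using fD'(3)[of "g hyp_base" hyp_base] fD'(2)[OF g(1) hyp_base_mem] sphere_point_mem[OF u e]
      by (simp add: g(2) fg)
    finally show ?thesis by (simp add: C_def hyp_form_commute[of y x] power2_eq_square mult_ac)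
  qed
  define d where "d = s - t"
  have d: "d > 0" using \<open>\<not> s \<le> t\<close> by (simp add: d_def)
  have C1: "C \<ge> 1" using one_le_power[OF hyp_form_ge_1[OF xy(1,2)], of 2] unfolding C_def by linarith
  \<comment> \<open>Chosen so that \<open>u powr (s - t)\<close> equals \<open>C + 1\<close> and
    exceeds the constant in \<open>le\<close>.\<close>
  define u where "u = (C + 1) powr (1 / d)"
  have u1: "u \<ge> 1" unfolding u_def using C1 d by (intro ge_one_powr_ge_zero) auto
  have "u powr d = C + 1" using d C1 by (simp add: u_def powr_powr)
  moreover have "u powr s = u powr d * u powr t" by (simp add: d_def flip: powr_add)
  ultimately have "(C + 1) * u powr t \<le> C * u powr t" using le[OF u1] by simp
  then show False using u1 by (simp add: algebra_simps)
qed

lemma conjugate_reps_sym: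
  fixes \<rho> \<sigma> :: "'g \<Rightarrow> real \<times> 'k \<Rightarrow> real \<times> 'k::real_inner"
  assumes "conjugate_reps G \<rho> \<sigma>" and \<sigma>: "\<sigma> \<in> hom G Is_hyp"
  shows "conjugate_reps G \<sigma> \<rho>"
proof -
  interpret K: group "Is_hyp :: (real \<times> 'k \<Rightarrow> real \<times> 'k) monoid" by (rule group_Is_hyp)
  obtain a where a: "a \<in> carrier Is_hyp"
    "\<And>g. g \<in> carrier G \<Longrightarrow> \<rho> g = a \<otimes>\<^bsub>Is_hyp\<^esub> \<sigma> g \<otimes>\<^bsub>Is_hyp\<^esub> inv\<^bsub>Is_hyp\<^esub> a"
    using assms(1) unfolding conjugate_reps_def by blast
  have "\<sigma> g = inv\<^bsub>Is_hyp\<^esub> a \<otimes>\<^bsub>Is_hyp\<^esub> \<rho> g \<otimes>\<^bsub>Is_hyp\<^esub> inv\<^bsub>Is_hyp\<^esub> (inv\<^bsub>Is_hyp\<^esub> a)" if "g \<in> carrier G" for g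
  proof -
    have "\<sigma> g \<in> carrier Is_hyp" using \<sigma> that by (auto simp: hom_def)
    then show ?thesis using a by (simp add: a(2)[OF that] K.m_assoc[symmetric]) (simp add: K.m_assoc)
  qed
  then show ?thesis unfolding conjugate_reps_def using a(1) K.inv_closed by blast
qed

lemma is_rho_power_equivariant:
  assumes "is_rho t \<rho>"
  obtains f where "power_equivariant \<rho> t f"
proof -
  obtain f where f: "f \<in> hyp_space \<rightarrow> hyp_space"
    "\<forall>g\<in>carrier Is_hyp. \<forall>x\<in>hyp_space. f (g x) = \<rho> g (f x)"
    "\<forall>x\<in>hyp_space. \<forall>y\<in>hyp_space. cosh (hyp_dist (f x) (f y)) = cosh (hyp_dist x y) powr t"
    using assms unfolding is_rho_def by blast
  have "hyp_form (f x) (f y) = hyp_form x y powr t" if "x \<in> hyp_space" "y \<in> hyp_space" for x y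
    using f(3) that funcset_mem[OF f(1)] by (metis cosh_hyp_dist)
  then show ?thesis using f(1,2) that unfolding power_equivariant_def by blast
qed

theorem theorem2:
  fixes rho_inf :: "real \<Rightarrow> (real \<times> 'h \<Rightarrow> real \<times> 'h) \<Rightarrow> real \<times> 'h::{real_inner, complete_space} \<Rightarrow> real \<times> 'h"
    and \<rho> :: "(real \<times> 'h \<Rightarrow> real \<times> 'h) \<Rightarrow> real \<times> 'h \<Rightarrow> real \<times> 'h"
  assumes "separable_space (euclidean :: 'h topology)"
    and "\<And>S :: 'h set. finite S \<Longrightarrow> span S \<noteq> UNIV"
    and "\<And>t. 0 < t \<Longrightarrow> t \<le> 1 \<Longrightarrow> is_rho t (rho_inf t)"
    and "irreducible_rep Is_hyp \<rho>"
  shows "\<exists>!t. 0 < t \<and> t \<le> 1 \<and> conjugate_reps Is_hyp \<rho> (rho_inf t)"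
proof -
  have inf: "infinite_dim (UNIV :: 'h set)"
    using assms(2) unfolding infinite_dim_def by blast
  have irr: "irreducible_rep Is_hyp (rho_inf t)" if "0 < t" "t \<le> 1" for t
    using assms(3)[OF that] by (simp add: is_rho_def)
  note hom = irreducible_repD(1)[OF assms(4)] and hom' = irreducible_repD(1)[OF irr]
  obtain t f where t: "0 < t" "t \<le> 1" and f: "power_equivariant \<rho> t f"
    by (rule irreducible_rep_power_equivariant[OF assms(1) inf inf assms(4)]) (rule that)
  obtain e :: 'h where e: "norm e = 1"
    using infinite_dim_unit_orthogonal[OF finite.emptyI subspace_UNIV inf] by metis
  show ?thesis
  proof (rule ex1I[of _ t])
    obtain f' where "power_equivariant (rho_inf t) t f'"
      using is_rho_power_equivariant[OF assms(3)[OF t]] .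
    then show "0 < t \<and> t \<le> 1 \<and> conjugate_reps Is_hyp \<rho> (rho_inf t)"
      using equal_exponent_imp_conjugate[OF assms(4) f irr[OF t]] t by blast
  next
    fix s assume s: "0 < s \<and> s \<le> 1 \<and> conjugate_reps Is_hyp \<rho> (rho_inf s)"
    then have h: "rho_inf s \<in> hom Is_hyp Is_hyp" by (intro hom') auto
    obtain f' where f': "power_equivariant (rho_inf s) s f'"
      using is_rho_power_equivariant[OF assms(3)] s by blast
    \<comment> \<open>Comparison of displacements gives one inequality; reversing the conjugacy
      gives the other.\<close>
    have "t \<le> s" using conjugate_imp_exponent_le[OF _ e hom f h f'] s by blast
    moreover have "s \<le> t"
      using conjugate_imp_exponent_le[OF conjugate_reps_sym[OF _ h] e h f' hom f] s by blast
    ultimately show "s = t" by simp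
  qed
qed

end
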